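(* Fix a prime $p$ and $\theta\in\Omega_p$, let $\Gamma=\mathbb{Z}[\tfrac1p]\times\mathbb{Z}[\tfrac1p]$, and consider the spectral triple $(\mathcal{A}^{\mathcal S}_\theta,\ell^2(\Gamma),\mathcal{D}_p)$ with representation $\lambda_{\sigma_\theta}$ and smooth subalgebra $C_C(\Gamma,\sigma_\theta)$. Let $L_{\mathcal{D}_p}(a)=\|[\mathcal{D}_p,\lambda_{\sigma_\theta}(a)]\|_{\mathcal{B}(\ell^2(\Gamma))}$ for self-adjoint $a\in C_C(\Gamma,\sigma_\theta)$. Then $(\mathcal{A}^{\mathcal S}_\theta,L_{\mathcal{D}_p})$ is a Leibniz quantum compact metric space.
   Context: $\mathbb{Z}[\tfrac1p]=\{a/p^k\}$ as additive discrete group; $\mathbb{L}_p(r)=|r|+\|r\|_p$ with $\|\cdot\|_p$ the $p$-adic norm, and $\mathbb{L}_p^\Sigma(r_1,r_2)=\mathbb{L}_p(r_1)+\mathbb{L}_p(r_2)$. $\Omega_p$: sequences $(\theta_n)_{n\ge0}$ in $[0,1)$ with $p\theta_n\equiv\theta_{n-1}\bmod\mathbb{Z}$ for $n\ge1$. $\sigma_\theta((\tfrac{q_1}{p^{k_1}},\tfrac{q_2}{p^{k_2}}),(\tfrac{q_3}{p^{k_3}},\tfrac{q_4}{p^{k_4}}))=\exp(2\pi i\theta_{k_1+k_4}q_1q_4)$. $\mathcal{A}^{\mathcal S}_\theta=C^*(\Gamma,\sigma_\theta)$ is the twisted group $C^*$-algebra (enveloping $C^*$-algebra of $\ell^1(\Gamma,\sigma_\theta)$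 with twisted convolution $(f_1*_\sigma f_2)(\gamma)=\sum_{\gamma_1}f_1(\gamma_1)f_2(\gamma-\gamma_1)\sigma(\gamma_1,\gamma-\gamma_1)$), represented faithfully by the left-$\sigma_\theta$ regular representation $(\lambda_\sigma(f)g)(\gamma)=\sum_{\gamma_1}\sigma(\gamma_1,\gamma-\gamma_1)f(\gamma_1)g(\gamma-\gamma_1)$ on $\ell^2(\Gamma)$; $C_C(\Gamma,\sigma_\theta)$ = finitely supported functions; $\mathcal{D}_p$ = multiplication by $\mathbb{L}_p^\Sigma$ on $\ell^2(\Gamma)$. A Leibniz quantum compact metric space is a pair $(A,L)$ with $A$ a unital $C^*$-algebra and $L$ a seminorm on a dense subspace $\mathrm{dom}(L)$ of the self-adjoint part $sa(A)$ such that: (1) $\{a\in\mathrm{dom}(L):L(a)=0\}=\mathbb{R}1_A$; (2) the Monge–Kantorovich metric $mk_L(\varphi,\psi)=\sup\{|\varphi(a)-\psi(a)|:a\in\mathrm{dom}(L),L(a)\le1\}$ metrizes the weak$^*$ topology on the state space of $A$; (3) for $a,b\in\mathrm{dom}(L)$, $\frac{ab+ba}{2},\frac{ab-ba}{2i}\in\mathrm{dom}(L)$ and $\max\{L(\frac{ab+ba}{2}),L(\frac{ab-ba}{2i})\}\le L(a)\|b\|+\|a\|L(b)$; (4) $L$ is lower semicontinuous with respect to the norm topology on $\mathrm{dom}(L)$. *)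

theory Defs
  imports "HOL-Analysis.Analysis" "HOL-Computational_Algebra.Factorial_Ring"
begin

definition Zp :: "nat \<Rightarrow> real set" where
  "Zp p = {x. \<exists>q::int. \<exists>k::nat. x = of_int q / real p ^ k}"

definition Gam :: "nat \<Rightarrow> (real \<times> real) set" where
  "Gam p = Zp p \<times> Zp p"

definition zrep :: "nat \<Rightarrow> real \<Rightarrow> int \<times> nat" where
  "zrep p x = (SOME (q, k). x = of_int q / real p ^ k)"

definition Omega :: "nat \<Rightarrow> (nat \<Rightarrow> real) set" where
  "Omega p = {\<theta>. (\<forall>n. 0 \<le> \<theta> n \<and> \<theta> n < 1) \<and>
                  (\<forall>n\<ge>1. real p * \<theta> n - \<theta> (n - 1) \<in> \<int>)}"

definition sigma :: "nat \<Rightarrow> (nat \<Rightarrow> real) \<Rightarrow> real \<times> real \<Rightarrow> real \<times> real \<Rightarrow> complex" where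
  "sigma p \<theta> x y =
     (let (q1, k1) = zrep p (fst x); (q4, k4) = zrep p (snd y)
      in exp (2 * complex_of_real pi * \<i> * complex_of_real (\<theta> (k1 + k4) * of_int q1 * of_int q4)))"

definition padic_norm :: "nat \<Rightarrow> real \<Rightarrow> real" where
  "padic_norm p x = (if x = 0 then 0 else
      (case zrep p x of (q, k) \<Rightarrow> real p ^ k / real p ^ multiplicity (int p) q))"

definition Lp :: "nat \<Rightarrow> real \<Rightarrow> real" where
  "Lp p r = \<bar>r\<bar> + padic_norm p r"

definition LpSigma :: "nat \<Rightarrow> real \<times> real \<Rightarrow> real" where
  "LpSigma p \<gamma> = Lp p (fst \<gamma>) + Lp p (snd \<gamma>)"

type_synonym 'x op = "('x \<Rightarrow> complex) \<Rightarrow> ('x \<Rightarrow> complex)"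

definition l2 :: "'x set \<Rightarrow> ('x \<Rightarrow> complex) set" where
  "l2 G = {g. (\<forall>x. x \<notin> G \<longrightarrow> g x = 0) \<and> (\<lambda>x. (cmod (g x))\<^sup>2) summable_on G}"

definition l2norm :: "'x set \<Rightarrow> ('x \<Rightarrow> complex) \<Rightarrow> real" where
  "l2norm G g = sqrt (\<Sum>\<^sub>\<infinity>x\<in>G. (cmod (g x))\<^sup>2)"

definition l2inner :: "'x set \<Rightarrow> ('x \<Rightarrow> complex) \<Rightarrow> ('x \<Rightarrow> complex) \<Rightarrow> complex" where
  "l2inner G g h = (\<Sum>\<^sub>\<infinity>x\<in>G. g x * cnj (h x))"

text \<open>Operators are represented as maps that are linear on l^2(G), map l^2(G) into itself,
  and send everything outside l^2(G) to 0 (so that equality of operators is equality of maps).\<close>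
definition is_op :: "'x set \<Rightarrow> 'x op \<Rightarrow> bool" where
  "is_op G T \<longleftrightarrow> (\<forall>g. g \<notin> l2 G \<longrightarrow> T g = (\<lambda>_. 0)) \<and> (\<forall>g\<in>l2 G. T g \<in> l2 G) \<and>
     (\<forall>g\<in>l2 G. \<forall>h\<in>l2 G. \<forall>c. T (\<lambda>x. g x + c * h x) = (\<lambda>x. T g x + c * T h x))"

definition opnorm :: "'x set \<Rightarrow> 'x op \<Rightarrow> ereal" where
  "opnorm G T = (SUP g\<in>{g\<in>l2 G. l2norm G g \<le> 1}. ereal (l2norm G (T g)))"

definition op_add :: "'x op \<Rightarrow> 'x op \<Rightarrow> 'x op" where
  "op_add T S = (\<lambda>g x. T g x + S g x)"

definition op_scale :: "complex \<Rightarrow> 'x op \<Rightarrow> 'x op" where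
  "op_scale c T = (\<lambda>g x. c * T g x)"

definition op_minus :: "'x op \<Rightarrow> 'x op \<Rightarrow> 'x op" where
  "op_minus T S = op_add T (op_scale (-1) S)"

definition op_one :: "'x set \<Rightarrow> 'x op" where
  "op_one G = (\<lambda>g. if g \<in> l2 G then g else (\<lambda>_. 0))"

definition self_adj :: "'x set \<Rightarrow> 'x op \<Rightarrow> bool" where
  "self_adj G T \<longleftrightarrow> (\<forall>g\<in>l2 G. \<forall>h\<in>l2 G. l2inner G (T g) h = l2inner G g (T h))"

definition positive_op :: "'x set \<Rightarrow> 'x op \<Rightarrow> bool" where
  "positive_op G T \<longleftrightarrow> (\<forall>g\<in>l2 G. l2inner G (T g) g \<in> \<real> \<and> 0 \<le> Re (l2inner G (T g) g))"

definition unital_cstar_subalg :: "'x set \<Rightarrow> 'x op set \<Rightarrow> bool" where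
  "unital_cstar_subalg G A \<longleftrightarrow>
     (\<forall>T\<in>A. is_op G T \<and> opnorm G T < \<infinity>) \<and> op_one G \<in> A \<and>
     (\<forall>T\<in>A. \<forall>S\<in>A. op_add T S \<in> A \<and> T \<circ> S \<in> A) \<and>
     (\<forall>T\<in>A. \<forall>c. op_scale c T \<in> A) \<and>
     (\<forall>T\<in>A. \<exists>S\<in>A. \<forall>g\<in>l2 G. \<forall>h\<in>l2 G. l2inner G (T g) h = l2inner G g (S h)) \<and>
     (\<forall>T. is_op G T \<and> (\<exists>s. (\<forall>n. s n \<in> A) \<and> (\<lambda>n. opnorm G (op_minus T (s n))) \<longlonglongrightarrow> 0)
          \<longrightarrow> T \<in> A)"

definition sa_part :: "'x set \<Rightarrow> 'x op set \<Rightarrow> 'x op set" where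
  "sa_part G A = {a\<in>A. self_adj G a}"

definition states :: "'x set \<Rightarrow> 'x op set \<Rightarrow> ('x op \<Rightarrow> complex) set" where
  "states G A = {\<phi>. \<phi> \<in> extensional A \<and>
      (\<forall>a\<in>A. \<forall>b\<in>A. \<phi> (op_add a b) = \<phi> a + \<phi> b) \<and>
      (\<forall>a\<in>A. \<forall>c. \<phi> (op_scale c a) = c * \<phi> a) \<and>
      (\<forall>a\<in>A. positive_op G a \<longrightarrow> \<phi> a \<in> \<real> \<and> 0 \<le> Re (\<phi> a)) \<and>
      \<phi> (op_one G) = 1}"

definition weak_star :: "'x set \<Rightarrow> 'x op set \<Rightarrow> ('x op \<Rightarrow> complex) topology" where
  "weak_star G A = subtopology (product_topology (\<lambda>_. euclidean) A) (states G A)"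

definition mk :: "('x op \<Rightarrow> complex) \<Rightarrow> ('x op \<Rightarrow> complex) \<Rightarrow> 'x op set \<Rightarrow> ('x op \<Rightarrow> ereal)
                   \<Rightarrow> ereal" where
  "mk \<phi> \<psi> D L = (SUP a\<in>{a\<in>D. L a \<le> 1}. ereal (cmod (\<phi> a - \<psi> a)))"

definition leibniz_qcms :: "'x set \<Rightarrow> 'x op set \<Rightarrow> 'x op set \<Rightarrow> ('x op \<Rightarrow> ereal) \<Rightarrow> bool" where
  "leibniz_qcms G A D L \<longleftrightarrow>
     unital_cstar_subalg G A \<and>
     \<comment> \<open>L is a (finite, real-valued) seminorm on a dense real subspace D of sa(A)\<close>
     D \<subseteq> sa_part G A \<and>
     (\<forall>a\<in>D. \<forall>b\<in>D. op_add a b \<in> D) \<and> (\<forall>a\<in>D. \<forall>c::real. op_scale (of_real c) a \<in> D) \<and>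
     (\<forall>a\<in>sa_part G A. \<forall>\<epsilon>>0. \<exists>b\<in>D. opnorm G (op_minus a b) < ereal \<epsilon>) \<and>
     (\<forall>a\<in>D. 0 \<le> L a \<and> L a < \<infinity>) \<and>
     (\<forall>a\<in>D. \<forall>b\<in>D. L (op_add a b) \<le> L a + L b) \<and>
     (\<forall>a\<in>D. \<forall>c::real. L (op_scale (of_real c) a) = ereal \<bar>c\<bar> * L a) \<and>
     \<comment> \<open>(1)\<close>
     {a\<in>D. L a = 0} = {op_scale (of_real c) (op_one G) | c::real. True} \<and>
     \<comment> \<open>(2)\<close>
     (\<forall>\<phi>\<in>states G A. \<forall>\<psi>\<in>states G A. mk \<phi> \<psi> D L < \<infinity>) \<and>
     Metric_space (states G A) (\<lambda>\<phi> \<psi>. real_of_ereal (mk \<phi> \<psi> D L)) \<and>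
     Metric_space.mtopology (states G A) (\<lambda>\<phi> \<psi>. real_of_ereal (mk \<phi> \<psi> D L)) = weak_star G A \<and>
     \<comment> \<open>(3) Leibniz\<close>
     (\<forall>a\<in>D. \<forall>b\<in>D.
        let J = op_scale (1/2) (op_add (a \<circ> b) (b \<circ> a));
            K = op_scale (1/(2*\<i>)) (op_minus (a \<circ> b) (b \<circ> a))
        in J \<in> D \<and> K \<in> D \<and>
           max (L J) (L K) \<le> L a * ereal (real_of_ereal (opnorm G b))
                              + ereal (real_of_ereal (opnorm G a)) * L b) \<and>
     \<comment> \<open>(4) lower semicontinuity w.r.t. the norm topology on D\<close>
     (\<forall>a\<in>D. \<forall>s. (\<forall>n. s n \<in> D) \<and> (\<lambda>n. opnorm G (op_minus (s n) a)) \<longlonglongrightarrow> 0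
          \<longrightarrow> L a \<le> liminf (\<lambda>n. L (s n)))"

definition CC :: "nat \<Rightarrow> (real \<times> real \<Rightarrow> complex) set" where
  "CC p = {f. finite {\<gamma>. f \<gamma> \<noteq> 0} \<and> {\<gamma>. f \<gamma> \<noteq> 0} \<subseteq> Gam p}"

definition lam :: "nat \<Rightarrow> (nat \<Rightarrow> real) \<Rightarrow> (real \<times> real \<Rightarrow> complex) \<Rightarrow> (real \<times> real) op" where
  "lam p \<theta> f = (\<lambda>g. if g \<in> l2 (Gam p) then
      (\<lambda>\<gamma>. if \<gamma> \<in> Gam p then
              (\<Sum>\<gamma>1\<in>{\<gamma>. f \<gamma> \<noteq> 0}. sigma p \<theta> \<gamma>1 (\<gamma> - \<gamma>1) * f \<gamma>1 * g (\<gamma> - \<gamma>1))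
            else 0)
      else (\<lambda>_. 0))"

text \<open>A^S_theta, realised via its faithful representation: norm closure of lam(C_C).\<close>
definition Atheta :: "nat \<Rightarrow> (nat \<Rightarrow> real) \<Rightarrow> (real \<times> real) op set" where
  "Atheta p \<theta> = {T. is_op (Gam p) T \<and>
      (\<exists>f. (\<forall>n. f n \<in> CC p) \<and> (\<lambda>n. opnorm (Gam p) (op_minus T (lam p \<theta> (f n)))) \<longlonglongrightarrow> 0)}"

definition Dp :: "nat \<Rightarrow> (real \<times> real \<Rightarrow> complex) \<Rightarrow> (real \<times> real \<Rightarrow> complex)" where
  "Dp p g = (\<lambda>\<gamma>. complex_of_real (LpSigma p \<gamma>) * g \<gamma>)"

definition domL :: "nat \<Rightarrow> (nat \<Rightarrow> real) \<Rightarrow> (real \<times> real) op set" where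
  "domL p \<theta> = {lam p \<theta> f | f. f \<in> CC p \<and> self_adj (Gam p) (lam p \<theta> f)}"

text \<open>Norm of the commutator [D_p, lam(a)], computed on the dense core C_C(Gamma) of D_p.\<close>
definition LD :: "nat \<Rightarrow> (real \<times> real) op \<Rightarrow> ereal" where
  "LD p a = (SUP g\<in>{g\<in>CC p. l2norm (Gam p) g \<le> 1}.
               ereal (l2norm (Gam p) (\<lambda>\<gamma>. Dp p (a g) \<gamma> - a (Dp p g) \<gamma>)))"

end

theory Submission
  imports Defs
begin

text \<open>
  By Rieffel's criterion the point is total boundedness of the Lipschitz ball modulo scalars, and
  it suffices to approximate its elements uniformly by their restrictions to one finite set: the
  weak* neighbourhood of a state given by the finitely many generators in this set then lies in a
  Monge-Kantorovich ball, since \<open>\<bar>f x\<bar> * \<l> x \<le> L(f)\<close> bounds the coefficients.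

  Right translations commute with \<open>\<lambda>(f)\<close>, so \<open>L(f)\<close> also bounds the commutator of \<open>\<lambda>(f)\<close> with every
  translate of the length function. Differences of suitable translates (far out in the real or in
  the \<open>p\<close>-adic direction) isolate one coordinate \<open>c\<close>. In the real direction this gives
  \<open>\<parallel>\<lambda>(c f)\<parallel> \<le> L(f)\<close>; since \<open>\<parallel>\<lambda>(k(c) g)\<parallel> \<le> \<parallel>k\<parallel>\<^sub>2 \<parallel>\<lambda>(g)\<parallel>\<close>, the part of \<open>f\<close> with \<open>c\<close> in a fixed
  \<open>p\<^sup>-\<^sup>m \<int>\<close> and \<open>\<bar>c\<bar>\<close> large is small because \<open>1 / c\<^sup>2\<close> is summable there. In the \<open>p\<close>-adic direction
  the component of \<open>f\<close> on a single coset of \<open>p\<^sup>-\<^sup>n \<int>\<close> in \<open>p\<^sup>-\<^sup>n\<^sup>-\<^sup>1 \<int>\<close>, other than the trivial one, has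
  norm \<open>O(p\<^sup>-\<^sup>n\<^sup>-\<^sup>1)\<close>; there are \<open>p - 1\<close> such cosets, and the shells sum up geometrically.
\<close>


section \<open>Square summable functions and bounded operators\<close>

text \<open>The obstacle is that \<open>LpSigma\<close> is a sum of four terms, two real and two
  p-adic, and a bound on the commutator with a sum gives no evident bound on the commutators with
  its terms. Translations help because they may be chosen after both \<open>f\<close> and the test
  vector: the bound obtained does not depend on the translation, so a length need only take a simple
  shape on the finitely many places that these two supports reach, and no limit of weights is taken.
  The order of the cuts is forced. Z[1/p] is dense in the line, so a bounded interval holds
  infinitely many of its elements, and inverse squares become summable only after a p-adic cut has
  left a lattice. Restriction to a subgroup does not increase the norm. Restriction of one
  coordinate to a finite set of values does, by at most the square root of their number; this factor
  is known before the cutoff for the other coordinate is chosen, and that cutoff absorbs it.\<close>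

lemma L2_set_power2: "(L2_set f A)\<^sup>2 = (\<Sum>x\<in>A. (f x)\<^sup>2)"
  by (simp add: L2_set_def sum_nonneg)

text \<open>Cancels a factor that may vanish; used where the norm of a vector is bounded by pairing
  the vector with itself.\<close>

lemma le_if_square_le:
  fixes n m :: real
  assumes "n * n \<le> m * n" "0 \<le> n" "0 \<le> m"
  shows "n \<le> m"
  using assms by (cases "n = 0") auto

text \<open>A sum of nonnegative terms is the supremum of its finite partial sums, so one bound on
  finite sections gives both membership in \<open>l2 G\<close> and the norm estimate.\<close>

lemma l2_bound:
  assumes "\<And>x. x \<notin> G \<Longrightarrow> g x = 0" "0 \<le> B"
    and "\<And>F. finite F \<Longrightarrow> F \<subseteq> G \<Longrightarrow> L2_set (\<lambda>x. cmod (g x)) F \<le> B"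
  shows "g \<in> l2 G" "l2norm G g \<le> B"
proof -
  have *: "(\<Sum>x\<in>F. (cmod (g x))\<^sup>2) \<le> B\<^sup>2" if "finite F" "F \<subseteq> G" for F
    using power_mono[OF assms(3)[OF that] L2_set_nonneg, of 2] by (simp add: L2_set_power2)
  have s: "(\<lambda>x. (cmod (g x))\<^sup>2) summable_on G"
    by (rule nonneg_bdd_above_summable_on) (auto intro!: bdd_aboveI2[where M="B\<^sup>2"] *)
  then show "g \<in> l2 G" using assms(1) by (simp add: l2_def)
  have "(\<Sum>\<^sub>\<infinity>x\<in>G. (cmod (g x))\<^sup>2) \<le> B\<^sup>2"
    by (rule infsum_le_finite_sums[OF s *])
  then show "l2norm G g \<le> B"
    using assms(2) unfolding l2norm_def by (simp add: real_le_lsqrt)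
qed

lemma l2_outside: "g \<in> l2 G \<Longrightarrow> x \<notin> G \<Longrightarrow> g x = 0"
  by (simp add: l2_def)

lemma l2norm_nonneg [simp]: "0 \<le> l2norm G g"
  by (simp add: l2norm_def infsum_nonneg)

lemma l2norm_power2: "(l2norm G g)\<^sup>2 = (\<Sum>\<^sub>\<infinity>x\<in>G. (cmod (g x))\<^sup>2)"
  by (simp add: l2norm_def infsum_nonneg)

lemma L2_set_le_l2norm:
  assumes "g \<in> l2 G" "finite F" "F \<subseteq> G"
  shows "L2_set (\<lambda>x. cmod (g x)) F \<le> l2norm G g"
  unfolding L2_set_def l2norm_def
  by (rule real_sqrt_le_mono, rule finite_sum_le_infsum) (use assms in \<open>auto simp: l2_def\<close>)

lemma l2_add:
  assumes "g \<in> l2 G" "h \<in> l2 G"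
  shows "(\<lambda>x. g x + h x) \<in> l2 G" "l2norm G (\<lambda>x. g x + h x) \<le> l2norm G g + l2norm G h"
proof -
  have *: "L2_set (\<lambda>x. cmod (g x + h x)) F \<le> l2norm G g + l2norm G h" if "finite F" "F \<subseteq> G" for F
  proof -
    have "L2_set (\<lambda>x. cmod (g x + h x)) F \<le> L2_set (\<lambda>x. cmod (g x) + cmod (h x)) F"
      by (rule L2_set_mono) (auto simp: norm_triangle_ineq)
    also have "\<dots> \<le> L2_set (\<lambda>x. cmod (g x)) F + L2_set (\<lambda>x. cmod (h x)) F"
      by (rule L2_set_triangle_ineq)
    finally show ?thesis
      using L2_set_le_l2norm[OF assms(1) that] L2_set_le_l2norm[OF assms(2) that] by linarith
  qed
  show "(\<lambda>x. g x + h x) \<in> l2 G" "l2norm G (\<lambda>x. g x + h x) \<le> l2norm G g + l2norm G h"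
    using l2_bound[of G "\<lambda>x. g x + h x", OF _ _ *] assms by (auto simp: l2_outside)
qed

lemma l2norm_scale: "l2norm G (\<lambda>x. c * g x) = cmod c * l2norm G g"
  by (simp add: l2norm_def norm_mult power_mult_distrib infsum_cmult_right' real_sqrt_mult)

lemma l2_scale: "g \<in> l2 G \<Longrightarrow> (\<lambda>x. c * g x) \<in> l2 G"
  by (auto simp: l2_def norm_mult power_mult_distrib intro: summable_on_cmult_right)

lemma l2_zero [simp]: "(\<lambda>_. 0) \<in> l2 G" "l2norm G (\<lambda>_. 0) = 0"
  by (auto simp: l2_def l2norm_def)

lemma l2_diff:
  assumes "g \<in> l2 G" "h \<in> l2 G"
  shows "(\<lambda>x. g x - h x) \<in> l2 G" "l2norm G (\<lambda>x. g x - h x) \<le> l2norm G g + l2norm G h"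
  using l2_add[OF assms(1) l2_scale[OF assms(2), of "-1"]] l2norm_scale[of G "-1" h] by simp_all

lemma l2_sum:
  assumes "finite I" "\<And>i. i \<in> I \<Longrightarrow> g i \<in> l2 G"
  shows "(\<lambda>x. \<Sum>i\<in>I. g i x) \<in> l2 G \<and> l2norm G (\<lambda>x. \<Sum>i\<in>I. g i x) \<le> (\<Sum>i\<in>I. l2norm G (g i))"
  using assms
proof (induction I)
  case (insert i I)
  then show ?case
    using l2_add[of "g i" G "\<lambda>x. \<Sum>i\<in>I. g i x"] by fastforce
qed auto

lemma l2_mono:
  assumes "h \<in> l2 G" "\<And>x. cmod (g x) \<le> c * cmod (h x)" "0 \<le> c"
  shows "g \<in> l2 G" "l2norm G g \<le> c * l2norm G h"
proof -
  have *: "L2_set (\<lambda>x. cmod (g x)) F \<le> c * l2norm G h" if "finite F" "F \<subseteq> G" for F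
  proof -
    have "L2_set (\<lambda>x. cmod (g x)) F \<le> L2_set (\<lambda>x. c * cmod (h x)) F"
      by (rule L2_set_mono) (auto simp: assms)
    also have "\<dots> = c * L2_set (\<lambda>x. cmod (h x)) F"
      using assms(3) by (simp add: L2_set_right_distrib)
    finally show ?thesis
      using L2_set_le_l2norm[OF assms(1) that] assms(3) by (meson mult_left_mono order_trans)
  qed
  have "g x = 0" if "x \<notin> G" for x
    using assms(2)[of x] l2_outside[OF assms(1) that] by simp
  then show "g \<in> l2 G" "l2norm G g \<le> c * l2norm G h"
    using l2_bound[of G g, OF _ _ *] assms by auto
qed

lemma l2_finite:
  assumes "finite E" "E \<subseteq> G" "\<And>x. x \<notin> E \<Longrightarrow> g x = 0"
  shows "g \<in> l2 G" "l2norm G g = L2_set (\<lambda>x. cmod (g x)) E"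
proof -
  have "((\<lambda>x. (cmod (g x))\<^sup>2) has_sum (\<Sum>x\<in>E. (cmod (g x))\<^sup>2)) G"
    using assms by (intro has_sum_finite_neutralI) auto
  then show "g \<in> l2 G" "l2norm G g = L2_set (\<lambda>x. cmod (g x)) E"
    using assms by (auto simp: l2_def l2norm_def L2_set_def infsumI intro: has_sum_imp_summable)
qed

lemma l2norm_zero_iff:
  assumes "g \<in> l2 G" "l2norm G g = 0" shows "g x = 0"
proof (cases "x \<in> G")
  case True
  then show ?thesis using L2_set_le_l2norm[OF assms(1), of "{x}"] assms(2) by simp
qed (simp add: l2_outside[OF assms(1)])

lemma cmod_le_l2norm: "g \<in> l2 G \<Longrightarrow> cmod (g x) \<le> l2norm G g"
  using L2_set_le_l2norm[of g G "{x}"] by (cases "x \<in> G") (auto simp: l2_outside)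

lemma l2inner_abs_summable:
  assumes "g \<in> l2 G" "h \<in> l2 G"
  shows "(\<lambda>x. norm (g x * cnj (h x))) summable_on G"
    "(\<Sum>\<^sub>\<infinity>x\<in>G. norm (g x * cnj (h x))) \<le> l2norm G g * l2norm G h"
proof -
  have *: "(\<Sum>x\<in>F. norm (g x * cnj (h x))) \<le> l2norm G g * l2norm G h" if "finite F" "F \<subseteq> G" for F
  proof -
    have "(\<Sum>x\<in>F. norm (g x * cnj (h x))) = (\<Sum>x\<in>F. \<bar>cmod (g x)\<bar> * \<bar>cmod (h x)\<bar>)"
      by (simp add: norm_mult)
    also have "\<dots> \<le> L2_set (\<lambda>x. cmod (g x)) F * L2_set (\<lambda>x. cmod (h x)) F"
      by (rule L2_set_mult_ineq)
    also have "\<dots> \<le> l2norm G g * l2norm G h"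
      by (intro mult_mono L2_set_le_l2norm assms that) auto
    finally show ?thesis .
  qed
  show s: "(\<lambda>x. norm (g x * cnj (h x))) summable_on G"
    by (rule nonneg_bdd_above_summable_on)
      (auto intro!: bdd_aboveI2[where M="l2norm G g * l2norm G h"] *)
  show "(\<Sum>\<^sub>\<infinity>x\<in>G. norm (g x * cnj (h x))) \<le> l2norm G g * l2norm G h"
    by (rule infsum_le_finite_sums[OF s *])
qed

lemma l2inner_summable:
  "g \<in> l2 G \<Longrightarrow> h \<in> l2 G \<Longrightarrow> (\<lambda>x. g x * cnj (h x)) summable_on G"
  by (rule abs_summable_summable[OF l2inner_abs_summable(1)])

lemma l2inner_cauchy_schwarz:
  assumes "g \<in> l2 G" "h \<in> l2 G"
  shows "cmod (l2inner G g h) \<le> l2norm G g * l2norm G h"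
  unfolding l2inner_def
  using norm_infsum_bound[OF l2inner_abs_summable(1)[OF assms]] l2inner_abs_summable(2)[OF assms]
  by linarith

lemma l2inner_add_left:
  "\<lbrakk>g \<in> l2 G; k \<in> l2 G; h \<in> l2 G\<rbrakk> \<Longrightarrow>
    l2inner G (\<lambda>x. g x + k x) h = l2inner G g h + l2inner G k h"
  unfolding l2inner_def by (simp add: distrib_right infsum_add l2inner_summable)

lemma l2inner_scale_left: "l2inner G (\<lambda>x. c * g x) h = c * l2inner G g h"
  unfolding l2inner_def by (simp add: infsum_cmult_right' mult.assoc)

lemma l2inner_commute: "l2inner G h g = cnj (l2inner G g h)"
  unfolding l2inner_def by (simp flip: infsum_cnj add: mult.commute)

lemma l2inner_add_right:
  "\<lbrakk>g \<in> l2 G; k \<in> l2 G; h \<in> l2 G\<rbrakk> \<Longrightarrow>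
    l2inner G h (\<lambda>x. g x + k x) = l2inner G h g + l2inner G h k"
  by (simp add: l2inner_commute[of G h] l2inner_add_left)

lemma l2inner_scale_right: "l2inner G h (\<lambda>x. c * g x) = cnj c * l2inner G h g"
  by (simp add: l2inner_commute[of G h] l2inner_scale_left)

lemma l2inner_self:
  assumes "g \<in> l2 G" shows "l2inner G g g = of_real ((l2norm G g)\<^sup>2)"
proof -
  have "((\<lambda>x. (cmod (g x))\<^sup>2) has_sum (l2norm G g)\<^sup>2) G"
    using assms unfolding l2norm_power2 l2_def by (simp add: has_sum_infsum)
  then have "((\<lambda>x. g x * cnj (g x)) has_sum complex_of_real ((l2norm G g)\<^sup>2)) G"
    unfolding complex_norm_square[symmetric] by (rule has_sum_of_real)
  then show ?thesis unfolding l2inner_def by (rule infsumI)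
qed

definition delta :: "'x \<Rightarrow> 'x \<Rightarrow> complex" where
  "delta y = (\<lambda>x. if x = y then 1 else 0)"

lemma delta_l2:
  assumes "y \<in> G" shows "delta y \<in> l2 G" "l2norm G (delta y) = 1"
  using l2_finite[of "{y}" G "delta y"] assms by (auto simp: delta_def)

lemma l2inner_delta_right: "y \<in> G \<Longrightarrow> l2inner G g (delta y) = g y"
  unfolding l2inner_def delta_def
  by (subst infsum_cong_neutral[where T="{y}" and g="\<lambda>x. g x * cnj 1"]) auto

definition restr :: "'x set \<Rightarrow> ('x \<Rightarrow> complex) \<Rightarrow> 'x \<Rightarrow> complex" where
  "restr A g = (\<lambda>x. if x \<in> A then g x else 0)"

lemma restr_l2:
  assumes "g \<in> l2 G" shows "restr A g \<in> l2 G" "l2norm G (restr A g) \<le> l2norm G g"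
  using l2_mono[of g G "restr A g" 1] assms by (auto simp: restr_def)

lemma l2_tail:
  assumes "g \<in> l2 G" "0 < e"
  obtains F where "finite F" "F \<subseteq> G" "l2norm G (\<lambda>x. g x - restr F g x) \<le> e"
proof -
  have s: "(\<lambda>x. (cmod (g x))\<^sup>2) summable_on G" using assms by (simp add: l2_def)
  obtain F where F: "finite F" "F \<subseteq> G"
    and d: "dist (\<Sum>x\<in>F. (cmod (g x))\<^sup>2) (\<Sum>\<^sub>\<infinity>x\<in>G. (cmod (g x))\<^sup>2) \<le> e\<^sup>2"
    using infsum_finite_approximation[OF s, of "e\<^sup>2"] assms(2) by auto
  have "l2norm G (\<lambda>x. g x - restr F g x) \<le> e"
  proof (rule l2_bound(2))
    fix E assume E: "finite E" "E \<subseteq> G"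
    have "(\<Sum>x\<in>E. (cmod (g x - restr F g x))\<^sup>2) = (\<Sum>x\<in>E - F. (cmod (g x))\<^sup>2)"
      using E by (intro sum.mono_neutral_cong_right) (auto simp: restr_def)
    also have "\<dots> = (\<Sum>x\<in>E \<union> F. (cmod (g x))\<^sup>2) - (\<Sum>x\<in>F. (cmod (g x))\<^sup>2)"
      using sum_diff[of "E \<union> F" F "\<lambda>x. (cmod (g x))\<^sup>2"] E F
      by (simp add: Un_Diff)
    also have "\<dots> \<le> (\<Sum>\<^sub>\<infinity>x\<in>G. (cmod (g x))\<^sup>2) - (\<Sum>x\<in>F. (cmod (g x))\<^sup>2)"
      using E F by (intro diff_right_mono finite_sum_le_infsum[OF s]) auto
    also have "\<dots> \<le> e\<^sup>2" using d by (simp add: dist_real_def)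
    finally show "L2_set (\<lambda>x. cmod (g x - restr F g x)) E \<le> e"
      using assms(2) by (simp add: L2_set_def real_le_lsqrt)
  qed (use assms in \<open>auto simp: l2_outside restr_def\<close>)
  then show thesis using that F by blast
qed

section \<open>Operators on \<open>l2 G\<close>, norm bounds and adjoints\<close>

lemma is_op_l2: "is_op G T \<Longrightarrow> g \<in> l2 G \<Longrightarrow> T g \<in> l2 G"
  by (simp add: is_op_def)

lemma is_op_lin: "\<lbrakk>is_op G T; g \<in> l2 G; h \<in> l2 G\<rbrakk> \<Longrightarrow>
   T (\<lambda>x. g x + c * h x) = (\<lambda>x. T g x + c * T h x)"
  by (simp add: is_op_def)

lemma is_op_zero: assumes "is_op G T" shows "T (\<lambda>_. 0) = (\<lambda>_. 0)"
  using is_op_lin[OF assms l2_zero(1) l2_zero(1), of "-1"] by (simp add: fun_eq_iff)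

lemma is_op_scale: "\<lbrakk>is_op G T; h \<in> l2 G\<rbrakk> \<Longrightarrow> T (\<lambda>x. c * h x) = (\<lambda>x. c * T h x)"
  using is_op_lin[of G T "\<lambda>_. 0" h c] is_op_zero[of G T] by simp

lemma is_op_add: "\<lbrakk>is_op G T; g \<in> l2 G; h \<in> l2 G\<rbrakk> \<Longrightarrow> T (\<lambda>x. g x + h x) = (\<lambda>x. T g x + T h x)"
  using is_op_lin[of G T g h 1] by simp

lemma is_op_diff: "\<lbrakk>is_op G T; g \<in> l2 G; h \<in> l2 G\<rbrakk> \<Longrightarrow> T (\<lambda>x. g x - h x) = (\<lambda>x. T g x - T h x)"
  using is_op_lin[of G T g h "-1"] by simp

lemma is_op_outside: "is_op G T \<Longrightarrow> g \<notin> l2 G \<Longrightarrow> T g = (\<lambda>_. 0)"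
  by (simp add: is_op_def)

text \<open>A real bound, least or not. It keeps the extended-real arithmetic of
  \<open>opnorm\<close> out of the estimates; \<open>opnorm_le_iff\<close> is the bridge.\<close>

definition bnd :: "'x set \<Rightarrow> 'x op \<Rightarrow> real \<Rightarrow> bool" where
  "bnd G T B \<longleftrightarrow> (\<forall>g\<in>l2 G. l2norm G (T g) \<le> B * l2norm G g)"

lemma opnorm_nonneg: "0 \<le> opnorm G T"
  unfolding opnorm_def
  by (rule SUP_upper2[of "\<lambda>_. 0"]) (auto simp: zero_ereal_def)

text \<open>Homogeneity passes from the unit ball to all vectors; a vector of norm 0 is the zero
  function, where a linear map vanishes.\<close>

lemma opnorm_le_iff:
  assumes "is_op G T" "0 \<le> B"
  shows "opnorm G T \<le> ereal B \<longleftrightarrow> bnd G T B"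
proof
  assume o: "opnorm G T \<le> ereal B"
  show "bnd G T B" unfolding bnd_def
  proof
    fix g assume g: "g \<in> l2 G"
    show "l2norm G (T g) \<le> B * l2norm G g"
    proof (cases "l2norm G g = 0")
      case True
      then have "g = (\<lambda>_. 0)" using l2norm_zero_iff[OF g] by auto
      then show ?thesis using is_op_zero[OF assms(1)] by simp
    next
      case False
      define c where "c = complex_of_real (1 / l2norm G g)"
      have c: "cmod c = 1 / l2norm G g" by (simp add: c_def norm_divide)
      have "ereal (l2norm G (T (\<lambda>x. c * g x))) \<le> opnorm G T"
        unfolding opnorm_def
        by (rule SUP_upper) (use g False in \<open>auto simp: l2_scale l2norm_scale c\<close>)
      then have "ereal (l2norm G (T (\<lambda>x. c * g x))) \<le> ereal B" using o by (rule order_trans)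
      then have "l2norm G (T g) / l2norm G g \<le> B"
        by (simp add: is_op_scale[OF assms(1) g] l2norm_scale c)
      then show ?thesis using False
        by (metis l2norm_nonneg order_le_less pos_divide_le_eq)
    qed
  qed
next
  assume b: "bnd G T B"
  show "opnorm G T \<le> ereal B" unfolding opnorm_def
  proof (rule SUP_least)
    fix g assume "g \<in> {g \<in> l2 G. l2norm G g \<le> 1}"
    then have "l2norm G (T g) \<le> B * l2norm G g" "B * l2norm G g \<le> B"
      using b assms(2) by (auto simp: bnd_def mult_left_le)
    then show "ereal (l2norm G (T g)) \<le> ereal B" by simp
  qed
qed

lemma opnorm_bnd:
  assumes "is_op G T" "opnorm G T < \<infinity>"
  shows "0 \<le> real_of_ereal (opnorm G T)" "opnorm G T = ereal (real_of_ereal (opnorm G T))"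
    "bnd G T (real_of_ereal (opnorm G T))"
proof -
  show n: "0 \<le> real_of_ereal (opnorm G T)" by (simp add: opnorm_nonneg real_of_ereal_pos)
  show e: "opnorm G T = ereal (real_of_ereal (opnorm G T))"
    using assms(2) opnorm_nonneg[of G T] by (intro ereal_real'[symmetric]) auto
  show "bnd G T (real_of_ereal (opnorm G T))"
    using opnorm_le_iff[OF assms(1) n] e by simp
qed

lemma bndD: "bnd G T B \<Longrightarrow> g \<in> l2 G \<Longrightarrow> l2norm G (T g) \<le> B * l2norm G g"
  by (simp add: bnd_def)

lemma bnd_mono: "bnd G T B \<Longrightarrow> B \<le> C \<Longrightarrow> bnd G T C"
  unfolding bnd_def by (meson l2norm_nonneg mult_right_mono order_trans)

lemma op_minus_apply: "op_minus T S = (\<lambda>g x. T g x - S g x)"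
  by (simp add: op_minus_def op_add_def op_scale_def)

lemma is_op_op_add: "is_op G T \<Longrightarrow> is_op G S \<Longrightarrow> is_op G (op_add T S)"
  unfolding is_op_def op_add_def by (auto simp: l2_add algebra_simps)

lemma is_op_op_scale: "is_op G T \<Longrightarrow> is_op G (op_scale c T)"
  unfolding is_op_def op_scale_def by (auto simp: l2_scale algebra_simps)

lemma is_op_op_minus: "is_op G T \<Longrightarrow> is_op G S \<Longrightarrow> is_op G (op_minus T S)"
  unfolding op_minus_def by (intro is_op_op_add is_op_op_scale)

lemma is_op_comp: "is_op G T \<Longrightarrow> is_op G S \<Longrightarrow> is_op G (T \<circ> S)"
  using is_op_zero[of G T] unfolding is_op_def by (auto)

lemma bnd_op_add:
  assumes "is_op G T" "is_op G S" "bnd G T B" "bnd G S C"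
  shows "bnd G (op_add T S) (B + C)"
  unfolding bnd_def op_add_def
proof
  fix g assume g: "g \<in> l2 G"
  show "l2norm G (\<lambda>x. T g x + S g x) \<le> (B + C) * l2norm G g"
    using l2_add(2)[OF is_op_l2[OF assms(1) g] is_op_l2[OF assms(2) g]]
      bndD[OF assms(3) g] bndD[OF assms(4) g] by (simp add: algebra_simps)
qed

lemma bnd_op_scale:
  assumes "bnd G T B" shows "bnd G (op_scale c T) (cmod c * B)"
  unfolding bnd_def op_scale_def
  by (simp add: l2norm_scale bndD[OF assms] mult.assoc mult_left_mono)

lemma bnd_comp:
  assumes "is_op G S" "bnd G T B" "bnd G S C" "0 \<le> B"
  shows "bnd G (T \<circ> S) (B * C)"
  unfolding bnd_def
proof
  fix g assume g: "g \<in> l2 G"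
  have "l2norm G (T (S g)) \<le> B * l2norm G (S g)" by (rule bndD[OF assms(2) is_op_l2[OF assms(1) g]])
  also have "\<dots> \<le> B * (C * l2norm G g)" by (rule mult_left_mono[OF bndD[OF assms(3) g] assms(4)])
  finally show "l2norm G ((T \<circ> S) g) \<le> B * C * l2norm G g" by (simp add: mult.assoc)
qed

text \<open>Kept as a relation, so that a concrete candidate such as \<open>lop (star f)\<close> can
  be certified directly; self-adjointness is the diagonal case.\<close>

definition adj :: "'x set \<Rightarrow> 'x op \<Rightarrow> 'x op \<Rightarrow> bool" where
  "adj G T S \<longleftrightarrow> (\<forall>g\<in>l2 G. \<forall>h\<in>l2 G. l2inner G (T g) h = l2inner G g (S h))"

text \<open>Put \<open>g = S h\<close> in the adjoint relation: the square of \<parallel>S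
  h\<parallel> is the inner product of \<open>T (S h)\<close> with \<open>h\<close>, hence at most B
  \<parallel>S h\<parallel> \<parallel>h\<parallel>, and one factor cancels.\<close>

lemma adj_bnd:
  assumes "is_op G T" "is_op G S" "adj G T S" "bnd G T B" "0 \<le> B"
  shows "bnd G S B"
  unfolding bnd_def
proof
  fix h assume h: "h \<in> l2 G"
  let ?n = "l2norm G (S h)"
  have Sh: "S h \<in> l2 G" by (rule is_op_l2[OF assms(2) h])
  have "complex_of_real (?n\<^sup>2) = l2inner G (T (S h)) h"
    using assms(3) Sh h by (simp add: adj_def l2inner_self)
  then have "cmod (complex_of_real (?n\<^sup>2)) = cmod (l2inner G (T (S h)) h)" by (rule arg_cong)
  then have "?n\<^sup>2 = cmod (l2inner G (T (S h)) h)" unfolding norm_of_real by simp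
  also have "\<dots> \<le> l2norm G (T (S h)) * l2norm G h"
    by (rule l2inner_cauchy_schwarz[OF is_op_l2[OF assms(1) Sh] h])
  also have "\<dots> \<le> (B * ?n) * l2norm G h"
    by (rule mult_right_mono[OF bndD[OF assms(4) Sh]]) simp
  finally have "?n * ?n \<le> (B * l2norm G h) * ?n" by (simp add: power2_eq_square ac_simps)
  then show "?n \<le> B * l2norm G h"
    by (rule le_if_square_le) (use assms in auto)
qed

lemma adj_op_add:
  assumes "is_op G T" "is_op G S" "is_op G T'" "is_op G S'" "adj G T T'" "adj G S S'"
  shows "adj G (op_add T S) (op_add T' S')"
  using assms unfolding adj_def op_add_def
  by (simp add: l2inner_add_left l2inner_add_right is_op_l2)

lemma adj_op_scale: "adj G T T' \<Longrightarrow> adj G (op_scale c T) (op_scale (cnj c) T')"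
  unfolding adj_def op_scale_def by (simp add: l2inner_scale_left l2inner_scale_right)

lemma adj_op_minus:
  assumes "is_op G T" "is_op G S" "is_op G T'" "is_op G S'" "adj G T T'" "adj G S S'"
  shows "adj G (op_minus T S) (op_minus T' S')"
  unfolding op_minus_def
  using adj_op_add[OF assms(1) is_op_op_scale[OF assms(2)] assms(3) is_op_op_scale[OF assms(4)]
      assms(5) adj_op_scale[OF assms(6)], of "-1"] by simp

lemma adj_sym: "adj G T S \<Longrightarrow> adj G S T"
  unfolding adj_def
  by (metis (no_types, lifting) complex_cnj_cnj l2inner_commute)

lemma self_adj_iff: "self_adj G T \<longleftrightarrow> adj G T T"
  by (simp add: self_adj_def adj_def)

text \<open>The Cartesian decomposition of an operator \<open>a\<close> with adjoint
  \<open>s\<close>. It serves the bound on states, the density of \<open>sadom\<close>, and the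
  Leibniz rule, where \<open>a\<close> is a product and \<open>s\<close> the same product in reverse
  order.\<close>

lemma self_adj_parts:
  assumes "is_op G a" "is_op G s" "adj G a s"
  defines "x \<equiv> op_scale (1/2) (op_add a s)"
    and "y \<equiv> op_scale (-\<i>/2) (op_add a (op_scale (-1) s))"
  shows "self_adj G x" "self_adj G y" "op_add x (op_scale \<i> y) = a"
proof -
  note sa = adj_sym[OF assms(3)] and op = is_op_op_scale[OF assms(1)] is_op_op_scale[OF assms(2)]
  have "adj G x (op_scale (cnj (1/2)) (op_add s a))"
    unfolding x_def by (intro adj_op_scale adj_op_add assms sa)
  moreover have "op_scale (cnj (1/2)) (op_add s a) = x" by (simp add: x_def op_add_def add.commute)
  ultimately show "self_adj G x" by (simp add: self_adj_iff)
  have "adj G y (op_scale (cnj (-\<i>/2)) (op_add s (op_scale (cnj (-1)) a)))"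
    unfolding y_def by (intro adj_op_scale adj_op_add assms op sa)
  moreover have "op_scale (cnj (-\<i>/2)) (op_add s (op_scale (cnj (-1)) a)) = y"
    by (simp add: y_def op_add_def op_scale_def algebra_simps)
  ultimately show "self_adj G y" by (simp add: self_adj_iff)
  show "op_add x (op_scale \<i> y) = a"
    by (simp add: x_def y_def op_add_def op_scale_def fun_eq_iff algebra_simps)
qed

lemma adj_comp: "\<lbrakk>is_op G S; is_op G T'; adj G T T'; adj G S S'\<rbrakk> \<Longrightarrow> adj G (T \<circ> S) (S' \<circ> T')"
  unfolding adj_def by (simp add: is_op_l2)

lemma l2inner_restr:
  assumes "is_op G T" "finite F" "F \<subseteq> G" "h \<in> l2 G"
  shows "l2inner G (T (restr F g)) h = (\<Sum>x\<in>F. g x * l2inner G (T (delta x)) h)"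
  using assms(2,3)
proof (induction F)
  case empty
  then show ?case using is_op_zero[OF assms(1)] by (simp add: restr_def l2inner_def)
next
  case (insert y F)
  have e: "restr (insert y F) g = (\<lambda>x. restr F g x + g y * delta y x)"
    using insert.hyps by (auto simp: restr_def delta_def)
  have r: "restr F g \<in> l2 G" using l2_finite(1)[of F G "restr F g"] insert by (auto simp: restr_def)
  have d: "delta y \<in> l2 G" using delta_l2(1)[of y G] insert.prems by simp
  show ?case unfolding e is_op_lin[OF assms(1) r d]
    using insert assms(1,4) r d
    by (simp add: l2inner_add_left l2inner_scale_left is_op_l2 l2_scale)
qed

text \<open>The adjoint is written down by coordinates,
  \<open>S h x = l2inner G h (T (delta x))\<close>. Testing \<open>T\<close> on a finite section of
  \<open>S h\<close> shows that \<open>S h\<close> is square summable with the same bound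
  \<open>B\<close>. The adjoint relation holds on finite sections by linearity and passes to
  \<open>l2 G\<close> by approximation.\<close>

lemma adjoint_exists:
  assumes T: "is_op G T" "bnd G T B" "0 \<le> B"
  obtains S where "is_op G S" "bnd G S B" "adj G T S"
proof -
  define S where "S = (\<lambda>h. if h \<in> l2 G then (\<lambda>x. if x \<in> G then l2inner G h (T (delta x)) else 0)
                      else (\<lambda>_. 0))"
  have Tr: "l2inner G (T (restr F g)) h = (\<Sum>x\<in>F. g x * cnj (S h x))"
    if "finite F" "F \<subseteq> G" "h \<in> l2 G" for F g h
    using that by (subst l2inner_restr[OF T(1)])
      (auto simp: S_def l2inner_commute[of G _ h] intro!: sum.cong)
  have Sb: "L2_set (\<lambda>x. cmod (S h x)) F \<le> B * l2norm G h"
    if h: "h \<in> l2 G" and F: "finite F" "F \<subseteq> G" for h F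
  proof -
    let ?k = "restr F (S h)" and ?n = "L2_set (\<lambda>x. cmod (S h x)) F"
    have k: "?k \<in> l2 G" "l2norm G ?k = ?n"
      using l2_finite[of F G ?k] F by (auto simp: restr_def intro!: L2_set_cong)
    have "complex_of_real (?n\<^sup>2) = l2inner G (T ?k) h"
      by (subst Tr[OF F h]) (simp add: L2_set_power2 flip: complex_norm_square)
    then have "cmod (complex_of_real (?n\<^sup>2)) = cmod (l2inner G (T ?k) h)" by (rule arg_cong)
    then have "?n\<^sup>2 = cmod (l2inner G (T ?k) h)" unfolding norm_of_real by simp
    also have "\<dots> \<le> l2norm G (T ?k) * l2norm G h"
      by (rule l2inner_cauchy_schwarz[OF is_op_l2[OF T(1) k(1)] h])
    also have "\<dots> \<le> (B * ?n) * l2norm G h"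
      using bndD[OF T(2) k(1)] k(2) by (intro mult_right_mono) auto
    finally have "?n * ?n \<le> (B * l2norm G h) * ?n" by (simp add: power2_eq_square ac_simps)
    then show ?thesis
      by (rule le_if_square_le) (use T(3) L2_set_nonneg in auto)
  qed
  have S2: "S h \<in> l2 G" "l2norm G (S h) \<le> B * l2norm G h" if "h \<in> l2 G" for h
    using l2_bound[of G "S h", OF _ _ Sb[OF that]] T(3) by (auto simp: S_def)
  have "is_op G S" unfolding is_op_def
  proof (intro conjI ballI allI impI)
    fix g h c assume gh: "g \<in> l2 G" "h \<in> l2 G"
    then show "S (\<lambda>x. g x + c * h x) = (\<lambda>x. S g x + c * S h x)"
      using l2_add(1)[OF gh(1) l2_scale[OF gh(2)]] is_op_l2[OF T(1) delta_l2(1)] unfolding S_def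
      by (auto simp: l2inner_add_left l2inner_scale_left l2_scale fun_eq_iff)
  qed (use S2 in \<open>auto simp: S_def\<close>)
  moreover have "bnd G S B" using S2 by (simp add: bnd_def)
  moreover have "adj G T S" unfolding adj_def
  proof (intro ballI)
    fix g h assume g: "g \<in> l2 G" and h: "h \<in> l2 G"
    let ?d = "cmod (l2inner G (T g) h - l2inner G g (S h))"
    have "?d \<le> 0 + e" if e: "0 < e" for e
    proof -
      \<comment> \<open>Each of the two error terms is at most \<open>e' * (B * l2norm G h)\<close>;
        the summand 1 keeps the denominator positive.\<close>
      define e' where "e' = e / (2 * (B * l2norm G h) + 1)"
      have pos: "0 < 2 * (B * l2norm G h) + 1"
        using T(3) mult_nonneg_nonneg[OF T(3) l2norm_nonneg[of G h]] by linarith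
      then have e': "0 < e'" using e by (simp add: e'_def)
      obtain F where F: "finite F" "F \<subseteq> G" "l2norm G (\<lambda>x. g x - restr F g x) \<le> e'"
        using l2_tail[OF g e'] by blast
      let ?r = "restr F g" and ?t = "\<lambda>x. g x - restr F g x"
      have r: "?r \<in> l2 G" and t: "?t \<in> l2 G" using restr_l2[OF g] l2_diff[OF g] by blast+
      have "l2inner G ?r (S h) = (\<Sum>x\<in>F. g x * cnj (S h x))"
        unfolding l2inner_def
        using F by (subst infsum_cong_neutral[where T=F and g="\<lambda>x. g x * cnj (S h x)"])
           (auto simp: restr_def)
      then have eq: "l2inner G (T ?r) h = l2inner G ?r (S h)" using Tr[OF F(1,2) h] by simp
      have "g = (\<lambda>x. ?r x + ?t x)" by simp
      then have "l2inner G (T g) h - l2inner G g (S h)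
         = l2inner G (T (\<lambda>x. ?r x + ?t x)) h - l2inner G (\<lambda>x. ?r x + ?t x) (S h)" by simp
      also have "\<dots> = l2inner G (T ?t) h - l2inner G ?t (S h)"
        unfolding is_op_add[OF T(1) r t]
          l2inner_add_left[OF is_op_l2[OF T(1) r] is_op_l2[OF T(1) t] h]
          l2inner_add_left[OF r t S2(1)[OF h]] by (simp add: eq)
      finally have "?d \<le> cmod (l2inner G (T ?t) h) + cmod (l2inner G ?t (S h))"
        by (simp add: norm_triangle_ineq4)
      also have "\<dots> \<le> l2norm G (T ?t) * l2norm G h + l2norm G ?t * l2norm G (S h)"
        by (intro add_mono l2inner_cauchy_schwarz is_op_l2[OF T(1) t] t h S2)
      also have "\<dots> \<le> (B * l2norm G ?t) * l2norm G h + l2norm G ?t * (B * l2norm G h)"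
        by (intro add_mono mult_right_mono mult_left_mono bndD[OF T(2) t] S2 h) auto
      also have "\<dots> = l2norm G ?t * (2 * (B * l2norm G h))" by (simp add: algebra_simps)
      also have "\<dots> \<le> e' * (2 * (B * l2norm G h) + 1)"
        using T(3) F(3) e' by (intro mult_mono) auto
      also have "\<dots> = e" using pos by (simp add: e'_def)
      finally show ?thesis by simp
    qed
    then have "?d \<le> 0" using field_le_epsilon by blast
    then show "l2inner G (T g) h = l2inner G g (S h)" by simp
  qed
  ultimately show thesis using that by blast
qed

section \<open>Twisted convolution\<close>

lemma infsum_finite_sum:
  fixes f :: "'i \<Rightarrow> 'x \<Rightarrow> complex"
  assumes "finite I" "\<And>i. i \<in> I \<Longrightarrow> f i summable_on A"
  shows "(\<Sum>\<^sub>\<infinity>x\<in>A. \<Sum>i\<in>I. f i x) = (\<Sum>i\<in>I. \<Sum>\<^sub>\<infinity>x\<in>A. f i x)"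
proof -
  have "((\<lambda>x. \<Sum>i\<in>I. f i x) has_sum (\<Sum>i\<in>I. \<Sum>\<^sub>\<infinity>x\<in>A. f i x)) A"
    using assms by (induction I rule: finite_induct) (auto intro: has_sum_add)
  then show ?thesis by (rule infsumI)
qed

abbreviation supp :: "('x \<Rightarrow> complex) \<Rightarrow> 'x set" where
  "supp f \<equiv> {x. f x \<noteq> 0}"

text \<open>The cocycle is taken to be a bicharacter of modulus 1. This yields associativity and a
  closed form of the involution, and it makes \<open>\<sigma> x \<eta>\<close> multiplicative in
  \<open>x\<close>, which is what lets twisted right translations commute with the representation.
  The group is a carrier set because these properties of \<open>sigma p \<theta>\<close> are
  established on \<open>Gam p\<close>.\<close>

locale twisted_group =
  fixes G :: "'a::ab_group_add set" and \<sigma> :: "'a \<Rightarrow> 'a \<Rightarrow> complex"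
  assumes G0: "0 \<in> G"
    and G_diff: "\<lbrakk>x \<in> G; y \<in> G\<rbrakk> \<Longrightarrow> x - y \<in> G"
    and sig_add_left: "\<lbrakk>x \<in> G; y \<in> G; z \<in> G\<rbrakk> \<Longrightarrow> \<sigma> (x + y) z = \<sigma> x z * \<sigma> y z"
    and sig_add_right: "\<lbrakk>x \<in> G; y \<in> G; z \<in> G\<rbrakk> \<Longrightarrow> \<sigma> z (x + y) = \<sigma> z x * \<sigma> z y"
    and sig_norm: "\<lbrakk>x \<in> G; y \<in> G\<rbrakk> \<Longrightarrow> cmod (\<sigma> x y) = 1"
begin

lemma G_uminus: "x \<in> G \<Longrightarrow> - x \<in> G"
  using G_diff[OF G0, of x] by simp

lemma G_add: "\<lbrakk>x \<in> G; y \<in> G\<rbrakk> \<Longrightarrow> x + y \<in> G"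
  using G_diff[of x "- y"] G_uminus[of y] by simp

lemma sig_neq: "\<lbrakk>x \<in> G; y \<in> G\<rbrakk> \<Longrightarrow> \<sigma> x y \<noteq> 0"
  using sig_norm[of x y] by auto

lemma sig_cnj: "\<lbrakk>x \<in> G; y \<in> G\<rbrakk> \<Longrightarrow> \<sigma> x y * cnj (\<sigma> x y) = 1"
  using sig_norm[of x y] by (simp flip: complex_norm_square)

lemma sig_zero [simp]:
  assumes "x \<in> G" shows "\<sigma> 0 x = 1" "\<sigma> x 0 = 1"
  using sig_add_left[of 0 0 x] sig_add_right[of 0 0 x] sig_neq[of 0 x] sig_neq[of x 0] assms G0
  by simp_all

lemma sig_uminus_left: "\<lbrakk>x \<in> G; y \<in> G\<rbrakk> \<Longrightarrow> \<sigma> (- x) y = cnj (\<sigma> x y)"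
  using sig_add_left[of x "- x" y] sig_cnj[of x y] sig_neq[of x y] G_uminus[of x]
  by (metis add.right_inverse mult_left_cancel sig_zero(1))

definition fs :: "('a \<Rightarrow> complex) set" where
  "fs = {f. finite (supp f) \<and> supp f \<subseteq> G}"

lemma fsI: "\<lbrakk>finite E; E \<subseteq> G; \<And>x. x \<notin> E \<Longrightarrow> f x = 0\<rbrakk> \<Longrightarrow> f \<in> fs"
  unfolding fs_def by (auto intro: finite_subset[of _ E])

lemma fs_finite: "f \<in> fs \<Longrightarrow> finite (supp f)"
  and fs_sub: "f \<in> fs \<Longrightarrow> supp f \<subseteq> G"
  and fs_G: "f \<in> fs \<Longrightarrow> f x \<noteq> 0 \<Longrightarrow> x \<in> G"
  by (auto simp: fs_def)

lemma fs_l2: "f \<in> fs \<Longrightarrow> f \<in> l2 G"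
  by (rule l2_finite(1)[of "supp f"]) (auto simp: fs_def)

lemma fs_mono: "f \<in> fs \<Longrightarrow> (\<And>x. f x = 0 \<Longrightarrow> g x = 0) \<Longrightarrow> g \<in> fs"
  by (rule fsI[of "supp f"]) (auto simp: fs_def)

lemma fs_add: "f \<in> fs \<Longrightarrow> g \<in> fs \<Longrightarrow> (\<lambda>x. f x + g x) \<in> fs"
  by (rule fsI[of "supp f \<union> supp g"]) (auto simp: fs_def)

lemma fs_diff: "f \<in> fs \<Longrightarrow> g \<in> fs \<Longrightarrow> (\<lambda>x. f x - g x) \<in> fs"
  by (rule fsI[of "supp f \<union> supp g"]) (auto simp: fs_def)

lemma fs_scale: "f \<in> fs \<Longrightarrow> (\<lambda>x. c * f x) \<in> fs"
  and fs_mult: "f \<in> fs \<Longrightarrow> (\<lambda>x. w x * f x) \<in> fs"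
  and fs_restr: "f \<in> fs \<Longrightarrow> restr A f \<in> fs"
  by (erule fs_mono, simp add: restr_def)+

lemma fs_zero: "(\<lambda>_. 0) \<in> fs"
  by (rule fsI[of "{}"]) auto

lemma fs_delta: "x \<in> G \<Longrightarrow> delta x \<in> fs"
  by (rule fsI[of "{x}"]) (auto simp: delta_def)

text \<open>The index set is the support of \<open>f\<close>, so for \<open>f\<close> in
  \<open>fs\<close> the sum is finite whatever the function \<open>g\<close> is;
  \<open>tconv_eq\<close> allows any larger finite index set.\<close>

definition tconv :: "('a \<Rightarrow> complex) \<Rightarrow> ('a \<Rightarrow> complex) \<Rightarrow> 'a \<Rightarrow> complex" where
  "tconv f g = (\<lambda>\<gamma>. if \<gamma> \<in> G then (\<Sum>x\<in>supp f. \<sigma> x (\<gamma> - x) * f x * g (\<gamma> - x)) else 0)"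

lemma tconv_eq:
  assumes "finite E" "supp f \<subseteq> E" "\<gamma> \<in> G"
  shows "tconv f g \<gamma> = (\<Sum>x\<in>E. \<sigma> x (\<gamma> - x) * f x * g (\<gamma> - x))"
  unfolding tconv_def using assms by (auto intro!: sum.mono_neutral_left)

lemma tconv_outside [simp]: "\<gamma> \<notin> G \<Longrightarrow> tconv f g \<gamma> = 0"
  by (simp add: tconv_def)

lemma tconv_nz:
  assumes "tconv f g \<gamma> \<noteq> 0"
  obtains x where "f x \<noteq> 0" "g (\<gamma> - x) \<noteq> 0" "\<gamma> \<in> G"
proof -
  have \<gamma>: "\<gamma> \<in> G" using assms by (metis tconv_outside)
  have "\<exists>x. f x \<noteq> 0 \<and> g (\<gamma> - x) \<noteq> 0"
  proof (rule ccontr)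
    assume "\<nexists>x. f x \<noteq> 0 \<and> g (\<gamma> - x) \<noteq> 0"
    then have "tconv f g \<gamma> = 0" unfolding tconv_def by (auto intro!: sum.neutral)
    with assms show False by simp
  qed
  with \<gamma> that show thesis by blast
qed

lemma tconv_sum_left:
  assumes "finite I" "\<And>i. i \<in> I \<Longrightarrow> f i \<in> fs"
  shows "tconv (\<lambda>x. \<Sum>i\<in>I. f i x) g = (\<lambda>\<gamma>. \<Sum>i\<in>I. tconv (f i) g \<gamma>)"
proof
  fix \<gamma>
  let ?E = "\<Union>i\<in>I. {x. f i x \<noteq> 0}"
  have E: "finite ?E" using assms fs_finite by auto
  show "tconv (\<lambda>x. \<Sum>i\<in>I. f i x) g \<gamma> = (\<Sum>i\<in>I. tconv (f i) g \<gamma>)"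
  proof (cases "\<gamma> \<in> G")
    case True
    have "tconv (\<lambda>x. \<Sum>i\<in>I. f i x) g \<gamma> = (\<Sum>x\<in>?E. \<sigma> x (\<gamma> - x) * (\<Sum>i\<in>I. f i x) * g (\<gamma> - x))"
      by (rule tconv_eq[OF E _ True]) (auto dest: sum.not_neutral_contains_not_neutral)
    also have "\<dots> = (\<Sum>i\<in>I. \<Sum>x\<in>?E. \<sigma> x (\<gamma> - x) * f i x * g (\<gamma> - x))"
      by (subst sum.swap) (simp add: sum_distrib_left sum_distrib_right)
    also have "\<dots> = (\<Sum>i\<in>I. tconv (f i) g \<gamma>)"
      by (intro sum.cong refl tconv_eq[OF E _ True, symmetric]) auto
    finally show ?thesis .
  qed simp
qed

lemma tconv_add_left:
  assumes "f \<in> fs" "g \<in> fs"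
  shows "tconv (\<lambda>x. f x + g x) h = (\<lambda>\<gamma>. tconv f h \<gamma> + tconv g h \<gamma>)"
  using tconv_sum_left[of "UNIV::bool set" "\<lambda>b. if b then f else g" h] assms
  by (simp add: UNIV_bool add.commute)

lemma tconv_scale_left: "tconv (\<lambda>x. c * f x) h = (\<lambda>\<gamma>. c * tconv f h \<gamma>)"
  unfolding tconv_def by (cases "c = 0") (auto simp: sum_distrib_left intro!: ext sum.cong)

lemma tconv_diff_left:
  assumes "f \<in> fs" "g \<in> fs"
  shows "tconv (\<lambda>x. f x - g x) h = (\<lambda>\<gamma>. tconv f h \<gamma> - tconv g h \<gamma>)"
  using tconv_add_left[OF assms(1) fs_scale[OF assms(2), of "-1"], of h] tconv_scale_left[of "-1" g h]
  by simp

lemma tconv_sum_right: "tconv f (\<lambda>x. \<Sum>i\<in>I. g i x) = (\<lambda>\<gamma>. \<Sum>i\<in>I. tconv f (g i) \<gamma>)"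
proof
  fix \<gamma> show "tconv f (\<lambda>x. \<Sum>i\<in>I. g i x) \<gamma> = (\<Sum>i\<in>I. tconv f (g i) \<gamma>)"
    unfolding tconv_def by (simp add: sum_distrib_left sum.swap[of _ I])
qed

lemma tconv_add_right: "tconv f (\<lambda>x. g x + h x) = (\<lambda>\<gamma>. tconv f g \<gamma> + tconv f h \<gamma>)"
  unfolding tconv_def by (auto simp: algebra_simps sum.distrib)

lemma tconv_scale_right: "tconv f (\<lambda>x. c * h x) = (\<lambda>\<gamma>. c * tconv f h \<gamma>)"
  unfolding tconv_def by (auto simp: algebra_simps sum_distrib_left)

lemma tconv_zero_right [simp]: "tconv f (\<lambda>_. 0) = (\<lambda>_. 0)"
  by (simp add: tconv_def fun_eq_iff)

lemma tconv_supp: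
  assumes "f \<in> fs" "g \<in> fs"
  defines "E \<equiv> (\<lambda>(x, y). x + y) ` (supp f \<times> supp g)"
  shows "finite E" "E \<subseteq> G" "\<And>\<gamma>. \<gamma> \<notin> E \<Longrightarrow> tconv f g \<gamma> = 0"
proof -
  show "finite E" using assms fs_finite by (simp add: E_def)
  show "E \<subseteq> G" using assms fs_G G_add by (auto simp: E_def)
  fix \<gamma> assume n: "\<gamma> \<notin> E"
  show "tconv f g \<gamma> = 0"
  proof (rule ccontr)
    assume "tconv f g \<gamma> \<noteq> 0"
    then obtain x where "f x \<noteq> 0" "g (\<gamma> - x) \<noteq> 0" using tconv_nz by blast
    then have "\<gamma> \<in> E" unfolding E_def by (intro image_eqI[of _ _ "(x, \<gamma> - x)"]) auto
    with n show False by simp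
  qed
qed

lemma tconv_fs: "f \<in> fs \<Longrightarrow> g \<in> fs \<Longrightarrow> tconv f g \<in> fs"
  by (rule fsI[OF tconv_supp])

lemma l2norm_translate:
  assumes "\<eta> \<in> G" "\<And>x. x \<in> G \<Longrightarrow> cmod (h (x + \<eta>)) = cmod (g x)"
  shows "l2norm G h = l2norm G g"
proof -
  have "bij_betw (\<lambda>x. x + \<eta>) G G"
    by (rule bij_betw_byWitness[where f'="\<lambda>x. x - \<eta>"]) (auto simp: G_add G_diff assms)
  then have "(\<Sum>\<^sub>\<infinity>x\<in>G. (cmod (h (x + \<eta>)))\<^sup>2) = (\<Sum>\<^sub>\<infinity>x\<in>G. (cmod (h x))\<^sup>2)"
    by (rule infsum_reindex_bij_betw)
  then show ?thesis unfolding l2norm_def using assms(2) by (simp cong: infsum_cong)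
qed

lemma l2_translate:
  assumes "\<eta> \<in> G" "g \<in> l2 G" shows "(\<lambda>x. if x \<in> G then g (x - \<eta>) else 0) \<in> l2 G"
    "l2norm G (\<lambda>x. if x \<in> G then g (x - \<eta>) else 0) = l2norm G g"
proof -
  have "bij_betw (\<lambda>x. x - \<eta>) G G"
    by (rule bij_betw_byWitness[where f'="\<lambda>x. x + \<eta>"]) (auto simp: G_add G_diff assms)
  then have "(\<lambda>x. (cmod (g (x - \<eta>)))\<^sup>2) summable_on G"
    using assms(2) summable_on_reindex_bij_betw[of "\<lambda>x. x - \<eta>" G G "\<lambda>x. (cmod (g x))\<^sup>2"]
    by (simp add: l2_def)
  then show "(\<lambda>x. if x \<in> G then g (x - \<eta>) else 0) \<in> l2 G"
    by (simp add: l2_def cong: summable_on_cong)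
  show "l2norm G (\<lambda>x. if x \<in> G then g (x - \<eta>) else 0) = l2norm G g"
    by (rule l2norm_translate[OF assms(1)]) (simp add: G_add assms)
qed

section \<open>The left regular representation by bounded operators\<close>

lemma tconv_l2:
  assumes "f \<in> fs" "g \<in> l2 G"
  shows "tconv f g \<in> l2 G" "l2norm G (tconv f g) \<le> (\<Sum>x\<in>supp f. cmod (f x)) * l2norm G g"
proof -
  let ?t = "\<lambda>x \<gamma>. if \<gamma> \<in> G then \<sigma> x (\<gamma> - x) * f x * g (\<gamma> - x) else 0"
  have e: "tconv f g = (\<lambda>\<gamma>. \<Sum>x\<in>supp f. ?t x \<gamma>)"
    by (rule ext) (simp add: tconv_def)
  have t: "?t x \<in> l2 G" "l2norm G (?t x) \<le> cmod (f x) * l2norm G g" if "f x \<noteq> 0" for x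
  proof -
    have x: "x \<in> G" using fs_G assms that by blast
    show "?t x \<in> l2 G" "l2norm G (?t x) \<le> cmod (f x) * l2norm G g"
      using l2_mono[OF l2_translate(1)[OF x assms(2)], of "?t x" "cmod (f x)"]
        l2_translate(2)[OF x assms(2)] x
      by (auto simp: norm_mult sig_norm G_diff)
  qed
  have s: "(\<lambda>\<gamma>. \<Sum>x\<in>supp f. ?t x \<gamma>) \<in> l2 G
    \<and> l2norm G (\<lambda>\<gamma>. \<Sum>x\<in>supp f. ?t x \<gamma>) \<le> (\<Sum>x\<in>supp f. l2norm G (?t x))"
    by (rule l2_sum) (use t fs_finite[OF assms(1)] in auto)
  then show "tconv f g \<in> l2 G" by (simp add: e)
  show "l2norm G (tconv f g) \<le> (\<Sum>x\<in>supp f. cmod (f x)) * l2norm G g"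
    unfolding e sum_distrib_right
    by (rule order_trans[OF conjunct2[OF s]]) (auto intro!: sum_mono t)
qed

definition lop :: "('a \<Rightarrow> complex) \<Rightarrow> 'a op" where
  "lop f = (\<lambda>g. if g \<in> l2 G then tconv f g else (\<lambda>_. 0))"

lemma lop_apply: "g \<in> l2 G \<Longrightarrow> lop f g = tconv f g"
  by (simp add: lop_def)

lemma is_op_lop: "f \<in> fs \<Longrightarrow> is_op G (lop f)"
  unfolding is_op_def lop_def
  by (auto simp: tconv_l2 l2_add l2_scale tconv_add_right tconv_scale_right)

lemma lop_bounded: assumes "f \<in> fs" obtains B where "0 \<le> B" "bnd G (lop f) B"
  by (rule that[of "\<Sum>x\<in>supp f. cmod (f x)"])
    (auto simp: bnd_def lop_apply tconv_l2 assms sum_nonneg)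

lemma lop_finite:
  assumes "f \<in> fs" shows "opnorm G (lop f) < \<infinity>"
proof -
  obtain B where "0 \<le> B" "bnd G (lop f) B" using lop_bounded[OF assms] .
  then have "opnorm G (lop f) \<le> ereal B" using opnorm_le_iff[OF is_op_lop[OF assms]] by blast
  then show ?thesis by (rule le_less_trans) simp
qed

text \<open>On a finite set \<open>F\<close> the values of \<open>tconv f g\<close> involve
  \<open>g\<close> only at differences of elements of \<open>F\<close> and of the support of
  \<open>f\<close>. Cutting \<open>g\<close> down to these gives a test vector in \<open>fs\<close>,
  so a bound on \<open>fs\<close> reaches \<open>l2 G\<close> without a limit.\<close>

lemma bnd_lop:
  assumes f: "f \<in> fs" and B: "0 \<le> B" and b: "\<And>\<xi>. \<xi> \<in> fs \<Longrightarrow> l2norm G (tconv f \<xi>) \<le> B * l2norm G \<xi>"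
  shows "bnd G (lop f) B"
  unfolding bnd_def
proof
  fix g assume g: "g \<in> l2 G"
  have "l2norm G (tconv f g) \<le> B * l2norm G g"
  proof (rule l2_bound(2))
    fix F assume F: "finite F" "F \<subseteq> G"
    let ?E = "(\<lambda>(y, x). y - x) ` (F \<times> supp f)"
    let ?\<xi> = "restr ?E g"
    have \<xi>: "?\<xi> \<in> fs"
      by (rule fsI[of ?E]) (use F fs_finite[OF f] fs_G[OF f] in \<open>auto simp: restr_def intro!: G_diff\<close>)
    have "tconv f g y = tconv f ?\<xi> y" if "y \<in> F" for y
      unfolding tconv_def restr_def using that by (auto intro!: sum.cong)
    then have "L2_set (\<lambda>x. cmod (tconv f g x)) F = L2_set (\<lambda>x. cmod (tconv f ?\<xi> x)) F"
      by (auto intro: L2_set_cong)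
    also have "\<dots> \<le> l2norm G (tconv f ?\<xi>)"
      by (rule L2_set_le_l2norm[OF tconv_l2(1)[OF f fs_l2[OF \<xi>]] F])
    also have "\<dots> \<le> B * l2norm G ?\<xi>" by (rule b[OF \<xi>])
    also have "\<dots> \<le> B * l2norm G g" by (rule mult_left_mono[OF restr_l2(2)[OF g] B])
    finally show "L2_set (\<lambda>x. cmod (tconv f g x)) F \<le> B * l2norm G g" .
  qed (use B in auto)
  then show "l2norm G (lop f g) \<le> B * l2norm G g" by (simp add: lop_apply[OF g])
qed

lemma lop_add: "f \<in> fs \<Longrightarrow> g \<in> fs \<Longrightarrow> op_add (lop f) (lop g) = lop (\<lambda>x. f x + g x)"
  by (auto simp: op_add_def lop_def tconv_add_left fun_eq_iff)

lemma lop_scale: "op_scale c (lop f) = lop (\<lambda>x. c * f x)"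
  by (auto simp: op_scale_def lop_def tconv_scale_left fun_eq_iff)

lemma lop_minus: "f \<in> fs \<Longrightarrow> g \<in> fs \<Longrightarrow> op_minus (lop f) (lop g) = lop (\<lambda>x. f x - g x)"
  by (auto simp: op_minus_apply lop_def tconv_diff_left fun_eq_iff)

lemma tconv_delta_zero:
  assumes "g \<in> l2 G" shows "tconv (delta 0) g = g"
proof
  fix \<gamma> show "tconv (delta 0) g \<gamma> = g \<gamma>"
    using tconv_eq[of "{0}" "delta 0" \<gamma> g] l2_outside[OF assms, of \<gamma>]
    by (cases "\<gamma> \<in> G") (auto simp: delta_def)
qed

lemma lop_one: "lop (delta 0) = op_one G"
  by (auto simp: lop_def op_one_def tconv_delta_zero)

lemma tconv_delta_right: "\<gamma> \<in> G \<Longrightarrow> f \<in> fs \<Longrightarrow> tconv f (delta 0) \<gamma> = f \<gamma>"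
  by (subst tconv_eq[of "insert \<gamma> (supp f)"])
     (auto simp: fs_finite sum.remove[of _ \<gamma>] delta_def intro!: sum.neutral split: if_splits)

text \<open>With \<open>z = x + y\<close> both sides become one double sum over the supports of
  \<open>f\<close> and \<open>g\<close>. The phases agree by the cocycle identity \<open>\<sigma> (x
  + y) (\<gamma> - x - y) * \<sigma> x y = \<sigma> x (\<gamma> - x) * \<sigma> y (\<gamma> - x -
  y)\<close>.\<close>

lemma tconv_assoc:
  assumes f: "f \<in> fs" and g: "g \<in> fs"
  shows "tconv f (tconv g h) = tconv (tconv f g) h"
proof
  fix \<gamma>
  let ?X = "supp f" and ?Y = "supp g"
  let ?Z = "(\<lambda>(x, y). x + y) ` (?X \<times> ?Y)"
  have fin: "finite ?X" "finite ?Y" using fs_finite f g by auto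
  show "tconv f (tconv g h) \<gamma> = tconv (tconv f g) h \<gamma>"
  proof (cases "\<gamma> \<in> G")
    case True
    have Z: "finite ?Z" "?Z \<subseteq> G" "{x. tconv f g x \<noteq> 0} \<subseteq> ?Z"
      using tconv_supp[OF f g] by auto
    have "tconv (tconv f g) h \<gamma> = (\<Sum>z\<in>?Z. \<sigma> z (\<gamma> - z) * tconv f g z * h (\<gamma> - z))"
      by (rule tconv_eq[OF Z(1,3) True])
    also have "\<dots> = (\<Sum>z\<in>?Z. \<Sum>x\<in>?X. \<sigma> z (\<gamma> - z) * (\<sigma> x (z - x) * f x * g (z - x)) * h (\<gamma> - z))"
      using Z(2) by (intro sum.cong refl) (auto simp: tconv_def sum_distrib_left sum_distrib_right)
    also have "\<dots> = (\<Sum>x\<in>?X. \<Sum>z\<in>?Z. \<sigma> z (\<gamma> - z) * (\<sigma> x (z - x) * f x * g (z - x)) * h (\<gamma> - z))"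
      by (rule sum.swap)
    also have "\<dots> = (\<Sum>x\<in>?X. \<Sum>z\<in>(\<lambda>y. x + y) ` ?Y.
        \<sigma> z (\<gamma> - z) * (\<sigma> x (z - x) * f x * g (z - x)) * h (\<gamma> - z))"
    proof (rule sum.cong[OF refl], rule sum.mono_neutral_right[OF Z(1)])
      fix x assume x: "x \<in> ?X"
      show "(\<lambda>y. x + y) ` ?Y \<subseteq> ?Z" using x by auto
      show "\<forall>z\<in>?Z - (\<lambda>y. x + y) ` ?Y.
          \<sigma> z (\<gamma> - z) * (\<sigma> x (z - x) * f x * g (z - x)) * h (\<gamma> - z) = 0"
      proof
        fix z assume "z \<in> ?Z - (\<lambda>y. x + y) ` ?Y"
        then have "g (z - x) = 0" using image_eqI[of z "\<lambda>y. x + y" "z - x" ?Y] by auto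
        then show "\<sigma> z (\<gamma> - z) * (\<sigma> x (z - x) * f x * g (z - x)) * h (\<gamma> - z) = 0" by simp
      qed
    qed
    also have "\<dots> = (\<Sum>x\<in>?X. \<Sum>y\<in>?Y.
        \<sigma> (x + y) (\<gamma> - (x + y)) * (\<sigma> x y * f x * g y) * h (\<gamma> - (x + y)))"
      by (rule sum.cong[OF refl], subst sum.reindex) (auto simp: inj_on_def)
    also have "\<dots> = (\<Sum>x\<in>?X. \<Sum>y\<in>?Y.
        \<sigma> x (\<gamma> - x) * f x * (\<sigma> y (\<gamma> - x - y) * g y * h (\<gamma> - x - y)))"
    proof (intro sum.cong refl)
      fix x y assume "x \<in> ?X" "y \<in> ?Y"
      then have xy: "x \<in> G" "y \<in> G" using fs_G f g by auto
      have r: "\<gamma> - x - y \<in> G" using True xy G_diff by blast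
      have e: "\<gamma> - (x + y) = \<gamma> - x - y" by simp
      have "\<sigma> x (\<gamma> - x) = \<sigma> x ((\<gamma> - x - y) + y)" by simp
      also have "\<dots> = \<sigma> x (\<gamma> - x - y) * \<sigma> x y" by (rule sig_add_right[OF r xy(2,1)])
      finally show "\<sigma> (x + y) (\<gamma> - (x + y)) * (\<sigma> x y * f x * g y) * h (\<gamma> - (x + y))
        = \<sigma> x (\<gamma> - x) * f x * (\<sigma> y (\<gamma> - x - y) * g y * h (\<gamma> - x - y))"
        unfolding e sig_add_left[OF xy r] by simp
    qed
    also have "\<dots> = tconv f (tconv g h) \<gamma>"
      using True fs_G[OF f] G_diff by (auto simp: tconv_def sum_distrib_left intro!: sum.cong)
    finally show ?thesis by simp
  qed simp
qed

lemma lop_comp: "f \<in> fs \<Longrightarrow> g \<in> fs \<Longrightarrow> lop f \<circ> lop g = lop (tconv f g)"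
  using tconv_l2(1)[of g] by (auto simp: lop_def tconv_assoc fun_eq_iff)

text \<open>The involution of the twisted group algebra. Its usual phase, the conjugate of
  \<open>\<sigma> x (- x)\<close>, equals \<open>\<sigma> x x\<close> for a bicharacter.\<close>

definition star :: "('a \<Rightarrow> complex) \<Rightarrow> 'a \<Rightarrow> complex" where
  "star f = (\<lambda>x. if x \<in> G then cnj (f (- x)) * \<sigma> x x else 0)"

lemma fs_star: assumes "f \<in> fs" shows "star f \<in> fs"
proof (rule fsI)
  show "finite (uminus ` supp f)" "uminus ` supp f \<subseteq> G"
    using fs_finite[OF assms] fs_G[OF assms] G_uminus by auto
  fix x assume "x \<notin> uminus ` supp f"
  then have "f (- x) = 0" using image_eqI[of x uminus "- x" "supp f"] by auto
  then show "star f x = 0" by (simp add: star_def)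
qed

text \<open>In each of the finitely many terms, shifting the summation variable by \<open>x\<close>
  moves the translation from \<open>g\<close> to \<open>h\<close>; the conjugated phase is the one
  that \<open>star f\<close> carries at \<open>- x\<close>.\<close>

lemma adj_lop:
  assumes f: "f \<in> fs" shows "adj G (lop f) (lop (star f))"
  unfolding adj_def
proof (intro ballI)
  fix g h assume g: "g \<in> l2 G" and h: "h \<in> l2 G"
  let ?X = "supp f"
  have fin: "finite ?X" using fs_finite f by auto
  have X: "x \<in> G" if "x \<in> ?X" for x using fs_G f that by auto
  let ?t = "\<lambda>x \<gamma>. \<sigma> x (\<gamma> - x) * f x * g (\<gamma> - x) * cnj (h \<gamma>)"
  let ?u = "\<lambda>x \<gamma>. \<sigma> x \<gamma> * f x * g \<gamma> * cnj (h (\<gamma> + x))"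
  have bij: "bij_betw (\<lambda>\<gamma>. \<gamma> + x) G G" if "x \<in> ?X" for x
    by (rule bij_betw_byWitness[where f'="\<lambda>\<gamma>. \<gamma> - x"]) (auto simp: G_add G_diff X[OF that])
  have ut: "?u x \<gamma> = ?t x (\<gamma> + x)" for x \<gamma> by simp
  have st: "?t x summable_on G" if x: "x \<in> ?X" for x
  proof -
    let ?k = "\<lambda>\<gamma>. if \<gamma> \<in> G then \<sigma> x (\<gamma> - x) * f x * g (\<gamma> - x) else 0"
    have "?k \<in> l2 G"
      using l2_mono(1)[OF l2_translate(1)[OF X[OF x] g], of ?k "cmod (f x)"] X[OF x]
      by (auto simp: norm_mult sig_norm G_diff)
    from l2inner_summable[OF this h] show ?thesis by (simp cong: summable_on_cong)
  qed
  have su: "?u x summable_on G" if "x \<in> ?X" for x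
    unfolding ut using st[OF that] summable_on_reindex_bij_betw[OF bij[OF that], of "?t x"] by simp
  have "l2inner G (lop f g) h = (\<Sum>\<^sub>\<infinity>\<gamma>\<in>G. \<Sum>x\<in>?X. ?t x \<gamma>)"
    unfolding l2inner_def lop_apply[OF g]
    by (intro infsum_cong) (simp add: tconv_def sum_distrib_right)
  also have "\<dots> = (\<Sum>x\<in>?X. \<Sum>\<^sub>\<infinity>\<gamma>\<in>G. ?t x \<gamma>)"
    by (rule infsum_finite_sum[OF fin st])
  also have "\<dots> = (\<Sum>x\<in>?X. \<Sum>\<^sub>\<infinity>\<gamma>\<in>G. ?u x \<gamma>)"
    unfolding ut by (intro sum.cong refl infsum_reindex_bij_betw[OF bij, symmetric]) auto
  also have "\<dots> = (\<Sum>\<^sub>\<infinity>\<gamma>\<in>G. \<Sum>x\<in>?X. ?u x \<gamma>)"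
    by (rule infsum_finite_sum[OF fin su, symmetric])
  also have "\<dots> = l2inner G g (lop (star f) h)"
    unfolding l2inner_def lop_apply[OF h]
  proof (rule infsum_cong)
    fix \<gamma> assume \<gamma>: "\<gamma> \<in> G"
    have "tconv (star f) h \<gamma> = (\<Sum>y\<in>uminus ` ?X. \<sigma> y (\<gamma> - y) * star f y * h (\<gamma> - y))"
      by (rule tconv_eq) (use \<gamma> fin in \<open>auto simp: star_def intro!: image_eqI[of _ uminus "- _"] split: if_splits\<close>)
    also have "\<dots> = (\<Sum>x\<in>?X. \<sigma> (- x) (\<gamma> + x) * star f (- x) * h (\<gamma> + x))"
      by (subst sum.reindex) auto
    also have "\<dots> = (\<Sum>x\<in>?X. cnj (\<sigma> x \<gamma> * f x) * h (\<gamma> + x))"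
    proof (intro sum.cong refl)
      fix x assume "x \<in> ?X"
      then have x: "x \<in> G" by (rule X)
      have a: "\<sigma> (- x) (\<gamma> + x) = cnj (\<sigma> x \<gamma>) * cnj (\<sigma> x x)"
        using sig_uminus_left[OF x G_add[OF \<gamma> x]] sig_add_right[OF \<gamma> x x] by simp
      have "\<sigma> x (- x) = cnj (\<sigma> x x)"
        using sig_add_right[of x "- x" x] x G_uminus[OF x] sig_cnj[OF x x] sig_neq[OF x x]
        by (metis add.right_inverse mult_left_cancel sig_zero(2))
      then have b: "\<sigma> (- x) (- x) = \<sigma> x x"
        using sig_uminus_left[OF x G_uminus[OF x]] by simp
      show "\<sigma> (- x) (\<gamma> + x) * star f (- x) * h (\<gamma> + x) = cnj (\<sigma> x \<gamma> * f x) * h (\<gamma> + x)"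
        using a b sig_cnj[OF x x] G_uminus[OF x] by (simp add: star_def algebra_simps)
    qed
    finally show "(\<Sum>x\<in>?X. ?u x \<gamma>) = g \<gamma> * cnj (tconv (star f) h \<gamma>)"
      by (simp add: sum_distrib_left algebra_simps)
  qed
  finally show "l2inner G (lop f g) h = l2inner G g (lop (star f) h)" .
qed

end

section \<open>Commutators with weights and class decompositions\<close>

text \<open>Pythagoras in pointwise form: functions with disjoint supports are orthogonal, and this
  is that fact at a single argument.\<close>

lemma norm_sum_sparse:
  fixes z :: "'i \<Rightarrow> complex"
  assumes "finite I" "\<And>i j. \<lbrakk>i \<in> I; j \<in> I; z i \<noteq> 0; z j \<noteq> 0\<rbrakk> \<Longrightarrow> i = j"
  shows "(cmod (\<Sum>i\<in>I. z i))\<^sup>2 = (\<Sum>i\<in>I. (cmod (z i))\<^sup>2)"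
proof (cases "\<exists>i\<in>I. z i \<noteq> 0")
  case True
  then obtain i where i: "i \<in> I" "z i \<noteq> 0" by blast
  then have "z j = 0" if "j \<in> I - {i}" for j using assms(2)[of i j] that by auto
  then show ?thesis using i assms(1) by (simp add: sum.remove[of I i])
qed simp

context twisted_group
begin

text \<open>The commutator of multiplication by \<open>w\<close> with convolution by
  \<open>f\<close>, applied to \<open>\<xi>\<close>. The weight is an arbitrary real function, so
  that translates and differences of the length can take its place.\<close>

definition comm :: "('a \<Rightarrow> real) \<Rightarrow> ('a \<Rightarrow> complex) \<Rightarrow> ('a \<Rightarrow> complex) \<Rightarrow> 'a \<Rightarrow> complex" where
  "comm w f \<xi> = (\<lambda>\<gamma>. of_real (w \<gamma>) * tconv f \<xi> \<gamma> - tconv f (\<lambda>x. of_real (w x) * \<xi> x) \<gamma>)"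

text \<open>Only differences of the weight enter. Additive constants drop out, and for an additive
  weight the factor is \<open>w x\<close>, which turns the commutator into a convolution.\<close>

lemma comm_eq:
  assumes "\<gamma> \<in> G"
  shows "comm w f \<xi> \<gamma> = (\<Sum>x\<in>supp f.
    of_real (w \<gamma> - w (\<gamma> - x)) * (\<sigma> x (\<gamma> - x) * f x * \<xi> (\<gamma> - x)))"
  using assms by (simp add: comm_def tconv_def sum_distrib_left algebra_simps sum_subtractf)

lemma comm_outside: "\<gamma> \<notin> G \<Longrightarrow> comm w f \<xi> \<gamma> = 0"
  by (simp add: comm_def)

lemma comm_fs: "f \<in> fs \<Longrightarrow> \<xi> \<in> fs \<Longrightarrow> comm w f \<xi> \<in> fs"
  unfolding comm_def by (intro fs_diff fs_mult tconv_fs)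

lemma comm_diff: "comm (\<lambda>x. v x - w x) f \<xi> = (\<lambda>\<gamma>. comm v f \<xi> \<gamma> - comm w f \<xi> \<gamma>)"
proof
  fix \<gamma> show "comm (\<lambda>x. v x - w x) f \<xi> \<gamma> = comm v f \<xi> \<gamma> - comm w f \<xi> \<gamma>"
    by (cases "\<gamma> \<in> G") (simp_all add: comm_eq comm_outside algebra_simps flip: sum_subtractf)
qed

text \<open>Right translation by \<open>\<eta>\<close>, twisted by \<open>\<sigma>(\<cdot>, \<eta>)\<close>, is a unitary which commutes with the left
  regular representation; conjugating with it translates the weight.\<close>
lemma comm_translate:
  assumes f: "f \<in> fs" and C: "\<And>\<xi>. \<xi> \<in> fs \<Longrightarrow> l2norm G (comm w f \<xi>) \<le> C * l2norm G \<xi>"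
    and \<eta>: "\<eta> \<in> G" and \<xi>: "\<xi> \<in> fs"
  shows "l2norm G (comm (\<lambda>x. w (x + \<eta>)) f \<xi>) \<le> C * l2norm G \<xi>"
proof -
  let ?\<xi> = "\<lambda>y. if y \<in> G then \<sigma> (y - \<eta>) \<eta> * \<xi> (y - \<eta>) else 0"
  have \<xi>': "?\<xi> \<in> fs"
  proof (rule fsI)
    show "finite ((\<lambda>x. x + \<eta>) ` supp \<xi>)" "(\<lambda>x. x + \<eta>) ` supp \<xi> \<subseteq> G"
      using fs_finite[OF \<xi>] fs_G[OF \<xi>] G_add \<eta> by auto
    fix y assume "y \<notin> (\<lambda>x. x + \<eta>) ` supp \<xi>"
    then have "\<xi> (y - \<eta>) = 0" using image_eqI[of y "\<lambda>x. x + \<eta>" "y - \<eta>" "supp \<xi>"] by auto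
    then show "?\<xi> y = 0" by simp
  qed
  have n: "l2norm G ?\<xi> = l2norm G \<xi>"
    by (rule l2norm_translate[OF \<eta>]) (simp add: G_add \<eta> norm_mult sig_norm)
  have "l2norm G (comm w f ?\<xi>) = l2norm G (comm (\<lambda>x. w (x + \<eta>)) f \<xi>)"
  proof (rule l2norm_translate[OF \<eta>])
    fix \<gamma> assume \<gamma>: "\<gamma> \<in> G"
    have "comm w f ?\<xi> (\<gamma> + \<eta>) = \<sigma> \<gamma> \<eta> * comm (\<lambda>x. w (x + \<eta>)) f \<xi> \<gamma>"
      unfolding comm_eq[OF \<gamma>] comm_eq[OF G_add[OF \<gamma> \<eta>]] sum_distrib_left
    proof (intro sum.cong refl)
      fix x assume "x \<in> supp f"
      then have x: "x \<in> G" using fs_G f by auto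
      have e: "\<gamma> + \<eta> - x = (\<gamma> - x) + \<eta>" by simp
      have "\<sigma> \<gamma> \<eta> = \<sigma> (x + (\<gamma> - x)) \<eta>" by simp
      also have "\<dots> = \<sigma> x \<eta> * \<sigma> (\<gamma> - x) \<eta>" by (rule sig_add_left[OF x G_diff[OF \<gamma> x] \<eta>])
      finally have s: "\<sigma> \<gamma> \<eta> = \<sigma> x \<eta> * \<sigma> (\<gamma> - x) \<eta>" .
      show "of_real (w (\<gamma> + \<eta>) - w (\<gamma> + \<eta> - x)) * (\<sigma> x (\<gamma> + \<eta> - x) * f x * ?\<xi> (\<gamma> + \<eta> - x))
        = \<sigma> \<gamma> \<eta> * (of_real (w (\<gamma> + \<eta>) - w (\<gamma> - x + \<eta>)) * (\<sigma> x (\<gamma> - x) * f x * \<xi> (\<gamma> - x)))"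
        unfolding e sig_add_right[OF G_diff[OF \<gamma> x] \<eta> x] s
        using G_add[OF G_diff[OF \<gamma> x] \<eta>] by simp
    qed
    then show "cmod (comm w f ?\<xi> (\<gamma> + \<eta>)) = cmod (comm (\<lambda>x. w (x + \<eta>)) f \<xi> \<gamma>)"
      using \<gamma> \<eta> by (simp add: norm_mult sig_norm)
  qed
  with C[OF \<xi>'] n show ?thesis by simp
qed

text \<open>The commutator is linear in the weight. Whatever looks the same from both places cancels
  in the difference, at the price of doubling the constant.\<close>

lemma comm_translate_diff:
  assumes f: "f \<in> fs" and C: "\<And>\<xi>. \<xi> \<in> fs \<Longrightarrow> l2norm G (comm w f \<xi>) \<le> C * l2norm G \<xi>"
    and \<eta>: "\<eta> \<in> G" "\<eta>' \<in> G" and \<xi>: "\<xi> \<in> fs"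
  shows "l2norm G (comm (\<lambda>x. w (x + \<eta>) - w (x + \<eta>')) f \<xi>) \<le> 2 * C * l2norm G \<xi>"
  unfolding comm_diff
  using l2_diff(2)[OF fs_l2[OF comm_fs[OF f \<xi>]] fs_l2[OF comm_fs[OF f \<xi>]],
      of "\<lambda>x. w (x + \<eta>)" "\<lambda>x. w (x + \<eta>')"]
    comm_translate[OF f C \<eta>(1) \<xi>] comm_translate[OF f C \<eta>(2) \<xi>]
  by linarith

lemma l2norm_fs_power2:
  assumes "finite E" "E \<subseteq> G" "\<And>x. x \<notin> E \<Longrightarrow> g x = 0"
  shows "(l2norm G g)\<^sup>2 = (\<Sum>x\<in>E. (cmod (g x))\<^sup>2)"
  using l2_finite(2)[OF assms] by (simp add: L2_set_power2)

text \<open>Says that \<open>\<kappa>\<close> labels elements as the cosets of a subgroup would: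
  once the class of \<open>x\<close> is fixed, the class of \<open>x + y\<close> and that of
  \<open>y\<close> determine each other. Labels of any type are allowed, which covers real
  coordinates as well as cosets of \<open>H m\<close>.\<close>

definition classmap :: "('a \<Rightarrow> 'b) \<Rightarrow> bool" where
  "classmap \<kappa> \<longleftrightarrow> (\<forall>x\<in>G. \<forall>y\<in>G. \<forall>x'\<in>G. \<forall>y'\<in>G. \<kappa> x = \<kappa> x' \<longrightarrow> (\<kappa> (x + y) = \<kappa> (x' + y') \<longleftrightarrow> \<kappa> y = \<kappa> y'))"

lemma classmapD:
  "\<lbrakk>classmap \<kappa>; \<kappa> x = \<kappa> x'; x \<in> G; y \<in> G; x' \<in> G; y' \<in> G\<rbrakk>
    \<Longrightarrow> \<kappa> (x + y) = \<kappa> (x' + y') \<longleftrightarrow> \<kappa> y = \<kappa> y'"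
  by (simp add: classmap_def)

lemma restr_class_sum:
  assumes "finite J" "\<And>x. f x \<noteq> 0 \<Longrightarrow> \<kappa> x \<in> J"
  shows "f = (\<lambda>x. \<Sum>j\<in>J. restr {x. \<kappa> x = j} f x)"
proof
  fix x show "f x = (\<Sum>j\<in>J. restr {x. \<kappa> x = j} f x)"
    using assms by (cases "f x = 0") (simp_all add: restr_def)
qed

text \<open>Distinct classes of \<open>f\<close> map a class of \<open>\<xi>\<close> to distinct classes, and vice versa: two
  orthogonal decompositions of the same double family.\<close>
lemma class_decomposition:
  assumes \<kappa>: "classmap \<kappa>" and f: "f \<in> fs" and \<xi>: "\<xi> \<in> fs" and J: "finite J"
    and C: "\<And>\<xi> i. \<xi> \<in> fs \<Longrightarrow> (\<And>x. \<xi> x \<noteq> 0 \<Longrightarrow> \<kappa> x = i) \<Longrightarrow> l2norm G (tconv f \<xi>) \<le> C * l2norm G \<xi>"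
    and C0: "0 \<le> C"
  shows "(\<Sum>j\<in>J. (l2norm G (tconv (restr {x. \<kappa> x = j} f) \<xi>))\<^sup>2) \<le> C\<^sup>2 * (l2norm G \<xi>)\<^sup>2"
proof -
  let ?f = "\<lambda>j. restr {x. \<kappa> x = j} f" and ?\<xi> = "\<lambda>i. restr {x. \<kappa> x = i} \<xi>"
  let ?I = "\<kappa> ` supp \<xi>" and ?J = "J \<union> \<kappa> ` supp f"
  let ?E = "(\<lambda>(x, y). x + y) ` (supp f \<times> supp \<xi>)"
  note E = tconv_supp[OF f \<xi>]
  have fin: "finite ?I" "finite ?J" using J fs_finite f \<xi> by auto
  have Eij: "tconv f' \<xi>' \<gamma> = 0" if "\<gamma> \<notin> ?E" "\<And>x. f x = 0 \<Longrightarrow> f' x = 0" "\<And>x. \<xi> x = 0 \<Longrightarrow> \<xi>' x = 0" for \<gamma> f' \<xi>'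
  proof (rule ccontr)
    assume "tconv f' \<xi>' \<gamma> \<noteq> 0"
    then obtain x where "f' x \<noteq> 0" "\<xi>' (\<gamma> - x) \<noteq> 0" using tconv_nz by blast
    then have "\<gamma> \<in> ?E" using that(2)[of x] that(3)[of "\<gamma> - x"]
      by (intro image_eqI[of _ _ "(x, \<gamma> - x)"]) auto
    with that(1) show False by simp
  qed
  have nrm: "(l2norm G (tconv f' \<xi>'))\<^sup>2 = (\<Sum>\<gamma>\<in>?E. (cmod (tconv f' \<xi>' \<gamma>))\<^sup>2)"
    if "\<And>x. f x = 0 \<Longrightarrow> f' x = 0" "\<And>x. \<xi> x = 0 \<Longrightarrow> \<xi>' x = 0" for f' \<xi>'
    by (rule l2norm_fs_power2[OF E(1,2)], rule Eij) (use that in auto)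
  have z: "\<exists>x. x \<in> G \<and> \<gamma> - x \<in> G \<and> \<kappa> x = j \<and> \<kappa> (\<gamma> - x) = i" if nz: "tconv (?f j) (?\<xi> i) \<gamma> \<noteq> 0" for i j \<gamma>
  proof -
    obtain x where "?f j x \<noteq> 0" "?\<xi> i (\<gamma> - x) \<noteq> 0" using tconv_nz[OF nz] by blast
    then show ?thesis using fs_G[OF f] fs_G[OF \<xi>]
      by (intro exI[of _ x]) (auto simp: restr_def split: if_splits)
  qed
  have A: "i = i'" if nz: "tconv (?f j) (?\<xi> i) \<gamma> \<noteq> 0" "tconv (?f j) (?\<xi> i') \<gamma> \<noteq> 0" for i i' j \<gamma>
  proof -
    obtain x where x: "x \<in> G" "\<gamma> - x \<in> G" "\<kappa> x = j" "\<kappa> (\<gamma> - x) = i" using z[OF nz(1)] by blast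
    obtain x' where x': "x' \<in> G" "\<gamma> - x' \<in> G" "\<kappa> x' = j" "\<kappa> (\<gamma> - x') = i'" using z[OF nz(2)] by blast
    have "\<kappa> (x + (\<gamma> - x)) = \<kappa> (x' + (\<gamma> - x')) \<longleftrightarrow> \<kappa> (\<gamma> - x) = \<kappa> (\<gamma> - x')"
      by (rule classmapD[OF \<kappa>]) (use x x' in simp_all)
    then show ?thesis using x(4) x'(4) by simp
  qed
  have B: "j = j'" if nz: "tconv (?f j) (?\<xi> i) \<gamma> \<noteq> 0" "tconv (?f j') (?\<xi> i) \<gamma> \<noteq> 0" for i j j' \<gamma>
  proof -
    obtain x where x: "x \<in> G" "\<gamma> - x \<in> G" "\<kappa> x = j" "\<kappa> (\<gamma> - x) = i" using z[OF nz(1)] by blast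
    obtain x' where x': "x' \<in> G" "\<gamma> - x' \<in> G" "\<kappa> x' = j'" "\<kappa> (\<gamma> - x') = i" using z[OF nz(2)] by blast
    have "\<kappa> (\<gamma> - x) = \<kappa> (\<gamma> - x')" using x x' by simp
    then have "\<kappa> ((\<gamma> - x) + x) = \<kappa> ((\<gamma> - x') + x') \<longleftrightarrow> \<kappa> x = \<kappa> x'"
      by (rule classmapD[OF \<kappa>]) (use x x' in simp_all)
    then show ?thesis using x(3) x'(3) by simp
  qed
  have \<xi>s: "\<xi> = (\<lambda>x. \<Sum>i\<in>?I. ?\<xi> i x)" by (rule restr_class_sum) (use fin in auto)
  have fsum: "f = (\<lambda>x. \<Sum>j\<in>?J. ?f j x)" by (rule restr_class_sum) (use fin in auto)
  have "(\<Sum>j\<in>J. (l2norm G (tconv (?f j) \<xi>))\<^sup>2) = (\<Sum>j\<in>J. \<Sum>\<gamma>\<in>?E. (cmod (tconv (?f j) \<xi> \<gamma>))\<^sup>2)"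
    by (intro sum.cong refl nrm) (auto simp: restr_def)
  also have "\<dots> = (\<Sum>j\<in>J. \<Sum>\<gamma>\<in>?E. \<Sum>i\<in>?I. (cmod (tconv (?f j) (?\<xi> i) \<gamma>))\<^sup>2)"
  proof (intro sum.cong refl)
    fix j \<gamma>
    have "tconv (?f j) \<xi> \<gamma> = (\<Sum>i\<in>?I. tconv (?f j) (?\<xi> i) \<gamma>)"
      by (subst \<xi>s) (simp only: tconv_sum_right)
    then show "(cmod (tconv (?f j) \<xi> \<gamma>))\<^sup>2 = (\<Sum>i\<in>?I. (cmod (tconv (?f j) (?\<xi> i) \<gamma>))\<^sup>2)"
      by (simp only:) (rule norm_sum_sparse[OF fin(1)], rule A)
  qed
  also have "\<dots> \<le> (\<Sum>j\<in>?J. \<Sum>\<gamma>\<in>?E. \<Sum>i\<in>?I. (cmod (tconv (?f j) (?\<xi> i) \<gamma>))\<^sup>2)"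
    by (rule sum_mono2[OF fin(2)]) (auto intro!: sum_nonneg)
  also have "\<dots> = (\<Sum>\<gamma>\<in>?E. \<Sum>j\<in>?J. \<Sum>i\<in>?I. (cmod (tconv (?f j) (?\<xi> i) \<gamma>))\<^sup>2)"
    by (rule sum.swap)
  also have "\<dots> = (\<Sum>\<gamma>\<in>?E. \<Sum>i\<in>?I. \<Sum>j\<in>?J. (cmod (tconv (?f j) (?\<xi> i) \<gamma>))\<^sup>2)"
    by (rule sum.cong[OF refl], rule sum.swap)
  also have "\<dots> = (\<Sum>\<gamma>\<in>?E. \<Sum>i\<in>?I. (cmod (tconv f (?\<xi> i) \<gamma>))\<^sup>2)"
  proof (intro sum.cong refl)
    fix i \<gamma>
    have "tconv f (?\<xi> i) \<gamma> = tconv (\<lambda>x. \<Sum>j\<in>?J. ?f j x) (?\<xi> i) \<gamma>" by (subst fsum) (rule refl)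
    also have "\<dots> = (\<Sum>j\<in>?J. tconv (?f j) (?\<xi> i) \<gamma>)"
      by (subst tconv_sum_left[OF fin(2)]) (use fs_restr[OF f] in auto)
    finally have e: "tconv f (?\<xi> i) \<gamma> = (\<Sum>j\<in>?J. tconv (?f j) (?\<xi> i) \<gamma>)" .
    show "(\<Sum>j\<in>?J. (cmod (tconv (?f j) (?\<xi> i) \<gamma>))\<^sup>2) = (cmod (tconv f (?\<xi> i) \<gamma>))\<^sup>2"
      unfolding e by (rule norm_sum_sparse[OF fin(2), symmetric], rule B)
  qed
  also have "\<dots> = (\<Sum>i\<in>?I. \<Sum>\<gamma>\<in>?E. (cmod (tconv f (?\<xi> i) \<gamma>))\<^sup>2)"
    by (rule sum.swap)
  also have "\<dots> = (\<Sum>i\<in>?I. (l2norm G (tconv f (?\<xi> i)))\<^sup>2)"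
    by (intro sum.cong refl nrm[symmetric]) (auto simp: restr_def)
  also have "\<dots> \<le> (\<Sum>i\<in>?I. C\<^sup>2 * (l2norm G (?\<xi> i))\<^sup>2)"
    unfolding power_mult_distrib[symmetric]
    by (intro sum_mono power_mono C fs_restr \<xi>) (auto simp: restr_def split: if_splits)
  also have "\<dots> = C\<^sup>2 * (\<Sum>i\<in>?I. \<Sum>x\<in>supp \<xi>. (cmod (?\<xi> i x))\<^sup>2)"
    unfolding sum_distrib_left[symmetric]
    by (intro arg_cong2[of _ _ _ _ "(*)"] refl sum.cong l2norm_fs_power2 fs_finite fs_sub \<xi>)
      (auto simp: restr_def)
  also have "\<dots> = C\<^sup>2 * (\<Sum>x\<in>supp \<xi>. \<Sum>i\<in>?I. (cmod (?\<xi> i x))\<^sup>2)"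
    by (subst sum.swap) (rule refl)
  also have "\<dots> = C\<^sup>2 * (\<Sum>x\<in>supp \<xi>. (cmod (\<xi> x))\<^sup>2)"
  proof -
    have "(\<Sum>i\<in>?I. (cmod (?\<xi> i x))\<^sup>2) = (cmod (\<xi> x))\<^sup>2" if "\<xi> x \<noteq> 0" for x
    proof -
      have "(\<Sum>i\<in>?I. (cmod (?\<xi> i x))\<^sup>2) = (\<Sum>i\<in>?I. if i = \<kappa> x then (cmod (\<xi> x))\<^sup>2 else 0)"
        by (rule sum.cong) (auto simp: restr_def)
      then show ?thesis using fin(1) that by simp
    qed
    then show ?thesis by simp
  qed
  also have "\<dots> = C\<^sup>2 * (l2norm G \<xi>)\<^sup>2"
    by (subst l2norm_fs_power2[of "supp \<xi>"]) (use fs_finite[OF \<xi>] fs_sub[OF \<xi>] in auto)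
  finally show ?thesis .
qed

text \<open>One term of the sum in \<open>class_decomposition\<close>. Its hypothesis is tested only
  on \<open>\<xi>\<close> inside a single class, so a weight can be centred according to that class,
  as \<open>coset_component_bound\<close> does, before a bound for every \<open>\<xi>\<close> is
  drawn.\<close>

lemma class_component:
  assumes "classmap \<kappa>" "f \<in> fs" "\<xi> \<in> fs" "0 \<le> C"
    and "\<And>\<xi> i. \<xi> \<in> fs \<Longrightarrow> (\<And>x. \<xi> x \<noteq> 0 \<Longrightarrow> \<kappa> x = i) \<Longrightarrow> l2norm G (tconv f \<xi>) \<le> C * l2norm G \<xi>"
  shows "l2norm G (tconv (restr {x. \<kappa> x = j} f) \<xi>) \<le> C * l2norm G \<xi>"
proof -
  have "(\<Sum>i\<in>{j}. (l2norm G (tconv (restr {x. \<kappa> x = i} f) \<xi>))\<^sup>2) \<le> C\<^sup>2 * (l2norm G \<xi>)\<^sup>2"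
    by (rule class_decomposition[OF assms(1-3) _ assms(5,4)]) auto
  then have "(l2norm G (tconv (restr {x. \<kappa> x = j} f) \<xi>))\<^sup>2 \<le> (C * l2norm G \<xi>)\<^sup>2"
    by (simp add: power_mult_distrib)
  then show ?thesis by (rule power2_le_imp_le) (use assms(4) in simp)
qed

text \<open>Cauchy-Schwarz over the classes: one factor is the square norm of \<open>k\<close> on
  \<open>J\<close>, the other is the square norm of the family of components applied to
  \<open>\<xi>\<close>, which \<open>class_decomposition\<close> bounds by
  \<open>C * l2norm G \<xi>\<close>.\<close>

lemma class_multiplier:
  fixes k :: "'b \<Rightarrow> complex"
  assumes "classmap \<kappa>" "f \<in> fs" "\<xi> \<in> fs" "0 \<le> C" "finite J"
    and "\<And>\<xi> i. \<xi> \<in> fs \<Longrightarrow> (\<And>x. \<xi> x \<noteq> 0 \<Longrightarrow> \<kappa> x = i) \<Longrightarrow> l2norm G (tconv f \<xi>) \<le> C * l2norm G \<xi>"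
  shows "l2norm G (tconv (\<lambda>x. if \<kappa> x \<in> J then k (\<kappa> x) * f x else 0) \<xi>)
    \<le> L2_set (\<lambda>j. cmod (k j)) J * (C * l2norm G \<xi>)"
proof -
  let ?f = "\<lambda>j. restr {x. \<kappa> x = j} f"
  have e: "(\<lambda>x. if \<kappa> x \<in> J then k (\<kappa> x) * f x else 0) = (\<lambda>x. \<Sum>j\<in>J. k j * ?f j x)"
  proof
    fix x
    have "(\<Sum>j\<in>J. k j * ?f j x) = (\<Sum>j\<in>J. if j = \<kappa> x then k (\<kappa> x) * f x else 0)"
      by (rule sum.cong) (auto simp: restr_def)
    then show "(if \<kappa> x \<in> J then k (\<kappa> x) * f x else 0) = (\<Sum>j\<in>J. k j * ?f j x)"
      using assms(5) by simp
  qed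
  have "tconv (\<lambda>x. if \<kappa> x \<in> J then k (\<kappa> x) * f x else 0) \<xi> = (\<lambda>\<gamma>. \<Sum>j\<in>J. k j * tconv (?f j) \<xi> \<gamma>)"
    unfolding e tconv_sum_left[OF assms(5) fs_scale[OF fs_restr[OF assms(2)]]] tconv_scale_left ..
  then have "l2norm G (tconv (\<lambda>x. if \<kappa> x \<in> J then k (\<kappa> x) * f x else 0) \<xi>)
    \<le> (\<Sum>j\<in>J. l2norm G (\<lambda>\<gamma>. k j * tconv (?f j) \<xi> \<gamma>))"
    by (simp only:) (rule conjunct2[OF l2_sum[OF assms(5)
      l2_scale[OF tconv_l2(1)[OF fs_restr[OF assms(2)] fs_l2[OF assms(3)]]]]])
  also have "\<dots> = (\<Sum>j\<in>J. \<bar>cmod (k j)\<bar> * \<bar>l2norm G (tconv (?f j) \<xi>)\<bar>)"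
    by (simp add: l2norm_scale)
  also have "\<dots> \<le> L2_set (\<lambda>j. cmod (k j)) J * L2_set (\<lambda>j. l2norm G (tconv (?f j) \<xi>)) J"
    by (rule L2_set_mult_ineq)
  also have "\<dots> \<le> L2_set (\<lambda>j. cmod (k j)) J * (C * l2norm G \<xi>)"
  proof (rule mult_left_mono[OF _ L2_set_nonneg])
    have "(L2_set (\<lambda>j. l2norm G (tconv (?f j) \<xi>)) J)\<^sup>2 \<le> (C * l2norm G \<xi>)\<^sup>2"
      using class_decomposition[OF assms(1-3,5) assms(6,4)]
      by (simp add: L2_set_power2 power_mult_distrib)
    then show "L2_set (\<lambda>j. l2norm G (tconv (?f j) \<xi>)) J \<le> C * l2norm G \<xi>"
      by (rule power2_le_imp_le) (use assms(4) in simp)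
  qed
  finally show ?thesis .
qed

text \<open>A norm bound for convolution by \<open>f\<close>, tested on \<open>fs\<close> alone;
  \<open>bnd_lop\<close> turns it into a bound on \<open>l2 G\<close>.\<close>

definition tbound :: "('a \<Rightarrow> complex) \<Rightarrow> real \<Rightarrow> bool" where
  "tbound f B \<longleftrightarrow> (\<forall>\<xi>\<in>fs. l2norm G (tconv f \<xi>) \<le> B * l2norm G \<xi>)"

lemma tboundD: "tbound f B \<Longrightarrow> \<xi> \<in> fs \<Longrightarrow> l2norm G (tconv f \<xi>) \<le> B * l2norm G \<xi>"
  by (simp add: tbound_def)

lemma tbound_mono: "tbound f B \<Longrightarrow> B \<le> C \<Longrightarrow> tbound f C"
  unfolding tbound_def by (meson l2norm_nonneg mult_right_mono order_trans)

lemma tbound_sum: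
  assumes "finite I" "\<And>i. i \<in> I \<Longrightarrow> f i \<in> fs" "\<And>i. i \<in> I \<Longrightarrow> tbound (f i) (B i)"
  shows "tbound (\<lambda>x. \<Sum>i\<in>I. f i x) (\<Sum>i\<in>I. B i)"
  unfolding tbound_def
proof
  fix \<xi> assume \<xi>: "\<xi> \<in> fs"
  have "l2norm G (\<lambda>\<gamma>. \<Sum>i\<in>I. tconv (f i) \<xi> \<gamma>) \<le> (\<Sum>i\<in>I. l2norm G (tconv (f i) \<xi>))"
    by (rule conjunct2[OF l2_sum[OF assms(1)]]) (intro fs_l2 tconv_fs assms \<xi>)
  also have "\<dots> \<le> (\<Sum>i\<in>I. B i * l2norm G \<xi>)" by (intro sum_mono tboundD assms \<xi>)
  finally show "l2norm G (tconv (\<lambda>x. \<Sum>i\<in>I. f i x) \<xi>) \<le> (\<Sum>i\<in>I. B i) * l2norm G \<xi>"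
    by (simp add: tconv_sum_left[OF assms(1,2)] sum_distrib_right)
qed

lemma tbound_add:
  assumes "f \<in> fs" "g \<in> fs" "tbound f B" "tbound g C"
  shows "tbound (\<lambda>x. f x + g x) (B + C)"
  using tbound_sum[of "UNIV::bool set" "\<lambda>b. if b then f else g" "\<lambda>b. if b then B else C"] assms
  by (simp add: UNIV_bool add.commute)

lemma tbound_restr_class:
  assumes "classmap \<kappa>" "f \<in> fs" "0 \<le> B" "tbound f B"
  shows "tbound (restr {x. \<kappa> x = j} f) B"
  unfolding tbound_def
  using class_component[OF assms(1,2) _ assms(3) tboundD[OF assms(4)]] by blast

text \<open>With finite supports the commutator sees the weight at finitely many places, so a
  translated length may be replaced by any weight with the same differences there.\<close>

lemma comm_cong:
  assumes "\<And>\<gamma> x. \<lbrakk>\<gamma> \<in> G; f x \<noteq> 0; \<xi> (\<gamma> - x) \<noteq> 0\<rbrakk> \<Longrightarrow> v \<gamma> - v (\<gamma> - x) = w \<gamma> - w (\<gamma> - x)"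
  shows "comm v f \<xi> = comm w f \<xi>"
proof
  fix \<gamma> show "comm v f \<xi> \<gamma> = comm w f \<xi> \<gamma>"
  proof (cases "\<gamma> \<in> G")
    case True
    have "of_real (v \<gamma> - v (\<gamma> - x)) * (\<sigma> x (\<gamma> - x) * f x * \<xi> (\<gamma> - x))
        = of_real (w \<gamma> - w (\<gamma> - x)) * (\<sigma> x (\<gamma> - x) * f x * \<xi> (\<gamma> - x))" if "f x \<noteq> 0" for x
      using assms[OF True that] by (cases "\<xi> (\<gamma> - x) = 0") auto
    then show ?thesis unfolding comm_eq[OF True] by (intro sum.cong refl) auto
  qed (simp add: comm_outside)
qed

lemma classmap_additive:
  assumes "\<And>x y. \<lbrakk>x \<in> G; y \<in> G\<rbrakk> \<Longrightarrow> c (x + y) = c x + (c y :: 'b :: cancel_semigroup_add)"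
  shows "classmap c"
  unfolding classmap_def using assms by simp

text \<open>The coset \<open>c x + K\<close> itself, as a set, serves as the label, so no
  representatives have to be chosen.\<close>

lemma classmap_coset:
  fixes c :: "'a \<Rightarrow> 'b :: ab_group_add"
  assumes "\<And>x y. \<lbrakk>x \<in> G; y \<in> G\<rbrakk> \<Longrightarrow> c (x + y) = c x + c y"
    and K: "0 \<in> K" "\<And>a b. \<lbrakk>a \<in> K; b \<in> K\<rbrakk> \<Longrightarrow> a - b \<in> K"
  shows "classmap (\<lambda>x. {z. z - c x \<in> K})"
proof -
  have eq: "{z. z - a \<in> K} = {z. z - b \<in> K} \<longleftrightarrow> a - b \<in> K" for a b
  proof
    assume "{z. z - a \<in> K} = {z. z - b \<in> K}"
    moreover have "a \<in> {z. z - a \<in> K}" using K(1) by simp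
    ultimately show "a - b \<in> K" by blast
  next
    assume ab: "a - b \<in> K"
    have ba: "b - a \<in> K" using K(2)[OF K(1) ab] by simp
    have "z - a \<in> K \<longleftrightarrow> z - b \<in> K" for z
      using K(2)[of "z - a" "b - a"] K(2)[of "z - b" "a - b"] ab ba by auto
    then show "{z. z - a \<in> K} = {z. z - b \<in> K}" by simp
  qed
  show ?thesis unfolding classmap_def eq
  proof (intro ballI impI)
    fix x y x' y' assume G: "x \<in> G" "y \<in> G" "x' \<in> G" "y' \<in> G" and d: "c x - c x' \<in> K"
    have e: "c (x + y) - c (x' + y') = (c x - c x') + (c y - c y')" using assms(1) G by simp
    have "(c x - c x') + (c y - c y') \<in> K \<longleftrightarrow> c y - c y' \<in> K"
    proof
      assume "(c x - c x') + (c y - c y') \<in> K"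
      from K(2)[OF this d] show "c y - c y' \<in> K" by simp
    next
      assume "c y - c y' \<in> K"
      from K(2)[OF d K(2)[OF K(1) this]] show "(c x - c x') + (c y - c y') \<in> K"
        by (simp add: algebra_simps)
    qed
    then show "c (x + y) - c (x' + y') \<in> K \<longleftrightarrow> c y - c y' \<in> K" by (simp only: e)
  qed
qed

end

section \<open>The algebra and the Lipschitz seminorm of a length function\<close>

lemma ereal_tendsto_zeroD:
  fixes u :: "nat \<Rightarrow> ereal"
  assumes "u \<longlonglongrightarrow> 0" "0 < e"
  obtains n where "u n < ereal e" 
  using order_tendstoD(2)[OF assms(1), of "ereal e"] assms(2)
  by (auto simp: zero_ereal_def eventually_sequentially)

text \<open>\<open>len_diff\<close> packs symmetry and the triangle inequality into the form in
  which the entries of the commutator are estimated; \<open>len_pos\<close> is what reduces the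
  kernel of the seminorm to the scalars.\<close>

locale twisted_length = twisted_group G \<sigma> for G :: "'a::ab_group_add set" and \<sigma> +
  fixes \<l> :: "'a \<Rightarrow> real"
  assumes len_zero: "\<l> 0 = 0"
    and len_pos: "\<lbrakk>x \<in> G; x \<noteq> 0\<rbrakk> \<Longrightarrow> 0 < \<l> x"
    and len_diff: "\<lbrakk>x \<in> G; y \<in> G\<rbrakk> \<Longrightarrow> \<bar>\<l> x - \<l> y\<bar> \<le> \<l> (x - y)"
begin

text \<open>This and the next two definitions copy \<open>Atheta\<close>, \<open>domL\<close> and
  \<open>LD\<close> for a general length, so that the concrete objects are recognised by
  unfolding.\<close>

definition alg :: "'a op set" where
  "alg = {T. is_op G T \<and>
      (\<exists>f. (\<forall>n. f n \<in> fs) \<and> (\<lambda>n. opnorm G (op_minus T (lop (f n)))) \<longlonglongrightarrow> 0)}"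

definition sadom :: "'a op set" where
  "sadom = {lop f | f. f \<in> fs \<and> self_adj G (lop f)}"

definition Lip :: "'a op \<Rightarrow> ereal" where
  "Lip a = (SUP g\<in>{g\<in>fs. l2norm G g \<le> 1}.
     ereal (l2norm G (\<lambda>\<gamma>. complex_of_real (\<l> \<gamma>) * a g \<gamma> - a (\<lambda>\<gamma>. complex_of_real (\<l> \<gamma>) * g \<gamma>) \<gamma>)))"

section \<open>The norm closure as a unital C*-algebra\<close>

lemma alg_is_op: "T \<in> alg \<Longrightarrow> is_op G T"
  by (simp add: alg_def)

lemma algD:
  assumes "T \<in> alg" "0 < e"
  obtains f where "f \<in> fs" "bnd G (op_minus T (lop f)) e"
proof -
  obtain f where f: "\<forall>n. f n \<in> fs" "(\<lambda>n. opnorm G (op_minus T (lop (f n)))) \<longlonglongrightarrow> 0"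
    using assms(1) by (auto simp: alg_def)
  obtain n where "opnorm G (op_minus T (lop (f n))) < ereal e"
    using ereal_tendsto_zeroD[OF f(2) assms(2)] .
  then have "bnd G (op_minus T (lop (f n))) e"
    using opnorm_le_iff[OF is_op_op_minus[OF alg_is_op[OF assms(1)] is_op_lop], of "f n" e] f(1) assms(2)
    by (simp add: less_imp_le)
  with that f(1) show thesis by blast
qed

lemma opnorm_tendsto_zeroI:
  assumes "\<And>n. is_op G (T n)" "\<And>n. bnd G (T n) (inverse (real (Suc n)))"
  shows "(\<lambda>n. opnorm G (T n)) \<longlonglongrightarrow> 0"
proof (rule tendsto_sandwich[OF always_eventually always_eventually tendsto_const])
  show "\<forall>n. 0 \<le> opnorm G (T n)" by (simp add: opnorm_nonneg)
  show "\<forall>n. opnorm G (T n) \<le> ereal (inverse (real (Suc n)))"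
    using opnorm_le_iff[OF assms(1)] assms(2) by simp
  have "(\<lambda>n. ereal (inverse (real (Suc n)))) \<longlonglongrightarrow> ereal 0"
    by (rule tendsto_ereal[OF LIMSEQ_inverse_real_of_nat])
  then show "(\<lambda>n. ereal (inverse (real (Suc n)))) \<longlonglongrightarrow> 0" by (simp add: zero_ereal_def)
qed

lemma algI:
  assumes "is_op G T" "\<And>e. 0 < e \<Longrightarrow> \<exists>f\<in>fs. bnd G (op_minus T (lop f)) e"
  shows "T \<in> alg"
proof -
  have "\<forall>n. \<exists>f\<in>fs. bnd G (op_minus T (lop f)) (inverse (real (Suc n)))"
    using assms(2) by simp
  then obtain f where f: "\<And>n. f n \<in> fs" "\<And>n. bnd G (op_minus T (lop (f n))) (inverse (real (Suc n)))"
    by metis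
  have "(\<lambda>n. opnorm G (op_minus T (lop (f n)))) \<longlonglongrightarrow> 0"
    by (rule opnorm_tendsto_zeroI[OF is_op_op_minus[OF assms(1) is_op_lop[OF f(1)]] f(2)])
  with assms(1) f(1) show ?thesis by (auto simp: alg_def)
qed

lemma alg_bounded:
  assumes "T \<in> alg" obtains B where "0 \<le> B" "bnd G T B"
proof -
  obtain f where f: "f \<in> fs" "bnd G (op_minus T (lop f)) 1" using algD[OF assms, of 1] by auto
  obtain B where B: "0 \<le> B" "bnd G (lop f) B" using lop_bounded[OF f(1)] .
  have e: "op_add (op_minus T (lop f)) (lop f) = T" by (simp add: op_minus_apply op_add_def)
  have "bnd G (op_add (op_minus T (lop f)) (lop f)) (1 + B)"
    by (rule bnd_op_add[OF is_op_op_minus[OF alg_is_op[OF assms] is_op_lop[OF f(1)]] is_op_lop[OF f(1)] f(2) B(2)])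
  with B(1) that[of "1 + B"] show thesis by (simp add: e)
qed

lemma alg_finite: assumes "T \<in> alg" shows "opnorm G T < \<infinity>"
proof -
  obtain B where "0 \<le> B" "bnd G T B" using alg_bounded[OF assms] .
  then have "opnorm G T \<le> ereal B" using opnorm_le_iff[OF alg_is_op[OF assms]] by blast
  then show ?thesis by (rule le_less_trans) simp
qed

lemma lop_alg: assumes "f \<in> fs" shows "lop f \<in> alg"
proof (rule algI[OF is_op_lop[OF assms]])
  fix e :: real assume "0 < e"
  then have "bnd G (op_minus (lop f) (lop f)) e" by (simp add: bnd_def op_minus_apply)
  with assms show "\<exists>g\<in>fs. bnd G (op_minus (lop f) (lop g)) e" by blast
qed

lemma alg_add:
  assumes T: "T \<in> alg" and S: "S \<in> alg" shows "op_add T S \<in> alg"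
proof (rule algI)
  note op = alg_is_op[OF T] alg_is_op[OF S]
  show "is_op G (op_add T S)" by (rule is_op_op_add[OF op])
  fix e :: real assume "0 < e"
  then have e2: "0 < e / 2" by simp
  obtain f where f: "f \<in> fs" "bnd G (op_minus T (lop f)) (e / 2)" using algD[OF T e2] .
  obtain g where g: "g \<in> fs" "bnd G (op_minus S (lop g)) (e / 2)" using algD[OF S e2] .
  have eq: "op_add (op_minus T (lop f)) (op_minus S (lop g)) = op_minus (op_add T S) (lop (\<lambda>x. f x + g x))"
    by (simp flip: lop_add[OF f(1) g(1)] add: op_add_def op_minus_apply fun_eq_iff)
  have "bnd G (op_minus (op_add T S) (lop (\<lambda>x. f x + g x))) (e / 2 + e / 2)"
    unfolding eq[symmetric]
    by (intro bnd_op_add is_op_op_minus op is_op_lop f g)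
  then show "\<exists>f\<in>fs. bnd G (op_minus (op_add T S) (lop f)) e" using fs_add[OF f(1) g(1)] by auto
qed

lemma alg_scale:
  assumes T: "T \<in> alg" shows "op_scale c T \<in> alg"
proof (rule algI)
  show "is_op G (op_scale c T)" by (rule is_op_op_scale[OF alg_is_op[OF T]])
  fix e :: real assume e: "0 < e"
  define d where "d = e / (cmod c + 1)"
  have pos: "0 < cmod c + 1" using norm_ge_zero[of c] by linarith
  then have d: "0 < d" using e by (simp add: d_def)
  obtain f where f: "f \<in> fs" "bnd G (op_minus T (lop f)) d" using algD[OF T d] .
  have eq: "op_scale c (op_minus T (lop f)) = op_minus (op_scale c T) (lop (\<lambda>x. c * f x))"
    by (simp flip: lop_scale add: op_scale_def op_minus_apply fun_eq_iff algebra_simps)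
  have "cmod c * d \<le> (cmod c + 1) * d" using d by (intro mult_right_mono) auto
  also have "\<dots> = e" using pos by (simp add: d_def)
  finally have "bnd G (op_minus (op_scale c T) (lop (\<lambda>x. c * f x))) e"
    unfolding eq[symmetric] by (rule bnd_mono[OF bnd_op_scale[OF f(2)]])
  then show "\<exists>f\<in>fs. bnd G (op_minus (op_scale c T) (lop f)) e" using fs_scale[OF f(1)] by blast
qed

lemma alg_comp:
  assumes T: "T \<in> alg" and S: "S \<in> alg" shows "T \<circ> S \<in> alg"
proof (rule algI)
  note op = alg_is_op[OF T] alg_is_op[OF S]
  show "is_op G (T \<circ> S)" by (rule is_op_comp[OF op])
  fix e :: real assume e: "0 < e"
  obtain B where B: "0 \<le> B" "bnd G S B" using alg_bounded[OF S] .
  define d where "d = e / (2 * (B + 1))"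
  have d: "0 < d" using e B(1) by (simp add: d_def)
  obtain f where f: "f \<in> fs" "bnd G (op_minus T (lop f)) d" using algD[OF T d] .
  obtain C where C: "0 \<le> C" "bnd G (lop f) C" using lop_bounded[OF f(1)] .
  \<comment> \<open>The accuracy for \<open>S\<close> is fixed only now, because its error gets
    multiplied by a bound \<open>C\<close> of the approximant of \<open>T\<close>.\<close>
  define d' where "d' = e / (2 * (C + 1))"
  have d': "0 < d'" using e C(1) by (simp add: d'_def)
  obtain g where g: "g \<in> fs" "bnd G (op_minus S (lop g)) d'" using algD[OF S d'] .
  note lops = is_op_lop[OF f(1)] is_op_lop[OF g(1)]
  have S2: "S h \<in> l2 G" and g2: "lop g h \<in> l2 G" for h
    using is_op_l2[OF op(2)] is_op_outside[OF op(2)] is_op_l2[OF lops(2)] is_op_outside[OF lops(2)]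
    by (cases "h \<in> l2 G"; simp)+
  have eq: "op_add (op_minus T (lop f) \<circ> S) (lop f \<circ> op_minus S (lop g)) = op_minus (T \<circ> S) (lop (tconv f g))"
    unfolding lop_comp[OF f(1) g(1), symmetric]
    by (simp add: op_add_def op_minus_apply fun_eq_iff is_op_diff[OF lops(1) S2 g2])
  have "bnd G (op_minus (T \<circ> S) (lop (tconv f g))) (d * B + C * d')"
    unfolding eq[symmetric]
    by (intro bnd_op_add bnd_comp is_op_comp is_op_op_minus op lops f g B C less_imp_le[OF d])
  moreover have "d * B \<le> e / 2" "C * d' \<le> e / 2"
    using e B(1) C(1) by (auto simp: d_def d'_def field_simps)
  ultimately have "bnd G (op_minus (T \<circ> S) (lop (tconv f g))) e"
    using bnd_mono[of G _ "d * B + C * d'" e] by simp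
  then show "\<exists>f\<in>fs. bnd G (op_minus (T \<circ> S) (lop f)) e" using tconv_fs[OF f(1) g(1)] by blast
qed

lemma alg_one: "op_one G \<in> alg"
  using lop_alg[OF fs_delta[OF G0]] by (simp add: lop_one)

text \<open>If \<open>lop f\<close> is close to \<open>T\<close>, then \<open>lop (star f)\<close>
  is equally close to the adjoint, since an adjoint inherits every norm bound.\<close>

lemma alg_adj:
  assumes T: "T \<in> alg" obtains S where "S \<in> alg" "adj G T S"
proof -
  obtain B where B: "0 \<le> B" "bnd G T B" using alg_bounded[OF T] .
  obtain S where S: "is_op G S" "bnd G S B" "adj G T S"
    using adjoint_exists[OF alg_is_op[OF T] B(2,1)] .
  have "S \<in> alg"
  proof (rule algI[OF S(1)])
    fix e :: real assume e: "0 < e"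
    obtain f where f: "f \<in> fs" "bnd G (op_minus T (lop f)) e" using algD[OF T e] .
    have "bnd G (op_minus S (lop (star f))) e"
      by (rule adj_bnd[OF _ _ adj_op_minus[OF _ _ _ _ S(3) adj_lop[OF f(1)]] f(2)])
         (use e in \<open>auto intro!: is_op_op_minus alg_is_op[OF T] is_op_lop f(1) S(1) fs_star\<close>)
    then show "\<exists>g\<in>fs. bnd G (op_minus S (lop g)) e" using fs_star[OF f(1)] by blast
  qed
  with S(3) that show thesis by blast
qed

lemma alg_closed:
  assumes T: "is_op G T" and s: "\<And>n. s n \<in> alg" "(\<lambda>n. opnorm G (op_minus T (s n))) \<longlonglongrightarrow> 0"
  shows "T \<in> alg"
proof (rule algI[OF T])
  fix e :: real assume "0 < e"
  then have e2: "0 < e / 2" by simp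
  obtain n where n: "opnorm G (op_minus T (s n)) < ereal (e / 2)"
    using ereal_tendsto_zeroD[OF s(2) e2] .
  note op = alg_is_op[OF s(1)[of n]]
  have b: "bnd G (op_minus T (s n)) (e / 2)"
    using opnorm_le_iff[OF is_op_op_minus[OF T op], of "e / 2"] n e2 by (simp add: less_imp_le)
  obtain f where f: "f \<in> fs" "bnd G (op_minus (s n) (lop f)) (e / 2)" using algD[OF s(1) e2] .
  have eq: "op_add (op_minus T (s n)) (op_minus (s n) (lop f)) = op_minus T (lop f)"
    by (simp add: op_add_def op_minus_apply fun_eq_iff)
  have "bnd G (op_minus T (lop f)) (e / 2 + e / 2)"
    unfolding eq[symmetric] by (intro bnd_op_add is_op_op_minus T op is_op_lop f b)
  with f(1) show "\<exists>f\<in>fs. bnd G (op_minus T (lop f)) e" by auto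
qed

lemma alg_unital_cstar_subalg: "unital_cstar_subalg G alg"
  unfolding unital_cstar_subalg_def
proof (intro conjI ballI allI impI)
  fix T assume "T \<in> alg"
  then show "\<exists>S\<in>alg. \<forall>g\<in>l2 G. \<forall>h\<in>l2 G. l2inner G (T g) h = l2inner G g (S h)"
    using alg_adj[of T] unfolding adj_def by metis
next
  fix T assume "is_op G T \<and> (\<exists>s. (\<forall>n. s n \<in> alg) \<and> (\<lambda>n. opnorm G (op_minus T (s n))) \<longlonglongrightarrow> 0)"
  then show "T \<in> alg" using alg_closed by blast
qed (auto intro: alg_is_op alg_finite alg_one alg_add alg_comp[unfolded comp_def] alg_scale simp: comp_def
      simp del: ereal_infty_less ereal_less_PInfty)

section \<open>The commutator seminorm on finitely supported elements\<close>

lemma sadom_sa: "sadom \<subseteq> sa_part G alg"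
  by (auto simp: sadom_def sa_part_def lop_alg)

text \<open>The length vanishes at 0, so the weight kills \<open>delta 0\<close> and one term of the
  commutator survives: it displays the coefficients of \<open>f\<close>, each multiplied by the
  length.\<close>

lemma comm_delta_zero: "\<lbrakk>f \<in> fs; x \<in> G\<rbrakk> \<Longrightarrow> comm \<l> f (delta 0) x = of_real (\<l> x) * f x"
proof -
  assume f: "f \<in> fs" and x: "x \<in> G"
  have "(\<lambda>y. complex_of_real (\<l> y) * delta 0 y) = (\<lambda>_. 0)" by (auto simp: delta_def len_zero)
  then show ?thesis by (simp add: comm_def tconv_delta_right[OF x f])
qed

lemma coefficient_bound:
  assumes f: "f \<in> fs" and C: "\<And>\<xi>. \<xi> \<in> fs \<Longrightarrow> l2norm G (comm \<l> f \<xi>) \<le> C * l2norm G \<xi>" and x: "x \<in> G"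
  shows "\<bar>\<l> x\<bar> * cmod (f x) \<le> C"
  using cmod_le_l2norm[OF fs_l2[OF comm_fs[OF f fs_delta[OF G0], of \<l>]], of x]
    C[OF fs_delta[OF G0]] delta_l2(2)[OF G0]
  by (simp add: comm_delta_zero[OF f x] norm_mult)

lemma lop_comm:
  assumes "g \<in> fs"
  shows "(\<lambda>\<gamma>. complex_of_real (\<l> \<gamma>) * lop f g \<gamma> - lop f (\<lambda>\<gamma>. complex_of_real (\<l> \<gamma>) * g \<gamma>) \<gamma>) = comm \<l> f g"
  by (simp add: comm_def lop_apply fs_l2 fs_mult assms)

lemma comm_scale_right: "comm w f (\<lambda>x. c * \<xi> x) = (\<lambda>\<gamma>. c * comm w f \<xi> \<gamma>)"
proof -
  have "(\<lambda>x. complex_of_real (w x) * (c * \<xi> x)) = (\<lambda>x. c * (complex_of_real (w x) * \<xi> x))"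
    by (simp add: algebra_simps)
  then show ?thesis by (simp add: comm_def tconv_scale_right algebra_simps)
qed

lemma Lip_le_iff:
  assumes f: "f \<in> fs" and C: "0 \<le> C"
  shows "Lip (lop f) \<le> ereal C \<longleftrightarrow> (\<forall>\<xi>\<in>fs. l2norm G (comm \<l> f \<xi>) \<le> C * l2norm G \<xi>)"
proof -
  have "Lip (lop f) = (SUP g\<in>{g\<in>fs. l2norm G g \<le> 1}. ereal (l2norm G (comm \<l> f g)))"
    unfolding Lip_def by (rule SUP_cong) (simp_all add: lop_comm)
  then have 1: "Lip (lop f) \<le> ereal C \<longleftrightarrow> (\<forall>g\<in>fs. l2norm G g \<le> 1 \<longrightarrow> l2norm G (comm \<l> f g) \<le> C)"
    by (auto simp: SUP_le_iff)
  show ?thesis unfolding 1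
  proof (intro iffI ballI impI)
    fix g assume *: "\<forall>g\<in>fs. l2norm G g \<le> 1 \<longrightarrow> l2norm G (comm \<l> f g) \<le> C" and g: "g \<in> fs"
    show "l2norm G (comm \<l> f g) \<le> C * l2norm G g"
    proof (cases "l2norm G g = 0")
      case True
      then have "g = (\<lambda>_. 0)" using l2norm_zero_iff[OF fs_l2[OF g]] by auto
      then show ?thesis by (simp add: comm_def)
    next
      case False
      define c where "c = complex_of_real (1 / l2norm G g)"
      have c: "cmod c = 1 / l2norm G g" by (simp add: c_def norm_divide)
      have "l2norm G (comm \<l> f (\<lambda>x. c * g x)) \<le> C"
        using * fs_scale[OF g] False by (auto simp: l2norm_scale c)
      then have "l2norm G (comm \<l> f g) / l2norm G g \<le> C" by (simp add: comm_scale_right l2norm_scale c)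
      then show ?thesis using False
        by (metis l2norm_nonneg order_le_less pos_divide_le_eq)
    qed
  next
    fix g assume *: "\<forall>\<xi>\<in>fs. l2norm G (comm \<l> f \<xi>) \<le> C * l2norm G \<xi>" and g: "g \<in> fs" "l2norm G g \<le> 1"
    have "l2norm G (comm \<l> f g) \<le> C * l2norm G g" using * g by blast
    also have "\<dots> \<le> C" using g C by (simp add: mult_left_le)
    finally show "l2norm G (comm \<l> f g) \<le> C" .
  qed
qed

lemma Lip_nonneg: "0 \<le> Lip a"
proof -
  have "ereal 0 \<le> Lip a" unfolding Lip_def
    by (rule SUP_upper2[of "\<lambda>_. 0"]) (auto simp: fs_zero)
  then show ?thesis by (simp add: zero_ereal_def)
qed

text \<open>Translation by \<open>x\<close> changes the length by at most \<open>\<l> x\<close>, so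
  each summand of the commutator is bounded even where the weight is not.\<close>

lemma comm_bounded:
  assumes f: "f \<in> fs" and \<xi>: "\<xi> \<in> fs"
  shows "l2norm G (comm \<l> f \<xi>) \<le> (\<Sum>x\<in>supp f. \<l> x * cmod (f x)) * l2norm G \<xi>"
proof -
  let ?t = "\<lambda>x \<gamma>. if \<gamma> \<in> G then of_real (\<l> \<gamma> - \<l> (\<gamma> - x)) * (\<sigma> x (\<gamma> - x) * f x * \<xi> (\<gamma> - x)) else 0"
  have e: "comm \<l> f \<xi> = (\<lambda>\<gamma>. \<Sum>x\<in>supp f. ?t x \<gamma>)"
  proof
    fix \<gamma> show "comm \<l> f \<xi> \<gamma> = (\<Sum>x\<in>supp f. ?t x \<gamma>)"
      by (cases "\<gamma> \<in> G") (simp_all add: comm_eq comm_outside)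
  qed
  have t: "?t x \<in> l2 G" "l2norm G (?t x) \<le> (\<l> x * cmod (f x)) * l2norm G \<xi>" if "f x \<noteq> 0" for x
  proof -
    have x: "x \<in> G" using fs_G f that by blast
    have b: "cmod (?t x \<gamma>) \<le> (\<l> x * cmod (f x)) * cmod (if \<gamma> \<in> G then \<xi> (\<gamma> - x) else 0)" for \<gamma>
    proof (cases "\<gamma> \<in> G")
      case True
      have "\<bar>\<l> \<gamma> - \<l> (\<gamma> - x)\<bar> \<le> \<l> x" using len_diff[OF True G_diff[OF True x]] by simp
      then have "\<bar>\<l> \<gamma> - \<l> (\<gamma> - x)\<bar> * (cmod (f x) * cmod (\<xi> (\<gamma> - x))) \<le> \<l> x * (cmod (f x) * cmod (\<xi> (\<gamma> - x)))"
        by (intro mult_right_mono) auto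
      then show ?thesis using True x by (simp add: norm_mult sig_norm G_diff mult.assoc flip: of_real_diff)
    qed simp
    have "0 \<le> \<l> x" using len_diff[OF x G0] len_zero by simp
    then show "?t x \<in> l2 G" "l2norm G (?t x) \<le> (\<l> x * cmod (f x)) * l2norm G \<xi>"
      using l2_mono[OF l2_translate(1)[OF x fs_l2[OF \<xi>]] b] l2_translate(2)[OF x fs_l2[OF \<xi>]]
      by auto
  qed
  have "l2norm G (\<lambda>\<gamma>. \<Sum>x\<in>supp f. ?t x \<gamma>) \<le> (\<Sum>x\<in>supp f. l2norm G (?t x))"
    by (rule conjunct2[OF l2_sum]) (use t fs_finite[OF f] in auto)
  then show ?thesis
    unfolding e sum_distrib_right
    by (rule order_trans) (auto intro!: sum_mono t)
qed

lemma Lip_finite: assumes f: "f \<in> fs" shows "Lip (lop f) < \<infinity>"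
proof -
  let ?C = "\<Sum>x\<in>supp f. \<l> x * cmod (f x)"
  have "0 \<le> \<l> x" if "x \<in> G" for x using len_diff[OF that G0] len_zero by simp
  then have "0 \<le> ?C" using fs_G[OF f] by (auto intro!: sum_nonneg mult_nonneg_nonneg)
  then have "Lip (lop f) \<le> ereal ?C" using Lip_le_iff[OF f] comm_bounded[OF f] by blast
  then show ?thesis by (rule le_less_trans) simp
qed

definition lipr :: "('a \<Rightarrow> complex) \<Rightarrow> real" where
  "lipr f = real_of_ereal (Lip (lop f))"

lemma Lip_lipr: "f \<in> fs \<Longrightarrow> Lip (lop f) = ereal (lipr f)"
  unfolding lipr_def using Lip_finite[of f] Lip_nonneg[of "lop f"]
  by (intro ereal_real'[symmetric]) auto

lemma lipr_nonneg: "0 \<le> lipr f"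
  unfolding lipr_def by (simp add: Lip_nonneg real_of_ereal_pos)

lemma lipr_bound: "f \<in> fs \<Longrightarrow> \<xi> \<in> fs \<Longrightarrow> l2norm G (comm \<l> f \<xi>) \<le> lipr f * l2norm G \<xi>"
  using Lip_le_iff[of f "lipr f"] Lip_lipr[of f] lipr_nonneg[of f] by simp

lemma comm_add: "f \<in> fs \<Longrightarrow> g \<in> fs \<Longrightarrow> comm w (\<lambda>x. f x + g x) \<xi> = (\<lambda>\<gamma>. comm w f \<xi> \<gamma> + comm w g \<xi> \<gamma>)"
  by (simp add: comm_def tconv_add_left algebra_simps)

lemma comm_scale: "comm w (\<lambda>x. c * f x) \<xi> = (\<lambda>\<gamma>. c * comm w f \<xi> \<gamma>)"
  by (simp add: comm_def tconv_scale_left algebra_simps)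

lemma Lip_add:
  assumes f: "f \<in> fs" and g: "g \<in> fs"
  shows "Lip (lop (\<lambda>x. f x + g x)) \<le> Lip (lop f) + Lip (lop g)"
proof -
  have "l2norm G (comm \<l> (\<lambda>x. f x + g x) \<xi>) \<le> (lipr f + lipr g) * l2norm G \<xi>" if \<xi>: "\<xi> \<in> fs" for \<xi>
    unfolding comm_add[OF f g]
    using l2_add(2)[OF fs_l2[OF comm_fs[OF f \<xi>]] fs_l2[OF comm_fs[OF g \<xi>]], of \<l> \<l>]
      lipr_bound[OF f \<xi>] lipr_bound[OF g \<xi>] by (simp add: algebra_simps)
  then have "Lip (lop (\<lambda>x. f x + g x)) \<le> ereal (lipr f + lipr g)"
    using Lip_le_iff[OF fs_add[OF f g]] lipr_nonneg by (simp add: add_nonneg_nonneg)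
  then show ?thesis by (simp add: Lip_lipr f g)
qed

lemma Lip_scale_le:
  assumes f: "f \<in> fs" shows "lipr (\<lambda>x. c * f x) \<le> cmod c * lipr f"
proof -
  have "l2norm G (comm \<l> (\<lambda>x. c * f x) \<xi>) \<le> (cmod c * lipr f) * l2norm G \<xi>" if \<xi>: "\<xi> \<in> fs" for \<xi>
    unfolding comm_scale l2norm_scale mult.assoc
    by (rule mult_left_mono[OF lipr_bound[OF f \<xi>]]) simp
  then have "Lip (lop (\<lambda>x. c * f x)) \<le> ereal (cmod c * lipr f)"
    using Lip_le_iff[OF fs_scale[OF f]] lipr_nonneg by simp
  then show ?thesis by (simp add: Lip_lipr fs_scale f)
qed

text \<open>Combines \<open>Lip_scale_le\<close> for \<open>c\<close> with the same inequality for
  its inverse.\<close>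

lemma lipr_scale:
  assumes f: "f \<in> fs" shows "lipr (\<lambda>x. c * f x) = cmod c * lipr f"
proof (cases "c = 0")
  case True
  then show ?thesis using Lip_scale_le[OF f, of 0] lipr_nonneg[of "\<lambda>x. 0 * f x"] by simp
next
  case False
  have "lipr f \<le> cmod (inverse c) * lipr (\<lambda>x. c * f x)"
    using Lip_scale_le[OF fs_scale[OF f, of c], of "inverse c"] False by (simp flip: mult.assoc)
  then have "cmod c * lipr f \<le> lipr (\<lambda>x. c * f x)"
    using False by (simp add: norm_divide field_simps)
  with Lip_scale_le[OF f, of c] show ?thesis by simp
qed

text \<open>A commutator is a derivation; this is the source of the Leibniz inequality.\<close>

lemma comm_tconv:
  assumes f: "f \<in> fs" and g: "g \<in> fs" and \<xi>: "\<xi> \<in> fs"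
  shows "comm w (tconv f g) \<xi> = (\<lambda>\<gamma>. comm w f (tconv g \<xi>) \<gamma> + tconv f (comm w g \<xi>) \<gamma>)"
proof -
  have d: "tconv f (\<lambda>x. a x - b x) = (\<lambda>\<gamma>. tconv f a \<gamma> - tconv f b \<gamma>)" for a b
    using tconv_add_right[of f a "\<lambda>x. -1 * b x"] tconv_scale_right[of f "-1" b] by simp
  show ?thesis unfolding comm_def d by (simp add: tconv_assoc[OF f g])
qed

lemma lipr_tconv:
  assumes f: "f \<in> fs" and g: "g \<in> fs" and B: "0 \<le> A" "bnd G (lop f) A" "0 \<le> B" "bnd G (lop g) B"
  shows "lipr (tconv f g) \<le> lipr f * B + A * lipr g"
proof -
  have "l2norm G (comm \<l> (tconv f g) \<xi>) \<le> (lipr f * B + A * lipr g) * l2norm G \<xi>" if \<xi>: "\<xi> \<in> fs" for \<xi>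
  proof -
    have g\<xi>: "tconv g \<xi> \<in> fs" by (rule tconv_fs[OF g \<xi>])
    have "l2norm G (comm \<l> (tconv f g) \<xi>) \<le> l2norm G (comm \<l> f (tconv g \<xi>)) + l2norm G (tconv f (comm \<l> g \<xi>))"
      unfolding comm_tconv[OF f g \<xi>]
      by (intro l2_add fs_l2 comm_fs tconv_fs f g \<xi>)
    also have "\<dots> \<le> lipr f * l2norm G (tconv g \<xi>) + A * l2norm G (comm \<l> g \<xi>)"
      using bndD[OF B(2) fs_l2[OF comm_fs[OF g \<xi>]]]
      by (intro add_mono lipr_bound f g\<xi>) (simp add: lop_apply fs_l2 comm_fs g \<xi>)
    also have "\<dots> \<le> lipr f * (B * l2norm G \<xi>) + A * (lipr g * l2norm G \<xi>)"
      using bndD[OF B(4) fs_l2[OF \<xi>]] lipr_nonneg B(1)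
      by (intro add_mono mult_left_mono lipr_bound g \<xi>) (simp_all add: lop_apply fs_l2 \<xi>)
    finally show ?thesis by (simp add: algebra_simps)
  qed
  then have "Lip (lop (tconv f g)) \<le> ereal (lipr f * B + A * lipr g)"
    using Lip_le_iff[OF tconv_fs[OF f g]] lipr_nonneg B by (simp add: add_nonneg_nonneg)
  then show ?thesis by (simp add: Lip_lipr tconv_fs f g)
qed

end

section \<open>States and the Monge-Kantorovich metric\<close>

lemma states_add: "\<lbrakk>\<phi> \<in> states G A; a \<in> A; b \<in> A\<rbrakk> \<Longrightarrow> \<phi> (op_add a b) = \<phi> a + \<phi> b"
  and states_scale: "\<lbrakk>\<phi> \<in> states G A; a \<in> A\<rbrakk> \<Longrightarrow> \<phi> (op_scale c a) = c * \<phi> a"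
  and states_pos: "\<lbrakk>\<phi> \<in> states G A; a \<in> A; positive_op G a\<rbrakk> \<Longrightarrow> \<phi> a \<in> \<real> \<and> 0 \<le> Re (\<phi> a)"
  and states_one: "\<phi> \<in> states G A \<Longrightarrow> \<phi> (op_one G) = 1"
  by (simp_all add: states_def)

lemma cstar_subalg_closed:
  assumes "unital_cstar_subalg G A"
  shows "op_one G \<in> A" "T \<in> A \<Longrightarrow> is_op G T" "T \<in> A \<Longrightarrow> op_scale c T \<in> A"
    "\<lbrakk>T \<in> A; S \<in> A\<rbrakk> \<Longrightarrow> op_add T S \<in> A" "T \<in> A \<Longrightarrow> \<exists>S\<in>A. adj G T S"
proof -
  note c = assms[unfolded unital_cstar_subalg_def]
  show "op_one G \<in> A" using c by (elim conjE)
  show "T \<in> A \<Longrightarrow> is_op G T" using conjunct1[OF c] by blast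
  show "T \<in> A \<Longrightarrow> op_scale c T \<in> A" using c[THEN conjunct2, THEN conjunct2, THEN conjunct2, THEN conjunct1] by blast
  show "\<lbrakk>T \<in> A; S \<in> A\<rbrakk> \<Longrightarrow> op_add T S \<in> A" using c[THEN conjunct2, THEN conjunct2, THEN conjunct1] by blast
  show "T \<in> A \<Longrightarrow> \<exists>S\<in>A. adj G T S" using c unfolding adj_def by (elim conjE) (erule bspec)
qed

lemma self_adj_inner_real:
  assumes "self_adj G x" "g \<in> l2 G" shows "l2inner G (x g) g \<in> \<real>"
proof -
  have "l2inner G (x g) g = cnj (l2inner G (x g) g)"
    using assms by (metis l2inner_commute self_adj_def)
  then show ?thesis by (metis Reals_cnj_iff)
qed

lemma positive_shift:
  assumes x: "is_op G x" "self_adj G x" "bnd G x B" and c: "c = 1 \<or> c = -1"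
  shows "positive_op G (op_add (op_scale (of_real B) (op_one G)) (op_scale (of_real c) x))"
  unfolding positive_op_def
proof
  fix g assume g: "g \<in> l2 G"
  have xg: "x g \<in> l2 G" by (rule is_op_l2[OF x(1) g])
  obtain r where r: "l2inner G (x g) g = of_real r" using self_adj_inner_real[OF x(2) g] by (auto elim: Reals_cases)
  have e: "l2inner G (op_add (op_scale (of_real B) (op_one G)) (op_scale (of_real c) x) g) g
     = of_real (B * (l2norm G g)\<^sup>2 + c * r)"
    using g by (simp add: op_add_def op_scale_def op_one_def l2inner_add_left[OF l2_scale[OF g] l2_scale[OF xg] g]
       l2inner_scale_left r l2inner_self)
  have "\<bar>r\<bar> \<le> l2norm G (x g) * l2norm G g"
    using l2inner_cauchy_schwarz[OF xg g] by (simp add: r)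
  also have "\<dots> \<le> (B * l2norm G g) * l2norm G g"
    by (rule mult_right_mono[OF bndD[OF x(3) g]]) simp
  finally have "\<bar>r\<bar> \<le> B * (l2norm G g)\<^sup>2" by (simp add: power2_eq_square)
  then have "0 \<le> B * (l2norm G g)\<^sup>2 + c * r" using c by auto
  then show "l2inner G (op_add (op_scale (of_real B) (op_one G)) (op_scale (of_real c) x) g) g \<in> \<real> \<and>
     0 \<le> Re (l2inner G (op_add (op_scale (of_real B) (op_one G)) (op_scale (of_real c) x) g) g)"
    unfolding e by simp
qed

text \<open>States are given by linearity, positivity and normalisation, with no continuity in the
  definition. Evaluating on the positive operators \<open>B + x\<close> and \<open>B - x\<close>
  shows that the value at \<open>x\<close> is real and lies between \<open>- B\<close> and
  \<open>B\<close>.\<close>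

lemma state_self_adj_bound:
  assumes A: "unital_cstar_subalg G A" and \<phi>: "\<phi> \<in> states G A"
    and x: "x \<in> A" "self_adj G x" "bnd G x B"
  shows "cmod (\<phi> x) \<le> B"
proof -
  have op: "is_op G x" and one: "op_one G \<in> A"
    and cl: "\<And>a c. a \<in> A \<Longrightarrow> op_scale c a \<in> A" "\<And>a b. \<lbrakk>a \<in> A; b \<in> A\<rbrakk> \<Longrightarrow> op_add a b \<in> A"
    using cstar_subalg_closed[OF A] x(1) by blast+
  have *: "of_real B + of_real c * \<phi> x \<in> \<real> \<and> 0 \<le> Re (of_real B + of_real c * \<phi> x)"
    if c: "c = 1 \<or> c = -1" for c
    using states_pos[OF \<phi> _ positive_shift[OF op x(2,3) c]]
    by (simp add: cl one x(1) states_add[OF \<phi>] states_scale[OF \<phi>] states_one[OF \<phi>])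
  have "Im (\<phi> x) = 0" using *[of 1] by (simp add: complex_is_Real_iff)
  moreover have "\<bar>Re (\<phi> x)\<bar> \<le> B" using *[of 1] *[of "-1"] by (simp add: abs_le_iff)
  ultimately show ?thesis by (simp add: cmod_eq_Re)
qed

text \<open>The factor 2 comes from bounding the real and the imaginary part of \<open>a\<close>
  separately by \<open>B\<close>.\<close>

lemma state_bound:
  assumes A: "unital_cstar_subalg G A" and \<phi>: "\<phi> \<in> states G A" and a: "a \<in> A" "bnd G a B" "0 \<le> B"
  shows "cmod (\<phi> a) \<le> 2 * B"
proof -
  have ops: "\<And>a. a \<in> A \<Longrightarrow> is_op G a"
    and cl: "\<And>a c. a \<in> A \<Longrightarrow> op_scale c a \<in> A" "\<And>a b. \<lbrakk>a \<in> A; b \<in> A\<rbrakk> \<Longrightarrow> op_add a b \<in> A"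
    using cstar_subalg_closed[OF A] by blast+
  obtain s where s: "s \<in> A" "adj G a s" using cstar_subalg_closed(5)[OF A a(1)] by blast
  note op = ops[OF a(1)] ops[OF s(1)]
  have sb: "bnd G s B" by (rule adj_bnd[OF op s(2) a(2,3)])
  define x where "x = op_scale (1/2) (op_add a s)"
  define y where "y = op_scale (-\<i>/2) (op_add a (op_scale (-1) s))"
  have mem: "x \<in> A" "y \<in> A" "op_scale \<i> y \<in> A" using a(1) s(1) by (auto simp: x_def y_def cl)
  note parts = self_adj_parts[OF op s(2), folded x_def y_def]
  have "bnd G x (cmod (1/2) * (B + B))"
    unfolding x_def by (intro bnd_op_scale bnd_op_add op a sb)
  then have xb: "bnd G x B" by simp
  have "bnd G y (cmod (-\<i>/2) * (B + cmod (-1) * B))"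
    unfolding y_def by (intro bnd_op_scale bnd_op_add is_op_op_scale op a sb)
  then have yb: "bnd G y B" by simp
  have "\<phi> a = \<phi> x + \<i> * \<phi> y" by (metis parts(3) states_add[OF \<phi>] states_scale[OF \<phi>] mem)
  then have "cmod (\<phi> a) \<le> cmod (\<phi> x) + cmod (\<phi> y)" by (metis norm_triangle_ineq norm_mult norm_ii mult_1)
  then show ?thesis
    using state_self_adj_bound[OF A \<phi> mem(1) parts(1) xb] state_self_adj_bound[OF A \<phi> mem(2) parts(2) yb] by linarith
qed

context twisted_length
begin

lemmas alg_state_bound = state_bound[OF alg_unital_cstar_subalg]

lemma state_minus: "\<lbrakk>\<phi> \<in> states G alg; a \<in> alg; b \<in> alg\<rbrakk> \<Longrightarrow> \<phi> (op_minus a b) = \<phi> a - \<phi> b"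
  unfolding op_minus_def by (simp add: states_add states_scale alg_scale)

lemma alg_minus: "\<lbrakk>a \<in> alg; b \<in> alg\<rbrakk> \<Longrightarrow> op_minus a b \<in> alg"
  unfolding op_minus_def by (intro alg_add alg_scale)

lemma state_lop_sum:
  assumes \<phi>: "\<phi> \<in> states G alg" and "finite S" "S \<subseteq> G"
  shows "\<phi> (lop (restr S f)) = (\<Sum>x\<in>S. f x * \<phi> (lop (delta x)))"
  using assms(2,3)
proof (induction S)
  case empty
  have "lop (restr {} f) = op_scale 0 (op_one G)"
    by (simp add: lop_def restr_def op_scale_def tconv_def fun_eq_iff)
  then show ?case by (simp add: states_scale[OF \<phi> alg_one])
next
  case (insert y S)
  have e: "restr (insert y S) f = (\<lambda>x. restr S f x + f y * delta y x)"
    using insert.hyps by (auto simp: restr_def delta_def)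
  have S: "restr S f \<in> fs" by (rule fsI[of S]) (use insert in \<open>auto simp: restr_def\<close>)
  have y: "delta y \<in> fs" using insert by (simp add: fs_delta)
  have l: "lop (restr (insert y S) f) = op_add (lop (restr S f)) (op_scale (f y) (lop (delta y)))"
    by (simp add: e lop_add[OF S fs_scale[OF y]] lop_scale)
  show ?case unfolding l
    using insert by (simp add: states_add[OF \<phi> lop_alg[OF S] alg_scale[OF lop_alg[OF y]]]
      states_scale[OF \<phi> lop_alg[OF y]])
qed

text \<open>The remainder outside \<open>S\<close> costs \<open>2 * e\<close> for each state. On
  \<open>S\<close> the coefficients are at most \<open>1 / \<l> x\<close>, and the one at 0 drops
  out because both states take the value 1 at the identity.\<close>

lemma state_diff_bound:
  assumes S: "finite S" "S \<subseteq> G" and f: "f \<in> fs" and lf: "lipr f \<le> 1"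
    and e: "0 \<le> e" "bnd G (lop (restr (- S) f)) e"
    and \<phi>: "\<phi> \<in> states G alg" and \<psi>: "\<psi> \<in> states G alg"
  shows "cmod (\<phi> (lop f) - \<psi> (lop f)) \<le>
    4 * e + (\<Sum>x\<in>S - {0}. cmod (\<phi> (lop (delta x)) - \<psi> (lop (delta x))) / \<l> x)"
proof -
  let ?t = "restr (- S) f" and ?r = "restr S f"
  have r: "?r \<in> fs" and t: "?t \<in> fs" using fs_restr[OF f] by auto
  have l: "lop f = op_add (lop ?t) (lop ?r)"
    unfolding lop_add[OF t r] by (rule arg_cong[of _ _ lop]) (simp add: restr_def fun_eq_iff)
  have ev: "\<omega> (lop f) = \<omega> (lop ?t) + (\<Sum>x\<in>S. f x * \<omega> (lop (delta x)))" if \<omega>: "\<omega> \<in> states G alg" for \<omega>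
    unfolding l states_add[OF \<omega> lop_alg[OF t] lop_alg[OF r]] state_lop_sum[OF \<omega> S] ..
  have "\<phi> (lop f) - \<psi> (lop f) = (\<phi> (lop ?t) - \<psi> (lop ?t))
     + (\<Sum>x\<in>S. f x * (\<phi> (lop (delta x)) - \<psi> (lop (delta x))))"
    unfolding ev[OF \<phi>] ev[OF \<psi>] by (simp add: right_diff_distrib sum_subtractf)
  also have "(\<Sum>x\<in>S. f x * (\<phi> (lop (delta x)) - \<psi> (lop (delta x))))
    = (\<Sum>x\<in>S-{0}. f x * (\<phi> (lop (delta x)) - \<psi> (lop (delta x))))"
    using S states_one[OF \<phi>] states_one[OF \<psi>] by (intro sum.mono_neutral_right) (auto simp: lop_one)
  finally have "cmod (\<phi> (lop f) - \<psi> (lop f)) \<le> cmod (\<phi> (lop ?t) - \<psi> (lop ?t))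
     + cmod (\<Sum>x\<in>S-{0}. f x * (\<phi> (lop (delta x)) - \<psi> (lop (delta x))))"
    by (simp add: norm_triangle_ineq)
  moreover have "cmod (\<phi> (lop ?t) - \<psi> (lop ?t)) \<le> 4 * e"
    using alg_state_bound[OF \<phi> lop_alg[OF t] e(2,1)] alg_state_bound[OF \<psi> lop_alg[OF t] e(2,1)]
      norm_triangle_ineq4[of "\<phi> (lop ?t)" "\<psi> (lop ?t)"] by linarith
  moreover have "cmod (\<Sum>x\<in>S-{0}. f x * (\<phi> (lop (delta x)) - \<psi> (lop (delta x))))
    \<le> (\<Sum>x\<in>S - {0}. cmod (\<phi> (lop (delta x)) - \<psi> (lop (delta x))) / \<l> x)"
  proof (rule sum_norm_le)
    fix x assume x: "x \<in> S - {0}"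
    then have p: "0 < \<l> x" using S len_pos by auto
    have "\<bar>\<l> x\<bar> * cmod (f x) \<le> lipr f" by (rule coefficient_bound[OF f lipr_bound[OF f]]) (use x S in auto)
    then have "cmod (f x) \<le> 1 / \<l> x" using p lf by (simp add: field_simps)
    then have "cmod (f x) * cmod (\<phi> (lop (delta x)) - \<psi> (lop (delta x)))
      \<le> (1 / \<l> x) * cmod (\<phi> (lop (delta x)) - \<psi> (lop (delta x)))"
      by (rule mult_right_mono) simp
    then show "cmod (f x * (\<phi> (lop (delta x)) - \<psi> (lop (delta x))))
      \<le> cmod (\<phi> (lop (delta x)) - \<psi> (lop (delta x))) / \<l> x"
      by (simp add: norm_mult)
  qed
  ultimately show ?thesis by linarith
qed

text \<open>Up to \<open>e\<close>, the Lipschitz ball is carried by one finite set. Such an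
  \<open>S\<close> must contain 0, since every multiple of \<open>delta 0\<close> has seminorm 0;
  this is how the scalars are divided out without forming a quotient.\<close>

definition uniform_tails :: bool where
  "uniform_tails \<longleftrightarrow> (\<forall>e>0. \<exists>S. finite S \<and> S \<subseteq> G \<and>
     (\<forall>f\<in>fs. lipr f \<le> 1 \<longrightarrow> bnd G (lop (restr (- S) f)) e))"

definition mkd :: "('a op \<Rightarrow> complex) \<Rightarrow> ('a op \<Rightarrow> complex) \<Rightarrow> real" where
  "mkd \<phi> \<psi> = real_of_ereal (mk \<phi> \<psi> sadom Lip)"

lemma mk_le_iff: "mk \<phi> \<psi> sadom Lip \<le> ereal M \<longleftrightarrow>
   (\<forall>f\<in>fs. self_adj G (lop f) \<longrightarrow> lipr f \<le> 1 \<longrightarrow> cmod (\<phi> (lop f) - \<psi> (lop f)) \<le> M)"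
  unfolding mk_def SUP_le_iff sadom_def by (auto simp: Lip_lipr one_ereal_def)

lemma mk_finite:
  assumes u: "uniform_tails" and \<phi>: "\<phi> \<in> states G alg" and \<psi>: "\<psi> \<in> states G alg"
  shows "mk \<phi> \<psi> sadom Lip < \<infinity>"
proof -
  obtain S where S: "finite S" "S \<subseteq> G" "\<And>f. f \<in> fs \<Longrightarrow> lipr f \<le> 1 \<Longrightarrow> bnd G (lop (restr (- S) f)) 1"
    using u unfolding uniform_tails_def by (metis zero_less_one)
  have "mk \<phi> \<psi> sadom Lip \<le> ereal (4 * 1 + (\<Sum>x\<in>S - {0}. cmod (\<phi> (lop (delta x)) - \<psi> (lop (delta x))) / \<l> x))"
    unfolding mk_le_iff using state_diff_bound[OF S(1,2) _ _ _ S(3) \<phi> \<psi>] by simp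
  then show ?thesis by (rule le_less_trans) simp
qed

lemma lop_zero: "lop (\<lambda>_. 0) = op_scale 0 (op_one G)"
  by (simp add: lop_def op_scale_def tconv_def fun_eq_iff)

lemma self_adj_zero: "self_adj G (lop (\<lambda>_. 0))"
  by (simp add: self_adj_def lop_zero op_scale_def l2inner_def)

lemma lipr_zero: "lipr (\<lambda>_. 0) = 0"
  using lipr_scale[OF fs_zero, of 0] by simp

lemma mk_nonneg: "0 \<le> mk \<phi> \<psi> sadom Lip"
  unfolding mk_def
proof (rule SUP_upper2)
  show "lop (\<lambda>_. 0) \<in> {a \<in> sadom. Lip a \<le> 1}"
    using fs_zero self_adj_zero by (auto simp: sadom_def Lip_lipr lipr_zero)
qed simp

lemma mkd_nonneg: "0 \<le> mkd \<phi> \<psi>"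
  unfolding mkd_def by (simp add: mk_nonneg real_of_ereal_pos)

lemma mkd_le_iff:
  assumes "uniform_tails" "\<phi> \<in> states G alg" "\<psi> \<in> states G alg"
  shows "mkd \<phi> \<psi> \<le> M \<longleftrightarrow>
   (\<forall>f\<in>fs. self_adj G (lop f) \<longrightarrow> lipr f \<le> 1 \<longrightarrow> cmod (\<phi> (lop f) - \<psi> (lop f)) \<le> M)"
proof -
  have "mk \<phi> \<psi> sadom Lip = ereal (mkd \<phi> \<psi>)"
    unfolding mkd_def using mk_finite[OF assms] mk_nonneg[of \<phi> \<psi>]
    by (intro ereal_real'[symmetric]) auto
  then show ?thesis using mk_le_iff[of \<phi> \<psi> M] by simp
qed

text \<open>Scale \<open>f\<close> into the unit ball. The divisor \<open>lipr f + 1\<close> is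
  positive even if the seminorm of \<open>f\<close> is 0, and a real scalar preserves
  self-adjointness.\<close>

lemma mkd_lop_bound:
  assumes u: "uniform_tails" and \<phi>: "\<phi> \<in> states G alg" and \<psi>: "\<psi> \<in> states G alg"
    and f: "f \<in> fs" "self_adj G (lop f)"
  shows "cmod (\<phi> (lop f) - \<psi> (lop f)) \<le> (lipr f + 1) * mkd \<phi> \<psi>"
proof -
  let ?c = "complex_of_real (1 / (lipr f + 1))"
  have p: "0 < lipr f + 1" using lipr_nonneg[of f] by linarith
  have cf: "(\<lambda>x. ?c * f x) \<in> fs" by (rule fs_scale[OF f(1)])
  have "adj G (op_scale ?c (lop f)) (op_scale (cnj ?c) (lop f))"
    by (rule adj_op_scale) (use f(2) in \<open>simp add: self_adj_iff\<close>)
  then have sa: "self_adj G (lop (\<lambda>x. ?c * f x))" by (simp add: self_adj_iff lop_scale)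
  have "lipr (\<lambda>x. ?c * f x) \<le> 1"
    unfolding lipr_scale[OF f(1)] using p by (simp add: norm_divide divide_simps)
  then have "cmod (\<phi> (lop (\<lambda>x. ?c * f x)) - \<psi> (lop (\<lambda>x. ?c * f x))) \<le> mkd \<phi> \<psi>"
    using mkd_le_iff[OF u \<phi> \<psi>, of "mkd \<phi> \<psi>"] cf sa by simp
  then have "cmod (?c * (\<phi> (lop f) - \<psi> (lop f))) \<le> mkd \<phi> \<psi>"
    unfolding lop_scale[symmetric] states_scale[OF \<phi> lop_alg[OF f(1)]]
      states_scale[OF \<psi> lop_alg[OF f(1)]] right_diff_distrib .
  moreover have "cmod ?c = 1 / (lipr f + 1)" unfolding norm_of_real using p by simp
  ultimately show ?thesis using p by (simp only: norm_mult) (simp add: field_simps)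
qed

lemma star_parts:
  assumes f: "f \<in> fs"
  obtains g h where "g \<in> fs" "h \<in> fs" "self_adj G (lop g)" "self_adj G (lop h)"
    "lop f = op_add (lop g) (op_scale \<i> (lop h))"
proof -
  note s = fs_star[OF f]
  let ?g = "\<lambda>x. 1/2 * (f x + star f x)" and ?h = "\<lambda>x. (-\<i>/2) * (f x + (-1) * star f x)"
  have gh: "?g \<in> fs" "?h \<in> fs" by (intro fs_scale fs_add f s)+
  have lg: "lop ?g = op_scale (1/2) (op_add (lop f) (lop (star f)))"
    by (simp only: lop_scale lop_add[OF f s])
  have lh: "lop ?h = op_scale (-\<i>/2) (op_add (lop f) (op_scale (-1) (lop (star f))))"
    by (simp only: lop_scale lop_add[OF f fs_scale[OF s]])
  show thesis
    using that[OF gh] self_adj_parts[OF is_op_lop[OF f] is_op_lop[OF s] adj_lop[OF f], folded lg lh] by simp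
qed

text \<open>The metric tests self-adjoint elements only. A general \<open>f\<close> is reached
  through its real and imaginary parts, each adding its own \<open>lipr\<close> plus 1 to the
  constant \<open>K\<close>.\<close>

lemma state_lop_mkd_bound:
  assumes u: "uniform_tails" and f: "f \<in> fs"
  obtains K where "0 < K" "\<And>\<phi> \<psi>. \<lbrakk>\<phi> \<in> states G alg; \<psi> \<in> states G alg\<rbrakk> \<Longrightarrow>
     cmod (\<phi> (lop f) - \<psi> (lop f)) \<le> K * mkd \<phi> \<psi>"
proof -
  obtain g h where gh: "g \<in> fs" "h \<in> fs" "self_adj G (lop g)" "self_adj G (lop h)"
    "lop f = op_add (lop g) (op_scale \<i> (lop h))" using star_parts[OF f] .
  have "cmod (\<phi> (lop f) - \<psi> (lop f)) \<le> (lipr g + lipr h + 2) * mkd \<phi> \<psi>"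
    if \<phi>: "\<phi> \<in> states G alg" and \<psi>: "\<psi> \<in> states G alg" for \<phi> \<psi>
  proof -
    have ev: "\<omega> (lop f) = \<omega> (lop g) + \<i> * \<omega> (lop h)" if \<omega>: "\<omega> \<in> states G alg" for \<omega>
      unfolding gh(5) by (simp add: states_add[OF \<omega>] states_scale[OF \<omega>] lop_alg gh alg_scale)
    have "\<phi> (lop f) - \<psi> (lop f) = (\<phi> (lop g) - \<psi> (lop g)) + \<i> * (\<phi> (lop h) - \<psi> (lop h))"
      by (simp add: ev \<phi> \<psi> algebra_simps)
    then have "cmod (\<phi> (lop f) - \<psi> (lop f)) \<le> cmod (\<phi> (lop g) - \<psi> (lop g)) + cmod (\<phi> (lop h) - \<psi> (lop h))"
      by (metis norm_triangle_ineq norm_mult norm_ii mult_1)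
    then show ?thesis
      using mkd_lop_bound[OF u \<phi> \<psi> gh(1,3)] mkd_lop_bound[OF u \<phi> \<psi> gh(2,4)]
      by (simp add: algebra_simps)
  qed
  moreover have "0 < lipr g + lipr h + 2" using lipr_nonneg[of g] lipr_nonneg[of h] by linarith
  ultimately show thesis using that by blast
qed

lemma state_continuous:
  assumes u: "uniform_tails" and T: "T \<in> alg" and e: "0 < e"
  obtains r where "0 < r" "\<And>\<phi> \<psi>. \<lbrakk>\<phi> \<in> states G alg; \<psi> \<in> states G alg; mkd \<phi> \<psi> < r\<rbrakk> \<Longrightarrow>
     cmod (\<phi> T - \<psi> T) < e"
proof -
  \<comment> \<open>By the factor 2 in \<open>state_bound\<close>, accuracy \<open>e / 8\<close>
    costs \<open>e / 4\<close> for each of the two states, which leaves \<open>e / 2\<close> for the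
    approximant itself.\<close>
  have e8: "0 < e / 8" using e by simp
  obtain f where f: "f \<in> fs" "bnd G (op_minus T (lop f)) (e / 8)" using algD[OF T e8] .
  obtain K where K: "0 < K" "\<And>\<phi> \<psi>. \<lbrakk>\<phi> \<in> states G alg; \<psi> \<in> states G alg\<rbrakk> \<Longrightarrow>
     cmod (\<phi> (lop f) - \<psi> (lop f)) \<le> K * mkd \<phi> \<psi>" using state_lop_mkd_bound[OF u f(1)] by blast
  have "cmod (\<phi> T - \<psi> T) < e"
    if \<phi>: "\<phi> \<in> states G alg" and \<psi>: "\<psi> \<in> states G alg" and r: "mkd \<phi> \<psi> < e / (2 * K)" for \<phi> \<psi>
  proof -
    have b: "cmod (\<omega> T - \<omega> (lop f)) \<le> e / 4" if \<omega>: "\<omega> \<in> states G alg" for \<omega>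
      using alg_state_bound[OF \<omega> alg_minus[OF T lop_alg[OF f(1)]] f(2)] e
      by (simp add: state_minus[OF \<omega> T lop_alg[OF f(1)]])
    have "\<phi> T - \<psi> T = (\<phi> T - \<phi> (lop f)) + (\<phi> (lop f) - \<psi> (lop f)) - (\<psi> T - \<psi> (lop f))" by simp
    then have "cmod (\<phi> T - \<psi> T) \<le> cmod (\<phi> T - \<phi> (lop f)) + cmod (\<phi> (lop f) - \<psi> (lop f)) + cmod (\<psi> T - \<psi> (lop f))"
      by (smt (verit) norm_triangle_ineq norm_triangle_ineq4)
    moreover have "cmod (\<phi> (lop f) - \<psi> (lop f)) < e / 2"
      using K(2)[OF \<phi> \<psi>] r K(1) by (simp add: field_simps)
    ultimately show ?thesis using b[OF \<phi>] b[OF \<psi>] by linarith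
  qed
  moreover have "0 < e / (2 * K)" using e K(1) by simp
  ultimately show thesis using that by blast
qed

lemma Metric_space_mkd:
  assumes u: "uniform_tails" shows "Metric_space (states G alg) mkd"
proof
  show "0 \<le> mkd \<phi> \<psi>" for \<phi> \<psi> by (rule mkd_nonneg)
  show "mkd \<phi> \<psi> = mkd \<psi> \<phi>" for \<phi> \<psi> by (simp add: mkd_def mk_def norm_minus_commute)
  fix \<phi> \<psi> assume \<phi>: "\<phi> \<in> states G alg" and \<psi>: "\<psi> \<in> states G alg"
  show "mkd \<phi> \<psi> = 0 \<longleftrightarrow> \<phi> = \<psi>"
  proof
    assume z: "mkd \<phi> \<psi> = 0"
    show "\<phi> = \<psi>"
    proof (rule extensionalityI)
      show "\<phi> \<in> extensional alg" "\<psi> \<in> extensional alg" using \<phi> \<psi> by (auto simp: states_def)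
      fix T assume T: "T \<in> alg"
      have "cmod (\<phi> T - \<psi> T) \<le> 0 + e" if e: "0 < e" for e
        using state_continuous[OF u T e] \<phi> \<psi> z by (metis add_0 less_imp_le)
      then show "\<phi> T = \<psi> T" using field_le_epsilon[of "cmod (\<phi> T - \<psi> T)" 0] by simp
    qed
  next
    assume "\<phi> = \<psi>"
    then have "mkd \<phi> \<psi> \<le> 0" using mkd_le_iff[OF u \<phi> \<psi>, of 0] by simp
    with mkd_nonneg[of \<phi> \<psi>] show "mkd \<phi> \<psi> = 0" by simp
  qed
  fix \<omega> assume \<omega>: "\<omega> \<in> states G alg"
  show "mkd \<phi> \<omega> \<le> mkd \<phi> \<psi> + mkd \<psi> \<omega>"
    unfolding mkd_le_iff[OF u \<phi> \<omega>]
  proof (intro ballI impI)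
    fix f assume f: "f \<in> fs" "self_adj G (lop f)" "lipr f \<le> 1"
    have "cmod (\<phi> (lop f) - \<psi> (lop f)) \<le> mkd \<phi> \<psi>" "cmod (\<psi> (lop f) - \<omega> (lop f)) \<le> mkd \<psi> \<omega>"
      using mkd_le_iff[OF u \<phi> \<psi>, of "mkd \<phi> \<psi>"] mkd_le_iff[OF u \<psi> \<omega>, of "mkd \<psi> \<omega>"] f by auto
    then show "cmod (\<phi> (lop f) - \<omega> (lop f)) \<le> mkd \<phi> \<psi> + mkd \<psi> \<omega>"
      using norm_triangle_ineq[of "\<phi> (lop f) - \<psi> (lop f)" "\<psi> (lop f) - \<omega> (lop f)"] by simp
  qed
qed

section \<open>Comparison of the metric topology with the weak* topology\<close>

lemma states_extensional: "states G A \<subseteq> extensional A"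
  by (auto simp: states_def)

lemma topspace_weak_star: "topspace (weak_star G A) = states G A"
  unfolding weak_star_def by (auto simp: states_def PiE_def)

lemma weak_star_eval_open:
  assumes "T \<in> A" "open V" shows "openin (weak_star G A) {\<phi> \<in> states G A. \<phi> T \<in> V}"
proof -
  have "continuous_map (weak_star G A) euclidean (\<lambda>\<phi>. \<phi> T)"
    unfolding weak_star_def
    by (rule continuous_map_from_subtopology[OF continuous_map_product_projection[OF assms(1)]])
  from openin_continuous_map_preimage[OF this, of V] assms(2)
  show ?thesis by (simp add: topspace_weak_star)
qed

lemma mtopology_eq_weak_star:
  assumes u: "uniform_tails"
  shows "Metric_space.mtopology (states G alg) mkd = weak_star G alg"
proof -
  interpret M: Metric_space "states G alg" mkd by (rule Metric_space_mkd[OF u])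
  \<comment> \<open>Weak* open sets are metrically open because every evaluation is continuous for
    the metric; this makes the identity map continuous.\<close>
  have 1: "openin M.mtopology W" if W: "openin (weak_star G alg) W" for W
  proof -
    have "continuous_map M.mtopology (weak_star G alg) id"
      unfolding weak_star_def continuous_map_in_subtopology continuous_map_componentwise
    proof (intro conjI ballI)
      fix T assume T: "T \<in> alg"
      show "continuous_map M.mtopology euclidean (\<lambda>\<phi>. id \<phi> T)"
        unfolding continuous_map_def
      proof (intro conjI allI impI)
        fix V :: "complex set" assume V: "openin euclidean V"
        show "openin M.mtopology {\<phi> \<in> topspace M.mtopology. id \<phi> T \<in> V}"
          unfolding M.openin_mtopology
        proof (intro conjI allI impI)
          fix \<phi> assume "\<phi> \<in> {\<phi> \<in> topspace M.mtopology. id \<phi> T \<in> V}"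
          then have \<phi>: "\<phi> \<in> states G alg" "\<phi> T \<in> V" by auto
          obtain e where e: "0 < e" "ball (\<phi> T) e \<subseteq> V"
            using V \<phi>(2) by (auto simp: open_contains_ball)
          obtain r where r: "0 < r" "\<And>\<phi> \<psi>. \<lbrakk>\<phi> \<in> states G alg; \<psi> \<in> states G alg; mkd \<phi> \<psi> < r\<rbrakk> \<Longrightarrow>
            cmod (\<phi> T - \<psi> T) < e" using state_continuous[OF u T e(1)] by blast
          have "M.mball \<phi> r \<subseteq> {\<phi> \<in> topspace M.mtopology. id \<phi> T \<in> V}"
            using r(2)[OF \<phi>(1)] e(2) by (auto simp: subset_iff dist_norm)
          then show "\<exists>r>0. M.mball \<phi> r \<subseteq> {\<phi> \<in> topspace M.mtopology. id \<phi> T \<in> V}" using r(1) by blast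
        qed auto
      qed simp
    qed (use subsetD[OF states_extensional] in auto)
    from openin_continuous_map_preimage[OF this W]
    have "openin M.mtopology {\<phi> \<in> states G alg. \<phi> \<in> W}" by simp
    moreover have "{\<phi> \<in> states G alg. \<phi> \<in> W} = W"
      using openin_subset[OF W] by (auto simp: topspace_weak_star)
    ultimately show ?thesis by simp
  qed
  have 2: "openin (weak_star G alg) W" if W: "openin M.mtopology W" for W
  proof (subst openin_subopen, intro ballI)
    fix \<phi> assume \<phi>W: "\<phi> \<in> W"
    then have \<phi>: "\<phi> \<in> states G alg" using openin_subset[OF W] by auto
    obtain r where r: "0 < r" "M.mball \<phi> r \<subseteq> W" using W \<phi>W unfolding M.openin_mtopology by blast
    \<comment> \<open>\<open>state_diff_bound\<close> multiplies the tail bound by 4, so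
      \<open>r / 16\<close> yields \<open>r / 4\<close>. The finite sum is granted another
      \<open>r / 4\<close>, and the total \<open>r / 2\<close> stays strictly below
      \<open>r\<close>.\<close>
    have r16: "0 < r / 16" using r(1) by simp
    obtain S where S: "finite S" "S \<subseteq> G"
      "\<And>f. f \<in> fs \<Longrightarrow> lipr f \<le> 1 \<Longrightarrow> bnd G (lop (restr (- S) f)) (r / 16)"
      using u r16 unfolding uniform_tails_def by metis
    define m where "m = (\<Sum>x\<in>S-{0}. 1 / \<l> x)"
    have lp: "0 < \<l> x" if "x \<in> S - {0}" for x using that S(2) len_pos by auto
    have m: "0 \<le> m" unfolding m_def using lp by (intro sum_nonneg) (simp add: less_imp_le)
    define d where "d = r / 4 / (m + 1)"
    have d: "0 < d" using r(1) m by (simp add: d_def)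
    let ?V = "\<lambda>x. {\<psi> \<in> states G alg. \<psi> (lop (delta x)) \<in> ball (\<phi> (lop (delta x))) d}"
    \<comment> \<open>Inserting the whole state space keeps the intersection nonempty as a family,
      and inside the states, when \<open>S - {0}\<close> is empty.\<close>
    let ?N = "\<Inter> (insert (states G alg) (?V ` (S - {0})))"
    have "openin (weak_star G alg) ?N"
    proof (rule openin_Inter)
      fix X assume "X \<in> insert (states G alg) (?V ` (S - {0}))"
      then show "openin (weak_star G alg) X"
      proof
        assume "X = states G alg"
        then show ?thesis using openin_topspace[of "weak_star G alg"] by (simp add: topspace_weak_star)
      next
        assume "X \<in> ?V ` (S - {0})"
        then obtain x where "x \<in> S" "X = ?V x" by blast
        then show ?thesis using weak_star_eval_open[OF lop_alg[OF fs_delta[of x]] open_ball] S(2) by auto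
      qed
    qed (use S(1) in auto)
    moreover have "\<phi> \<in> ?N" using \<phi> d by auto
    moreover have "?N \<subseteq> W"
    proof
      fix \<psi> assume N: "\<psi> \<in> ?N"
      then have \<psi>: "\<psi> \<in> states G alg" by auto
      have c: "cmod (\<phi> (lop (delta x)) - \<psi> (lop (delta x))) \<le> d" if "x \<in> S - {0}" for x
        using N that by (auto simp: dist_norm intro: less_imp_le)
      have "(\<Sum>x\<in>S - {0}. cmod (\<phi> (lop (delta x)) - \<psi> (lop (delta x))) / \<l> x) \<le> (\<Sum>x\<in>S - {0}. d * (1 / \<l> x))"
        using c lp by (intro sum_mono) (simp add: divide_right_mono less_imp_le)
      also have "\<dots> = d * m" by (simp add: m_def sum_distrib_left)
      also have "\<dots> \<le> d * (m + 1)" using d by simp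
      also have "\<dots> = r / 4" using m unfolding d_def by (intro nonzero_divide_eq_eq[THEN iffD1, symmetric]) auto
      finally have s: "(\<Sum>x\<in>S - {0}. cmod (\<phi> (lop (delta x)) - \<psi> (lop (delta x))) / \<l> x) \<le> r / 4" .
      have "mkd \<phi> \<psi> \<le> r / 2" unfolding mkd_le_iff[OF u \<phi> \<psi>]
      proof (intro ballI impI)
        fix f assume f: "f \<in> fs" "lipr f \<le> 1"
        show "cmod (\<phi> (lop f) - \<psi> (lop f)) \<le> r / 2"
          using state_diff_bound[OF S(1,2) f _ S(3)[OF f] \<phi> \<psi>] s r(1) by simp
      qed
      then have "\<psi> \<in> M.mball \<phi> r" using \<phi> \<psi> r(1) by simp
      then show "\<psi> \<in> W" using r(2) by blast
    qed
    ultimately show "\<exists>T. openin (weak_star G alg) T \<and> \<phi> \<in> T \<and> T \<subseteq> W" by blast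
  qed
  show ?thesis unfolding topology_eq using 1 2 by blast
qed

end

section \<open>From uniform tails to a quantum compact metric space\<close>

context twisted_length
begin

lemma sadomI: "f \<in> fs \<Longrightarrow> self_adj G (lop f) \<Longrightarrow> lop f \<in> sadom"
  by (auto simp: sadom_def)

lemma sadom_add:
  assumes "a \<in> sadom" "b \<in> sadom" shows "op_add a b \<in> sadom"
proof -
  obtain f g where f: "f \<in> fs" "a = lop f" "self_adj G a" and g: "g \<in> fs" "b = lop g" "self_adj G b"
    using assms by (auto simp: sadom_def)
  have "adj G (op_add a b) (op_add a b)"
    by (rule adj_op_add) (use f g in \<open>auto simp: is_op_lop self_adj_iff\<close>)
  then show ?thesis using sadomI[OF fs_add[OF f(1) g(1)]] f g by (simp add: lop_add self_adj_iff)
qed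

lemma self_adj_scale: "self_adj G a \<Longrightarrow> self_adj G (op_scale (of_real c) a)"
  using adj_op_scale[of G a a "of_real c"] by (simp add: self_adj_iff)

lemma sadom_scale:
  assumes "a \<in> sadom" shows "op_scale (of_real c) a \<in> sadom"
proof -
  obtain f where f: "f \<in> fs" "a = lop f" "self_adj G a" using assms by (auto simp: sadom_def)
  show ?thesis using sadomI[OF fs_scale[OF f(1)]] self_adj_scale[OF f(3)] f by (simp add: lop_scale)
qed

text \<open>Symmetrise an approximant: \<open>a\<close> is its own adjoint, so
  \<open>lop (star f)\<close> is as close to \<open>a\<close> as \<open>lop f\<close> is, and so is
  their self-adjoint mean.\<close>

lemma sadom_dense:
  assumes a: "a \<in> sa_part G alg" and e: "0 < e"
  shows "\<exists>b\<in>sadom. opnorm G (op_minus a b) < ereal e"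
proof -
  have aa: "a \<in> alg" "adj G a a" using a by (auto simp: sa_part_def self_adj_iff)
  note op = alg_is_op[OF aa(1)]
  have e2: "0 < e / 2" using e by simp
  obtain f where f: "f \<in> fs" "bnd G (op_minus a (lop f)) (e / 2)" using algD[OF aa(1) e2] .
  note s = fs_star[OF f(1)]
  let ?g = "\<lambda>x. 1/2 * (f x + star f x)"
  have g: "?g \<in> fs" by (intro fs_scale fs_add f s)
  have lg: "lop ?g = op_scale (1/2) (op_add (lop f) (lop (star f)))"
    by (simp only: lop_scale lop_add[OF f(1) s])
  note ops = is_op_lop[OF f(1)] is_op_lop[OF s]
  have gs: "self_adj G (lop ?g)"
    using self_adj_parts(1)[OF ops adj_lop[OF f(1)], folded lg] .
  have b': "bnd G (op_minus a (lop (star f))) (e / 2)"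
    by (rule adj_bnd[OF _ _ adj_op_minus[OF _ _ _ _ aa(2) adj_lop[OF f(1)]] f(2)])
      (use e in \<open>auto intro!: is_op_op_minus op ops\<close>)
  have eq: "op_minus a (lop ?g) = op_scale (1/2) (op_add (op_minus a (lop f)) (op_minus a (lop (star f))))"
    unfolding lg by (simp add: op_minus_apply op_scale_def op_add_def fun_eq_iff algebra_simps)
  have "bnd G (op_minus a (lop ?g)) (cmod (1/2) * (e / 2 + e / 2))"
    unfolding eq by (intro bnd_op_scale bnd_op_add is_op_op_minus op ops f b')
  then have "opnorm G (op_minus a (lop ?g)) \<le> ereal (e / 2)"
    using opnorm_le_iff[OF is_op_op_minus[OF op is_op_lop[OF g]], of "e / 2"] e by simp
  also have "\<dots> < ereal e" using e by simp
  finally show ?thesis using sadomI[OF g gs] by blast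
qed

lemma lipr_add: "f \<in> fs \<Longrightarrow> g \<in> fs \<Longrightarrow> lipr (\<lambda>x. f x + g x) \<le> lipr f + lipr g"
  using Lip_add[of f g] by (simp add: Lip_lipr fs_add)

lemma lipr_delta_zero: "lipr (delta 0) = 0"
proof -
  have "comm \<l> (delta 0) \<xi> = (\<lambda>_. 0)" if "\<xi> \<in> fs" for \<xi>
    using that by (simp add: comm_def tconv_delta_zero fs_l2 fs_mult)
  then have "Lip (lop (delta 0)) \<le> ereal 0" using Lip_le_iff[OF fs_delta[OF G0], of 0] by simp
  then show ?thesis using lipr_nonneg[of "delta 0"] by (simp add: Lip_lipr fs_delta G0)
qed

lemma self_adj_one: "self_adj G (op_one G)"
  by (simp add: self_adj_def op_one_def)

text \<open>Seminorm 0 kills every coefficient off 0 by \<open>coefficient_bound\<close>, as the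
  length is positive there; self-adjointness makes the remaining coefficient real.\<close>

lemma Lip_kernel: "{a \<in> sadom. Lip a = 0} = {op_scale (of_real c) (op_one G) | c::real. True}"
proof (intro set_eqI iffI)
  fix a assume "a \<in> {a \<in> sadom. Lip a = 0}"
  then obtain f where f: "f \<in> fs" "a = lop f" "self_adj G a" "lipr f = 0"
    by (auto simp: sadom_def lipr_def)
  have "f x = 0" if x: "x \<noteq> 0" for x
  proof (cases "x \<in> G")
    case True
    have "\<bar>\<l> x\<bar> * cmod (f x) \<le> 0"
      using coefficient_bound[OF f(1) lipr_bound[OF f(1)] True] f(4) by simp
    moreover have "0 < \<bar>\<l> x\<bar>" using len_pos[OF True x] by simp
    ultimately show ?thesis
      by (metis mult_pos_pos not_le zero_less_norm_iff)
  qed (use fs_G[OF f(1)] in blast)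
  then have e: "f = (\<lambda>x. f 0 * delta 0 x)" by (auto simp: delta_def)
  have d: "delta 0 \<in> l2 G" by (rule delta_l2(1)[OF G0])
  have "l2inner G (lop f (delta 0)) (delta 0) = f 0"
    by (simp add: l2inner_delta_right[OF G0] lop_apply[OF d] tconv_delta_right[OF G0 f(1)])
  then have "f 0 \<in> \<real>" using self_adj_inner_real[OF f(3) d] f(2) by simp
  then obtain c where "f 0 = of_real c" by (auto elim: Reals_cases)
  then have "a = op_scale (of_real c) (op_one G)"
    using f(2) e by (metis lop_one lop_scale)
  then show "a \<in> {op_scale (of_real c) (op_one G) | c::real. True}" by blast
next
  fix a assume "a \<in> {op_scale (of_real c) (op_one G) | c::real. True}"
  then obtain c :: real where a: "a = op_scale (of_real c) (op_one G)" by blast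
  let ?f = "\<lambda>x. complex_of_real c * delta 0 x"
  have f: "?f \<in> fs" by (intro fs_scale fs_delta G0)
  have l: "a = lop ?f" by (simp add: a lop_scale flip: lop_one)
  have "Lip a = 0" by (simp add: l Lip_lipr[OF f] lipr_scale[OF fs_delta[OF G0]] lipr_delta_zero)
  moreover have "a \<in> sadom"
    using sadomI[OF f] self_adj_scale[OF self_adj_one, of c] l a by metis
  ultimately show "a \<in> {a \<in> sadom. Lip a = 0}" by blast
qed

text \<open>For self-adjoint \<open>a\<close> and \<open>b\<close> the adjoint of
  \<open>a \<circ> b\<close> is \<open>b \<circ> a\<close>, so \<open>J\<close> and \<open>K\<close>
  are the real and imaginary parts of a product. Both orders of the product obey the same derivation
  estimate, and the factor of modulus 1/2 averages them.\<close>

lemma Lip_leibniz: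
  assumes "a \<in> sadom" "b \<in> sadom"
  defines "J \<equiv> op_scale (1/2) (op_add (a \<circ> b) (b \<circ> a))"
    and "K \<equiv> op_scale (1/(2*\<i>)) (op_minus (a \<circ> b) (b \<circ> a))"
  shows "J \<in> sadom" "K \<in> sadom"
    "max (Lip J) (Lip K) \<le> Lip a * ereal (real_of_ereal (opnorm G b))
      + ereal (real_of_ereal (opnorm G a)) * Lip b"
proof -
  obtain f g where f: "f \<in> fs" "a = lop f" "self_adj G a" and g: "g \<in> fs" "b = lop g" "self_adj G b"
    using assms by (auto simp: sadom_def)
  have op: "is_op G a" "is_op G b" using f g is_op_lop by auto
  have fg: "tconv f g \<in> fs" "tconv g f \<in> fs" "a \<circ> b = lop (tconv f g)" "b \<circ> a = lop (tconv g f)"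
    using f g by (auto simp: tconv_fs lop_comp)
  have opc: "is_op G (a \<circ> b)" "is_op G (b \<circ> a)" using op by (auto intro: is_op_comp)
  have ad: "adj G (a \<circ> b) (b \<circ> a)" "adj G (b \<circ> a) (a \<circ> b)"
    using f(3) g(3) op by (auto simp: self_adj_iff intro: adj_comp)
  let ?j = "\<lambda>x. 1/2 * (tconv f g x + tconv g f x)"
  let ?k = "\<lambda>x. (1/(2*\<i>)) * (tconv f g x + (-1) * tconv g f x)"
  have jk: "?j \<in> fs" "?k \<in> fs" by (intro fs_scale fs_add fg)+
  have J: "J = lop ?j" unfolding J_def fg(3,4) by (simp only: lop_scale lop_add[OF fg(1,2)])
  have K: "K = lop ?k" unfolding K_def fg(3,4) op_minus_def
    by (simp only: lop_scale lop_add[OF fg(1) fs_scale[OF fg(2)]])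
  note parts = self_adj_parts[OF opc ad(1)]
  show "J \<in> sadom" using parts(1) sadomI[OF jk(1)] J by (simp add: J_def)
  have "K = op_scale (-\<i>/2) (op_add (a \<circ> b) (op_scale (-1) (b \<circ> a)))"
    by (simp add: K_def op_minus_def)
  then show "K \<in> sadom" using parts(2) sadomI[OF jk(2)] K by simp
  define A B where "A = real_of_ereal (opnorm G a)" and "B = real_of_ereal (opnorm G b)"
  have AB: "0 \<le> A" "bnd G (lop f) A" "0 \<le> B" "bnd G (lop g) B"
    using opnorm_bnd[OF op(1)] opnorm_bnd[OF op(2)] lop_finite[OF f(1)] lop_finite[OF g(1)] f(2) g(2)
    by (auto simp: A_def B_def)
  have l1: "lipr (tconv f g) \<le> lipr f * B + A * lipr g" by (rule lipr_tconv[OF f(1) g(1) AB])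
  have l2: "lipr (tconv g f) \<le> lipr f * B + A * lipr g"
    using lipr_tconv[OF g(1) f(1) AB(3,4,1,2)] by (simp add: algebra_simps)
  have "lipr ?j \<le> lipr f * B + A * lipr g"
    unfolding lipr_scale[OF fs_add[OF fg(1,2)]] using lipr_add[OF fg(1,2)] l1 l2 by simp
  moreover have "lipr (\<lambda>x. (-1) * tconv g f x) = lipr (tconv g f)"
    unfolding lipr_scale[OF fg(2)] by simp
  then have "lipr ?k \<le> lipr f * B + A * lipr g"
    unfolding lipr_scale[OF fs_add[OF fg(1) fs_scale[OF fg(2)]]]
    using lipr_add[OF fg(1) fs_scale[OF fg(2), of "-1"]] l1 l2 by (simp add: norm_divide norm_mult)
  ultimately have "max (Lip J) (Lip K) \<le> ereal (lipr f * B + A * lipr g)"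
    unfolding J K Lip_lipr[OF jk(1)] Lip_lipr[OF jk(2)] by simp
  also have "\<dots> = Lip a * ereal B + ereal A * Lip b"
    by (simp add: f(2) g(2) Lip_lipr f(1) g(1))
  finally show "max (Lip J) (Lip K) \<le> Lip a * ereal (real_of_ereal (opnorm G b))
      + ereal (real_of_ereal (opnorm G a)) * Lip b" by (simp add: A_def B_def)
qed

text \<open>Finite support of \<open>comm \<l> f \<xi>\<close> makes the unbounded weight harmless: only finitely many
  coordinates have to converge.\<close>
lemma comm_approx:
  assumes f: "f \<in> fs" and \<xi>: "\<xi> \<in> fs"
  obtains M where "0 \<le> M" "\<And>g d. \<lbrakk>g \<in> fs; 0 \<le> d; bnd G (lop (\<lambda>x. g x - f x)) d\<rbrakk> \<Longrightarrow>
    l2norm G (comm \<l> f \<xi>) \<le> l2norm G (comm \<l> g \<xi>) + d * M"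
proof -
  let ?E = "{x. comm \<l> f \<xi> x \<noteq> 0}" and ?w = "\<lambda>x. complex_of_real (\<l> x) * \<xi> x"
  have E: "finite ?E" by (rule fs_finite[OF comm_fs[OF f \<xi>]])
  let ?m = "\<Sum>x\<in>?E. \<bar>\<l> x\<bar>"
  have m: "0 \<le> ?m" by (rule sum_nonneg) simp
  let ?M = "?m * l2norm G \<xi> + l2norm G ?w"
  have w: "?w \<in> fs" by (rule fs_mult[OF \<xi>])
  have "l2norm G (comm \<l> f \<xi>) \<le> l2norm G (comm \<l> g \<xi>) + d * ?M"
    if g: "g \<in> fs" and d: "0 \<le> d" "bnd G (lop (\<lambda>x. g x - f x)) d" for g d
  proof -
    let ?d = "\<lambda>x. g x - f x"
    have dfs: "?d \<in> fs" by (rule fs_diff[OF g f])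
    have t: "l2norm G (tconv ?d \<zeta>) \<le> d * l2norm G \<zeta>" if "\<zeta> \<in> fs" for \<zeta>
      using bndD[OF d(2) fs_l2[OF that]] by (simp add: lop_apply fs_l2 that)
    let ?r = "restr ?E (comm \<l> g \<xi>)"
    let ?s = "restr ?E (\<lambda>\<gamma>. complex_of_real (\<l> \<gamma>) * tconv ?d \<xi> \<gamma>)"
    let ?u = "restr ?E (tconv ?d ?w)"
    have e: "comm \<l> f \<xi> = (\<lambda>\<gamma>. (?r \<gamma> - ?s \<gamma>) + ?u \<gamma>)"
      by (rule ext) (auto simp: restr_def comm_def tconv_diff_left[OF g f] algebra_simps)
    have l2: "?r \<in> l2 G" "?s \<in> l2 G" "?u \<in> l2 G"
      by (intro fs_l2 fs_restr comm_fs fs_mult tconv_fs g \<xi> w dfs)+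
    have "l2norm G ?r \<le> l2norm G (comm \<l> g \<xi>)" by (rule restr_l2(2)[OF fs_l2[OF comm_fs[OF g \<xi>]]])
    moreover have "l2norm G ?s \<le> ?m * l2norm G (tconv ?d \<xi>)"
    proof (rule l2_mono(2)[OF fs_l2[OF tconv_fs[OF dfs \<xi>]] _ m])
      fix x
      have "\<bar>\<l> x\<bar> \<le> ?m" if "x \<in> ?E" by (rule member_le_sum[OF that _ E]) simp
      then show "cmod (?s x) \<le> ?m * cmod (tconv ?d \<xi> x)"
        by (auto simp: restr_def norm_mult m mult_right_mono)
    qed
    moreover have "?m * l2norm G (tconv ?d \<xi>) \<le> ?m * (d * l2norm G \<xi>)"
      by (rule mult_left_mono[OF t[OF \<xi>] m])
    moreover have "l2norm G ?u \<le> l2norm G (tconv ?d ?w)"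
      by (rule restr_l2(2)[OF fs_l2[OF tconv_fs[OF dfs w]]])
    moreover have "l2norm G (tconv ?d ?w) \<le> d * l2norm G ?w" by (rule t[OF w])
    moreover have "l2norm G (comm \<l> f \<xi>) = l2norm G (\<lambda>\<gamma>. (?r \<gamma> - ?s \<gamma>) + ?u \<gamma>)"
      by (rule arg_cong[OF e])
    moreover have "l2norm G (\<lambda>\<gamma>. (?r \<gamma> - ?s \<gamma>) + ?u \<gamma>) \<le> (l2norm G ?r + l2norm G ?s) + l2norm G ?u"
      by (rule order_trans[OF l2_add(2)[OF l2_diff(1)[OF l2(1,2)] l2(3)]
            add_right_mono[OF l2_diff(2)[OF l2(1,2)]]])
    ultimately show ?thesis by (simp add: algebra_simps)
  qed
  with that[of ?M] m show thesis by simp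
qed

text \<open>Were the inequality false, some \<open>C\<close> would lie strictly between the two
  sides. Infinitely many \<open>s n\<close> then obey the bound \<open>C\<close> while being as
  close to \<open>a\<close> as desired, and \<open>comm_approx\<close> carries that bound to
  \<open>a\<close> on each test vector separately.\<close>

lemma Lip_lsc:
  assumes a: "a \<in> sadom" and s: "\<And>n. s n \<in> sadom" "(\<lambda>n. opnorm G (op_minus (s n) a)) \<longlonglongrightarrow> 0"
  shows "Lip a \<le> liminf (\<lambda>n. Lip (s n))"
proof (rule ccontr)
  assume "\<not> Lip a \<le> liminf (\<lambda>n. Lip (s n))"
  then have "liminf (\<lambda>n. Lip (s n)) < Lip a" by simp
  then obtain C where C: "liminf (\<lambda>n. Lip (s n)) < ereal C" "ereal C < Lip a" using ereal_dense2 by blast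
  obtain f where f: "f \<in> fs" "a = lop f" using a by (auto simp: sadom_def)
  have "\<forall>n. \<exists>g. g \<in> fs \<and> s n = lop g" using s(1) by (auto simp: sadom_def)
  then obtain g where g: "\<And>n. g n \<in> fs" "\<And>n. s n = lop (g n)" by metis
  have fr: "\<exists>\<^sub>F n in sequentially. Lip (s n) < ereal C"
  proof (rule ccontr)
    assume "\<not> (\<exists>\<^sub>F n in sequentially. Lip (s n) < ereal C)"
    then have "\<forall>\<^sub>F n in sequentially. ereal C \<le> Lip (s n)" by (simp add: not_frequently not_less)
    then have "ereal C \<le> liminf (\<lambda>n. Lip (s n))" by (rule Liminf_bounded)
    with C(1) show False by simp
  qed
  then obtain n0 where "Lip (s n0) < ereal C" by (auto dest: frequently_ex)
  then have "0 < ereal C" using Lip_nonneg[of "s n0"] by (rule le_less_trans[rotated])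
  then have C0: "0 \<le> C" by simp
  have "l2norm G (comm \<l> f \<xi>) \<le> C * l2norm G \<xi>" if \<xi>: "\<xi> \<in> fs" for \<xi>
  proof (rule field_le_epsilon)
    fix e :: real assume e: "0 < e"
    obtain M where M: "0 \<le> M" "\<And>g d. \<lbrakk>g \<in> fs; 0 \<le> d; bnd G (lop (\<lambda>x. g x - f x)) d\<rbrakk> \<Longrightarrow>
      l2norm G (comm \<l> f \<xi>) \<le> l2norm G (comm \<l> g \<xi>) + d * M" using comm_approx[OF f(1) \<xi>] by blast
    define d where "d = e / (M + 1)"
    have d: "0 < d" using e M(1) by (simp add: d_def)
    have "\<forall>\<^sub>F n in sequentially. opnorm G (op_minus (s n) a) < ereal d"
      by (rule order_tendstoD(2)[OF s(2)]) (use d in \<open>simp add: zero_ereal_def\<close>)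
    then have "\<exists>\<^sub>F n in sequentially. Lip (s n) < ereal C \<and> opnorm G (op_minus (s n) a) < ereal d"
      by (rule frequently_eventually_frequently[OF fr])
    then obtain n where n: "Lip (s n) < ereal C" "opnorm G (op_minus (s n) a) < ereal d"
      by (auto dest: frequently_ex)
    have b: "bnd G (lop (\<lambda>x. g n x - f x)) d"
      using n(2) opnorm_le_iff[OF is_op_lop[OF fs_diff[OF g(1)[of n] f(1)]], of d] d
      by (simp add: g(2) f(2) lop_minus g(1) f(1) less_imp_le)
    have "l2norm G (comm \<l> f \<xi>) \<le> l2norm G (comm \<l> (g n) \<xi>) + d * M"
      by (rule M(2)[OF g(1) less_imp_le[OF d] b])
    moreover have "l2norm G (comm \<l> (g n) \<xi>) \<le> C * l2norm G \<xi>"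
      using n(1) Lip_le_iff[OF g(1) C0, of n] \<xi> by (simp add: g(2) less_imp_le)
    moreover have "d * M \<le> e" using e M(1) by (simp add: d_def field_simps)
    ultimately show "l2norm G (comm \<l> f \<xi>) \<le> C * l2norm G \<xi> + e" by linarith
  qed
  then have "Lip a \<le> ereal C" unfolding f(2) using Lip_le_iff[OF f(1) C0] by blast
  with C(2) show False by simp
qed

theorem leibniz_qcms_of_uniform_tails:
  assumes u: "uniform_tails" shows "leibniz_qcms G alg sadom Lip"
proof -
  have r: "\<exists>f\<in>fs. a = lop f" if "a \<in> sadom" for a using that by (auto simp: sadom_def)
  have 1: "\<forall>a\<in>sadom. 0 \<le> Lip a \<and> Lip a < \<infinity>" using r Lip_nonneg Lip_finite by fastforce
  have 2: "\<forall>a\<in>sadom. \<forall>b\<in>sadom. Lip (op_add a b) \<le> Lip a + Lip b"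
  proof (intro ballI)
    fix a b assume "a \<in> sadom" "b \<in> sadom"
    then obtain f g where "f \<in> fs" "g \<in> fs" "a = lop f" "b = lop g" using r by metis
    then show "Lip (op_add a b) \<le> Lip a + Lip b" using Lip_add by (simp add: lop_add)
  qed
  have 3: "\<forall>a\<in>sadom. \<forall>c::real. Lip (op_scale (of_real c) a) = ereal \<bar>c\<bar> * Lip a"
  proof (intro ballI allI)
    fix a c assume "a \<in> sadom"
    then obtain f where f: "f \<in> fs" "a = lop f" using r by metis
    then show "Lip (op_scale (complex_of_real c) a) = ereal \<bar>c\<bar> * Lip a"
      by (simp add: lop_scale Lip_lipr fs_scale lipr_scale)
  qed
  have 4: "\<forall>\<phi>\<in>states G alg. \<forall>\<psi>\<in>states G alg. mk \<phi> \<psi> sadom Lip < \<infinity>" using mk_finite[OF u] by blast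
  have 5: "\<forall>a\<in>sadom. \<forall>b\<in>sadom.
        let J = op_scale (1/2) (op_add (a \<circ> b) (b \<circ> a));
            K = op_scale (1/(2*\<i>)) (op_minus (a \<circ> b) (b \<circ> a))
        in J \<in> sadom \<and> K \<in> sadom \<and>
           max (Lip J) (Lip K) \<le> Lip a * ereal (real_of_ereal (opnorm G b))
                              + ereal (real_of_ereal (opnorm G a)) * Lip b"
    unfolding Let_def using Lip_leibniz by blast
  have 6: "\<forall>a\<in>sadom. \<forall>s. (\<forall>n. s n \<in> sadom) \<and> (\<lambda>n. opnorm G (op_minus (s n) a)) \<longlonglongrightarrow> 0
          \<longrightarrow> Lip a \<le> liminf (\<lambda>n. Lip (s n))"
    using Lip_lsc by blast
  show ?thesis
    unfolding leibniz_qcms_def mkd_def[symmetric]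
    by (intro conjI alg_unital_cstar_subalg sadom_sa Lip_kernel Metric_space_mkd[OF u]
        mtopology_eq_weak_star[OF u] 1 2 3 4 5 6)
      (auto intro: sadom_add sadom_scale sadom_dense)
qed

end

section \<open>The p-adic norm on the p-adic fractions\<close>

locale prime_base =
  fixes p :: nat
  assumes prime_p: "prime p"
begin

lemma p_gt: "1 < p" "0 < p" "1 < real p" "0 < real p" "(0::real) < real p ^ k"
  using prime_gt_1_nat[OF prime_p] by auto

lemma prime_int: "prime_elem (int p)"
  using prime_p by simp

abbreviation "N \<equiv> padic_norm p"

text \<open>The subgroup of fractions with denominator \<open>p ^ n\<close>. These subgroups
  increase to \<open>Zp p\<close> and, by \<open>padic_norm_le_iff\<close>, are its p-adic balls of
  radius \<open>p ^ n\<close>.\<close>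

definition H :: "nat \<Rightarrow> real set" where
  "H n = {x. \<exists>q::int. x = of_int q / real p ^ n}"

lemma Zp_iff: "x \<in> Zp p \<longleftrightarrow> (\<exists>n. x \<in> H n)"
  by (auto simp: Zp_def H_def)

lemma H_step: "x \<in> H n \<Longrightarrow> x \<in> H (n + k)"
  unfolding H_def
proof clarify
  fix q :: int
  show "\<exists>r::int. of_int q / real p ^ n = of_int r / real p ^ (n + k)"
    by (rule exI[of _ "q * int p ^ k"]) (use p_gt in \<open>simp add: field_simps power_add\<close>)
qed

lemma H_mono: "x \<in> H n \<Longrightarrow> n \<le> m \<Longrightarrow> x \<in> H m"
  using H_step[of x n "m - n"] by simp

lemma H_zero: "0 \<in> H n"
  unfolding H_def by (auto intro: exI[of _ 0])

lemma H_diff: "x \<in> H n \<Longrightarrow> y \<in> H n \<Longrightarrow> x - y \<in> H n"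
  unfolding H_def by (auto simp flip: diff_divide_distrib of_int_diff)

lemma H_uminus: "x \<in> H n \<Longrightarrow> - x \<in> H n"
  using H_diff[OF H_zero, of x n] by simp

lemma H_add: "x \<in> H n \<Longrightarrow> y \<in> H n \<Longrightarrow> x + y \<in> H n"
  using H_diff[of x n "- y"] H_uminus[of y n] by simp

lemma H_Zp: "x \<in> H n \<Longrightarrow> x \<in> Zp p"
  by (auto simp: Zp_iff)

lemma H_common:
  assumes "finite E" "E \<subseteq> Zp p" obtains n where "E \<subseteq> H n"
proof -
  have "\<exists>n. E \<subseteq> H n" using assms
  proof (induction E)
    case (insert x E)
    then obtain n m where "E \<subseteq> H n" "x \<in> H m" by (auto simp: Zp_iff)
    then have "insert x E \<subseteq> H (max n m)" by (auto intro: H_mono)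
    then show ?case by blast
  qed simp
  with that show thesis by blast
qed

lemma Zp_diff: assumes "x \<in> Zp p" "y \<in> Zp p" shows "x - y \<in> Zp p"
proof -
  obtain n where "{x, y} \<subseteq> H n" using H_common[of "{x, y}"] assms by auto
  then show ?thesis using H_diff[of x n y] by (auto simp: Zp_iff)
qed

lemma Zp_zero: "0 \<in> Zp p"
  using H_zero by (auto simp: Zp_iff)

lemma Zp_uminus: "x \<in> Zp p \<Longrightarrow> - x \<in> Zp p"
  using Zp_diff[OF Zp_zero, of x] by simp

lemma Zp_add: "x \<in> Zp p \<Longrightarrow> y \<in> Zp p \<Longrightarrow> x + y \<in> Zp p"
  using Zp_diff[of x "- y"] Zp_uminus[of y] by simp

lemma pow_H: "real p ^ k \<in> H n"
  unfolding H_def using p_gt by (auto intro!: exI[of _ "int p ^ (k + n)"] simp: power_add)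

lemma inv_pow_H: "1 / real p ^ k \<in> H k"
  unfolding H_def by (auto intro!: exI[of _ 1])

lemma zrep_eq:
  assumes "x \<in> Zp p" "zrep p x = (q, k)" shows "x = of_int q / real p ^ k"
proof -
  have "\<exists>r. (\<lambda>(q, k). x = of_int q / real p ^ k) r" using assms(1) by (auto simp: Zp_def)
  then have "(\<lambda>(q, k). x = of_int q / real p ^ k) (zrep p x)"
    unfolding zrep_def by (rule someI_ex)
  with assms(2) show ?thesis by simp
qed

lemma cross_eq:
  assumes "of_int q / real p ^ k = of_int q' / real p ^ k'"
  shows "q * int p ^ k' = q' * int p ^ k"
proof -
  have "of_int q * real p ^ k' = of_int q' * real p ^ k"
    using assms p_gt by (simp add: field_simps)
  then have "real_of_int (q * int p ^ k') = real_of_int (q' * int p ^ k)" by simp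
  then show ?thesis by (simp only: of_int_eq_iff)
qed

text \<open>\<open>zrep\<close> picks an arbitrary fraction. Cross-multiplying two fractions for
  \<open>x\<close> and comparing multiplicities of \<open>p\<close> shows that the quotient does not
  depend on the choice.\<close>

lemma padic_norm_eq:
  assumes x: "x = of_int q / real p ^ k" and q: "q \<noteq> 0"
  shows "N x = real p ^ k / real p ^ multiplicity (int p) q"
proof -
  have Z: "x \<in> Zp p" using x by (auto simp: Zp_def)
  have x0: "x \<noteq> 0" using x q p_gt by simp
  obtain q' k' where r: "zrep p x = (q', k')" by force
  have x': "x = of_int q' / real p ^ k'" by (rule zrep_eq[OF Z r])
  have q': "q' \<noteq> 0" using x' x0 by auto
  have "q * int p ^ k' = q' * int p ^ k" by (rule cross_eq) (use x x' in simp)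
  then have "multiplicity (int p) (q * int p ^ k') = multiplicity (int p) (q' * int p ^ k)" by simp
  moreover have "multiplicity (int p) (a * int p ^ j) = multiplicity (int p) a + j" if "a \<noteq> 0" for a j
    using that p_gt prime_int
    by (subst prime_elem_multiplicity_mult_distrib) (auto intro!: multiplicity_same_power)
  ultimately have m: "multiplicity (int p) q + k' = multiplicity (int p) q' + k" using q q' by simp
  have "real p ^ k' * real p ^ multiplicity (int p) q = real p ^ k * real p ^ multiplicity (int p) q'"
    unfolding power_add[symmetric] using m by (simp add: add.commute)
  then show ?thesis using x0 r p_gt by (simp add: padic_norm_def field_simps)
qed

lemma padic_norm_zero [simp]: "N 0 = 0"
  by (simp add: padic_norm_def)

lemma padic_norm_pos: "x \<in> Zp p \<Longrightarrow> x \<noteq> 0 \<Longrightarrow> 0 < N x"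
  using padic_norm_eq[of x] p_gt by (auto simp: Zp_def)

lemma padic_norm_nonneg: "x \<in> Zp p \<Longrightarrow> 0 \<le> N x"
  using padic_norm_pos[of x] by (cases "x = 0") auto

lemma padic_norm_uminus: assumes "x \<in> Zp p" shows "N (- x) = N x"
proof (cases "x = 0")
  case False
  obtain q k where x: "x = of_int q / real p ^ k" using assms by (auto simp: Zp_def)
  then have q: "q \<noteq> 0" using False by auto
  have "N (- x) = real p ^ k / real p ^ multiplicity (int p) (- q)"
    by (rule padic_norm_eq) (use x q in auto)
  moreover have "multiplicity (int p) (- q) = multiplicity (int p) q"
    using multiplicity_times_unit_right[of "- 1" "int p" q] by simp
  ultimately show ?thesis using padic_norm_eq[OF x q] by simp
qed simp

text \<open>The link between metric and algebra: balls around 0 are subgroups, so p-adic closeness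
  is a matter of cosets. For membership, the power of \<open>p\<close> in the numerator cancels the
  excess power in the denominator.\<close>

lemma padic_norm_le_iff:
  assumes "x \<in> Zp p" shows "N x \<le> real p ^ n \<longleftrightarrow> x \<in> H n"
proof (cases "x = 0")
  case True
  then show ?thesis using H_zero p_gt by (simp add: less_imp_le)
next
  case False
  obtain q k where x: "x = of_int q / real p ^ k" using assms by (auto simp: Zp_def)
  then have q: "q \<noteq> 0" using False by auto
  show ?thesis
  proof
    assume "x \<in> H n"
    then obtain r :: int where r: "x = of_int r / real p ^ n" by (auto simp: H_def)
    then have r0: "r \<noteq> 0" using False by auto
    have "real p ^ n / real p ^ multiplicity (int p) r \<le> real p ^ n / 1"
      using p_gt by (intro divide_left_mono) (auto intro: one_le_power)
    then show "N x \<le> real p ^ n" unfolding padic_norm_eq[OF r r0] by simp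
  next
    let ?m = "multiplicity (int p) q"
    assume "N x \<le> real p ^ n"
    then have "real p ^ k \<le> real p ^ (n + ?m)"
      unfolding padic_norm_eq[OF x q] using p_gt by (simp add: field_simps power_add)
    then have k: "k \<le> n + ?m" using power_increasing_iff[OF p_gt(3)] by blast
    obtain u where u: "q = int p ^ ?m * u" using multiplicity_dvd[of "int p" q] by (auto elim: dvdE)
    have "real p ^ (n + ?m) = real p ^ (n + ?m - k) * real p ^ k"
      using k by (simp flip: power_add)
    then have e: "real p ^ n * real p ^ ?m = real p ^ (n + ?m - k) * real p ^ k" by (simp add: power_add)
    have "x = real p ^ ?m * of_int u / real p ^ k" unfolding x by (subst u) simp
    also have "\<dots> = of_int (u * int p ^ (n + ?m - k)) / real p ^ n"
      using e p_gt by (simp add: field_simps)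
    finally show "x \<in> H n" unfolding H_def by blast
  qed
qed

lemma padic_norm_add:
  assumes "x \<in> Zp p" "y \<in> Zp p" shows "N (x + y) \<le> max (N x) (N y)"
proof (cases "x = 0 \<or> y = 0 \<or> x + y = 0")
  case True
  then show ?thesis using padic_norm_nonneg assms by (auto simp: max_def)
next
  case False
  obtain n where "{x, y} \<subseteq> H n" using H_common[of "{x, y}"] assms by auto
  then obtain q r where x: "x = of_int q / real p ^ n" and y: "y = of_int r / real p ^ n"
    by (auto simp: H_def)
  have xy: "x + y = of_int (q + r) / real p ^ n" by (simp add: x y add_divide_distrib)
  have nz: "q \<noteq> 0" "r \<noteq> 0" "q + r \<noteq> 0" using False x y xy by (auto simp del: of_int_add)
  let ?m = "multiplicity (int p)"
  have nu: "\<not> is_unit (int p)" by (rule prime_elem_not_unit[OF prime_int])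
  have "int p ^ min (?m q) (?m r) dvd q + r"
    by (intro dvd_add multiplicity_dvd') auto
  then have "min (?m q) (?m r) \<le> ?m (q + r)"
    using power_dvd_iff_le_multiplicity[OF _ nu] nz by blast
  then consider "?m q \<le> ?m (q + r)" | "?m r \<le> ?m (q + r)" by linarith
  then show ?thesis
  proof cases
    case 1
    then have "N (x + y) \<le> N x"
      unfolding padic_norm_eq[OF x nz(1)] padic_norm_eq[OF xy nz(3)]
      using p_gt by (intro divide_left_mono power_increasing) auto
    then show ?thesis by simp
  next
    case 2
    then have "N (x + y) \<le> N y"
      unfolding padic_norm_eq[OF y nz(2)] padic_norm_eq[OF xy nz(3)]
      using p_gt by (intro divide_left_mono power_increasing) auto
    then show ?thesis by simp
  qed
qed

text \<open>Apply the ultrametric inequality to \<open>y = (x + y) + (- x)\<close>: since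
  \<open>N x < N y\<close>, the larger term on the right must be that of
  \<open>x + y\<close>.\<close>

lemma padic_norm_add_eq:
  assumes "x \<in> Zp p" "y \<in> Zp p" "N x < N y" shows "N (x + y) = N y"
proof -
  have "N ((x + y) + (- x)) \<le> max (N (x + y)) (N (- x))"
    by (rule padic_norm_add[OF Zp_add[OF assms(1,2)] Zp_uminus[OF assms(1)]])
  then have "N y \<le> N (x + y)" using assms(3) padic_norm_uminus[OF assms(1)] by (simp add: max_def split: if_splits)
  with padic_norm_add[OF assms(1,2)] assms(3) show ?thesis by simp
qed

lemma padic_norm_pow: "N (real p ^ k) = 1 / real p ^ k"
  using padic_norm_eq[of "real p ^ k" "int p ^ k" 0] p_gt prime_int
  by (simp add: multiplicity_same_power)

text \<open>At exponent \<open>Suc n\<close> these are representatives of the nontrivial cosets of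
  \<open>H n\<close> in \<open>H (Suc n)\<close>; the exact norm is what
  \<open>coset_component_bound\<close> asks of its shift.\<close>

lemma padic_norm_digit:
  assumes "0 < j" "j < p" shows "N (real j / real p ^ n) = real p ^ n"
proof -
  have "\<not> int p dvd int j" using assms by (auto dest: dvd_imp_le)
  then have "multiplicity (int p) (int j) = 0" by (simp add: not_dvd_imp_multiplicity_0)
  then show ?thesis using padic_norm_eq[of "real j / real p ^ n" "int j" n] assms by simp
qed

section \<open>The length function and its translates\<close>

lemma Lp_uminus: "x \<in> Zp p \<Longrightarrow> Lp p (- x) = Lp p x"
  by (simp add: Lp_def padic_norm_uminus)

lemma Lp_nonneg: "x \<in> Zp p \<Longrightarrow> 0 \<le> Lp p x"
  by (simp add: Lp_def padic_norm_nonneg)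

lemma Lp_pos: "x \<in> Zp p \<Longrightarrow> x \<noteq> 0 \<Longrightarrow> 0 < Lp p x"
  using padic_norm_pos[of x] by (simp add: Lp_def add_nonneg_pos)

lemma Lp_zero: "Lp p 0 = 0"
  by (simp add: Lp_def)

lemma Lp_add: "x \<in> Zp p \<Longrightarrow> y \<in> Zp p \<Longrightarrow> Lp p (x + y) \<le> Lp p x + Lp p y"
  using padic_norm_add[of x y] padic_norm_nonneg[of x] padic_norm_nonneg[of y]
  unfolding Lp_def by (smt (verit) abs_triangle_ineq)

lemma Lp_diff:
  assumes "x \<in> Zp p" "y \<in> Zp p" shows "\<bar>Lp p x - Lp p y\<bar> \<le> Lp p (x - y)"
  using Lp_add[OF Zp_diff[OF assms] assms(2)] Lp_add[OF Zp_diff[OF assms(2,1)] assms(1)]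
    Lp_uminus[OF Zp_diff[OF assms]] by simp

text \<open>Far out along the real axis, at a \<open>p\<close>-adically small place, the real part of the length is
  affine and the \<open>p\<close>-adic part is unchanged; the weight of the reflected place differs by twice
  the coordinate.\<close>
lemma Lp_real_shift:
  assumes "finite E" "E \<subseteq> Zp p"
  obtains t where "t \<in> Zp p" "\<And>a. a \<in> E \<Longrightarrow> Lp p (a + t) - Lp p (a - t) = 2 * a"
proof -
  \<comment> \<open>One element \<open>p ^ j\<close> does both jobs: as a real number it is at least
    \<open>\<bar>a\<bar>\<close>, while its p-adic norm \<open>1 / p ^ j\<close> is below that of a
    nonzero \<open>a\<close>.\<close>
  have "\<forall>a\<in>E. \<exists>k. \<forall>j\<ge>k. \<bar>a\<bar> \<le> real p ^ j \<and> (a \<noteq> 0 \<longrightarrow> 1 / real p ^ j < N a)"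
  proof
    fix a assume a: "a \<in> E"
    obtain k where k: "\<bar>a\<bar> < real p ^ k" using real_arch_pow[OF p_gt(3)] by blast
    obtain l where l: "1 / N a < real p ^ l" using real_arch_pow[OF p_gt(3)] by blast
    have "\<bar>a\<bar> \<le> real p ^ j \<and> (a \<noteq> 0 \<longrightarrow> 1 / real p ^ j < N a)" if j: "max k l \<le> j" for j
    proof -
      have "real p ^ k \<le> real p ^ j" "real p ^ l \<le> real p ^ j"
        using j p_gt by (auto intro!: power_increasing)
      then have b: "\<bar>a\<bar> \<le> real p ^ j" "1 / N a < real p ^ j" using k l by linarith+
      have "1 / real p ^ j < N a" if "a \<noteq> 0"
        using b(2) padic_norm_pos[of a] that a assms(2) p_gt(5)[of j]
        by (auto simp: field_simps)
      with b show ?thesis by blast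
    qed
    then show "\<exists>k. \<forall>j\<ge>k. \<bar>a\<bar> \<le> real p ^ j \<and> (a \<noteq> 0 \<longrightarrow> 1 / real p ^ j < N a)" by blast
  qed
  then obtain k where k: "\<And>a j. a \<in> E \<Longrightarrow> k a \<le> j \<Longrightarrow>
    \<bar>a\<bar> \<le> real p ^ j \<and> (a \<noteq> 0 \<longrightarrow> 1 / real p ^ j < N a)" by metis
  define K where "K = Max (insert 0 (k ` E))"
  have K: "k a \<le> K" if "a \<in> E" for a using that assms(1) by (simp add: K_def)
  have t: "real p ^ K \<in> Zp p" using pow_H H_Zp by blast
  have "Lp p (a + real p ^ K) - Lp p (a - real p ^ K) = 2 * a" if a: "a \<in> E" for a
  proof -
    have aZ: "a \<in> Zp p" using a assms(2) by blast
    have b: "\<bar>a\<bar> \<le> real p ^ K" and n: "a \<noteq> 0 \<Longrightarrow> N (real p ^ K) < N a"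
      using k[OF a K[OF a]] by (auto simp: padic_norm_pow)
    have "N (a + real p ^ K) = N (a - real p ^ K)"
    proof (cases "a = 0")
      case True
      then show ?thesis using padic_norm_uminus[OF t] by simp
    next
      case False
      have n': "N (- (real p ^ K)) < N a" using n[OF False] padic_norm_uminus[OF t] by simp
      show ?thesis
        using padic_norm_add_eq[OF t aZ n[OF False]] padic_norm_add_eq[OF Zp_uminus[OF t] aZ n']
        by (simp add: add.commute)
    qed
    then show ?thesis using b by (simp add: Lp_def)
  qed
  with t that show thesis by blast
qed

text \<open>Comparing with a place which is also \<open>p\<close>-adically far out isolates the \<open>p\<close>-adic part.\<close>
lemma Lp_padic_shift:
  assumes E: "finite E" "E \<subseteq> Zp p" and u: "u \<in> Zp p"
  obtains s s' j K where "s \<in> Zp p" "s' \<in> Zp p" "s = u + real p ^ j"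
    "\<forall>a\<in>E. Lp p (a + s) - Lp p (a + s') = N (a + s) + K"
proof -
  obtain M where M: "E \<subseteq> H M" using H_common[OF E] .
  have "\<exists>B. \<forall>a\<in>insert 0 E. \<bar>a\<bar> \<le> B" using E(1)
    by (meson finite_imp_bounded finite_insert bounded_real)
  then obtain B where B: "\<And>a. a \<in> E \<Longrightarrow> \<bar>a\<bar> \<le> B" "0 \<le> B" by auto
  obtain j where j: "B + \<bar>u\<bar> < real p ^ j" using real_arch_pow[OF p_gt(3)] by blast
  \<comment> \<open>The summand \<open>p ^ j\<close> makes the arguments nonnegative at both places,
    so their real parts differ by a constant; and it lies in every \<open>H n\<close>, so that
    \<open>s\<close> and \<open>u\<close> are in the same coset of each of them.\<close>
  define s where "s = u + real p ^ j"
  \<comment> \<open>\<open>1 / p ^ Suc M\<close> has larger p-adic norm than anything in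
    \<open>H M\<close>, so seen from \<open>s'\<close> the p-adic part is constant on
    \<open>E\<close>.\<close>
  define s' where "s' = real p ^ j + 1 / real p ^ Suc M"
  have pj: "real p ^ j \<in> Zp p" using pow_H H_Zp by blast
  have i: "1 / real p ^ Suc M \<in> Zp p" using inv_pow_H H_Zp by blast
  have s: "s \<in> Zp p" "s' \<in> Zp p" unfolding s_def s'_def by (intro Zp_add u pj i)+
  have Ni: "N (1 / real p ^ Suc M) = real p ^ Suc M"
    using padic_norm_digit[of 1 "Suc M"] p_gt by simp
  have "Lp p (a + s) - Lp p (a + s') = N (a + s) + (s - s' - real p ^ Suc M)" if a: "a \<in> E" for a
  proof -
    have aj: "a + real p ^ j \<in> H M" using a M pow_H by (auto intro: H_add)
    have "N (a + real p ^ j) \<le> real p ^ M" using padic_norm_le_iff[OF H_Zp[OF aj]] aj by blast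
    also have "\<dots> < N (1 / real p ^ Suc M)" unfolding Ni using p_gt by simp
    finally have "N (a + s') = real p ^ Suc M"
      using padic_norm_add_eq[OF H_Zp[OF aj] i] Ni by (simp add: s'_def add.assoc)
    moreover have "0 < 1 / real p ^ Suc M" by (rule divide_pos_pos[OF zero_less_one p_gt(5)])
    then have "0 \<le> a + s" "0 \<le> a + s'"
      using B(1)[OF a] j unfolding s_def s'_def by linarith+
    ultimately show ?thesis by (simp add: Lp_def)
  qed
  with that[OF s s_def] show thesis by blast
qed

section \<open>Lattice points and tails of inverse squares\<close>

lemma finite_H_interval: "finite {a \<in> H m. \<bar>a\<bar> \<le> R}"
proof -
  let ?B = "\<lceil>R * real p ^ m\<rceil>"
  have "{a \<in> H m. \<bar>a\<bar> \<le> R} \<subseteq> (\<lambda>q. of_int q / real p ^ m) ` {-?B..?B}"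
  proof
    fix a assume "a \<in> {a \<in> H m. \<bar>a\<bar> \<le> R}"
    then obtain q :: int where q: "a = of_int q / real p ^ m" "\<bar>a\<bar> \<le> R" unfolding H_def by blast
    have "\<bar>real_of_int q\<bar> = \<bar>a\<bar> * real p ^ m" using q(1) p_gt by simp
    also have "\<dots> \<le> R * real p ^ m" by (rule mult_right_mono[OF q(2)]) simp
    finally have "\<bar>real_of_int q\<bar> \<le> R * real p ^ m" .
    then have "\<bar>q\<bar> \<le> ?B" by linarith
    then show "a \<in> (\<lambda>q. of_int q / real p ^ m) ` {-?B..?B}"
      using q(1) by (intro image_eqI[of _ _ q]) (auto simp: abs_le_iff)
  qed
  then show ?thesis by (rule finite_subset) simp
qed

lemma sum_inverse_squares_nat:
  assumes "finite I" "0 < K" "\<And>n::nat. n \<in> I \<Longrightarrow> K < n"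
  shows "(\<Sum>n\<in>I. 1 / (real n)\<^sup>2) \<le> 1 / real K"
proof -
  \<comment> \<open>Telescoping, by \<open>1 / (x + 1)^2 \<le> 1 / x - 1 / (x + 1)\<close>.\<close>
  have t: "(\<Sum>n\<in>{K<..K + d}. 1 / (real n)\<^sup>2) \<le> 1 / real K - 1 / real (K + d)" for d
  proof (induction d)
    case (Suc d)
    let ?x = "real (K + d)"
    have x: "0 < ?x" using assms(2) by simp
    have "1 / (?x + 1)\<^sup>2 \<le> 1 / (?x * (?x + 1))"
      using x by (intro divide_left_mono) (auto simp: power2_eq_square)
    also have "\<dots> = 1 / ?x - 1 / (?x + 1)" using x by (simp add: field_simps)
    finally have "1 / (real (K + Suc d))\<^sup>2 \<le> 1 / ?x - 1 / real (K + Suc d)" by (simp add: add.commute)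
    moreover have "{K<..K + Suc d} = insert (K + Suc d) {K<..K + d}" by auto
    ultimately show ?case using Suc by simp
  qed simp
  have "I \<subseteq> {K<..K + Max (insert 0 I)}"
  proof
    fix n assume n: "n \<in> I"
    then have "n \<le> Max (insert 0 I)" using assms(1) by simp
    then show "n \<in> {K<..K + Max (insert 0 I)}" using assms(3)[OF n] by simp
  qed
  then have "(\<Sum>n\<in>I. 1 / (real n)\<^sup>2) \<le> (\<Sum>n\<in>{K<..K + Max (insert 0 I)}. 1 / (real n)\<^sup>2)"
    by (intro sum_mono2) auto
  also have "\<dots> \<le> 1 / real K" by (rule order_trans[OF t]) simp
  finally show ?thesis .
qed

lemma sum_inverse_squares_int:
  assumes I: "finite I" and K: "0 < K" "\<And>q::int. q \<in> I \<Longrightarrow> int K < \<bar>q\<bar>"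
  shows "(\<Sum>q\<in>I. 1 / (real_of_int q)\<^sup>2) \<le> 2 / real K"
proof -
  have part: "(\<Sum>q\<in>I'. 1 / (real_of_int q)\<^sup>2) \<le> 1 / real K"
    if "I' \<subseteq> I" "inj_on (\<lambda>q. nat \<bar>q\<bar>) I'" for I'
  proof -
    have "(\<Sum>q\<in>I'. 1 / (real_of_int q)\<^sup>2) = (\<Sum>q\<in>I'. 1 / (real (nat \<bar>q\<bar>))\<^sup>2)" by simp
    also have "\<dots> = (\<Sum>n\<in>(\<lambda>q. nat \<bar>q\<bar>) ` I'. 1 / (real n)\<^sup>2)" by (simp add: sum.reindex[OF that(2)])
    also have "\<dots> \<le> 1 / real K"
      by (rule sum_inverse_squares_nat[OF _ K(1)]) (use that(1) I K(2) in \<open>auto intro: finite_subset simp: zless_nat_eq_int_zless\<close>)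
    finally show ?thesis .
  qed
  have "I = {q \<in> I. 0 \<le> q} \<union> {q \<in> I. q < 0}" by auto
  then have "(\<Sum>q\<in>I. 1 / (real_of_int q)\<^sup>2)
    = (\<Sum>q\<in>{q \<in> I. 0 \<le> q}. 1 / (real_of_int q)\<^sup>2) + (\<Sum>q\<in>{q \<in> I. q < 0}. 1 / (real_of_int q)\<^sup>2)"
    using I by (subst sum.union_disjoint[symmetric]) auto
  then show ?thesis
    using part[of "{q \<in> I. 0 \<le> q}"] part[of "{q \<in> I. q < 0}"]
    by (simp add: inj_on_def nat_eq_iff2)
qed

text \<open>Writing \<open>a = q / p ^ m\<close> reduces the sum to integers at the cost of a factor
  \<open>p ^ (2 * m)\<close>. The cutoff \<open>R\<close> therefore depends on \<open>m\<close>,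
  which has to be fixed first.\<close>

lemma H_inverse_square_tail:
  assumes e: "0 < e"
  obtains R where "0 \<le> R" "\<And>J. \<lbrakk>finite J; J \<subseteq> H m; \<And>a. a \<in> J \<Longrightarrow> R < \<bar>a\<bar>\<rbrakk> \<Longrightarrow> L2_set (\<lambda>a. 1 / \<bar>a\<bar>) J \<le> e"
proof -
  let ?P = "real p ^ m"
  \<comment> \<open>Ensures that \<open>p ^ (2 * m) * (2 / K)\<close> is at most \<open>e^2\<close>,
    the 2 coming from the two signs of \<open>q\<close>.\<close>
  obtain K :: nat where K: "2 * ?P\<^sup>2 / e\<^sup>2 < real K" using reals_Archimedean2 by blast
  have K0: "0 < K" using K e by (metis divide_nonneg_nonneg le_less_trans mult_nonneg_nonneg of_nat_0_less_iff
        zero_le_numeral zero_le_power2)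
  have "L2_set (\<lambda>a. 1 / \<bar>a\<bar>) J \<le> e"
    if J: "finite J" "J \<subseteq> H m" "\<And>a. a \<in> J \<Longrightarrow> real K / ?P < \<bar>a\<bar>" for J
  proof -
    let ?h = "\<lambda>q::int. of_int q / ?P"
    have inj: "inj ?h" using p_gt by (auto simp: inj_on_def)
    define I where "I = ?h -` J"
    have JI: "J = ?h ` I" using J(2) by (auto simp: I_def H_def)
    have I: "finite I" unfolding I_def by (rule finite_vimageI[OF J(1) inj])
    have big: "int K < \<bar>q\<bar>" if "q \<in> I" for q
    proof -
      have "real K / ?P < \<bar>?h q\<bar>" using J(3)[of "?h q"] that by (simp add: I_def)
      then have "real K < \<bar>real_of_int q\<bar>" using p_gt by (simp add: field_simps)
      then show ?thesis by linarith
    qed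
    have "(\<Sum>a\<in>J. (1 / \<bar>a\<bar>)\<^sup>2) = (\<Sum>q\<in>I. ?P\<^sup>2 * (1 / (real_of_int q)\<^sup>2))"
      unfolding JI by (subst sum.reindex[OF inj_on_subset[OF inj]]) (auto simp: power_divide)
    also have "\<dots> \<le> ?P\<^sup>2 * (2 / real K)"
      unfolding sum_distrib_left[symmetric] by (intro mult_left_mono sum_inverse_squares_int[OF I K0 big]) auto
    also have "\<dots> \<le> e\<^sup>2" using K K0 e by (simp add: field_simps)
    finally show ?thesis using e by (simp add: L2_set_def real_le_lsqrt)
  qed
  moreover have "0 \<le> real K / ?P" by simp
  ultimately show thesis using that by blast
qed

end

section \<open>Uniform tails for the p-adic fractions\<close>

locale solenoid = prime_base p for p :: nat +
  fixes \<theta> :: "nat \<Rightarrow> real"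
  assumes theta: "\<theta> \<in> Omega p"
begin

lemma theta_step: "real p ^ j * \<theta> (n + j) - \<theta> n \<in> \<int>"
proof (induction j)
  case (Suc j)
  have "real p * \<theta> (n + Suc j) - \<theta> (n + j) \<in> \<int>" using theta by (auto simp: Omega_def dest!: spec[of _ "n + Suc j"])
  then have "real p ^ j * (real p * \<theta> (n + Suc j) - \<theta> (n + j)) \<in> \<int>"
    by (intro Ints_mult) auto
  from Ints_add[OF this Suc] show ?case by (simp add: algebra_simps)
qed simp

definition e2 :: "real \<Rightarrow> complex" where
  "e2 t = exp (2 * complex_of_real pi * \<i> * complex_of_real t)"

lemma e2_add: "e2 (s + t) = e2 s * e2 t"
  by (simp add: e2_def exp_add algebra_simps)

lemma norm_e2: "cmod (e2 t) = 1"
  by (simp add: e2_def)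

lemma e2_Ints: assumes "t \<in> \<int>" shows "e2 t = 1"
  using exp_integer_2pi[OF assms] by (simp add: e2_def algebra_simps)

lemma e2_cong: "s - t \<in> \<int> \<Longrightarrow> e2 s = e2 t"
  using e2_add[of "s - t" t] e2_Ints[of "s - t"] by simp

text \<open>The phase does not depend on the fractions that \<open>zrep\<close> picks. By
  \<open>theta_step\<close> both exponents are, modulo integers, expressions in
  \<open>\<theta>\<close> at the common index \<open>?n\<close>, and there they coincide because the
  numerators cross-multiply.\<close>

lemma sigma_eq:
  assumes x: "fst x = of_int q / real p ^ k" and y: "snd y = of_int r / real p ^ l"
  shows "sigma p \<theta> x y = e2 (\<theta> (k + l) * of_int q * of_int r)"
proof -
  have xy: "fst x \<in> Zp p" "snd y \<in> Zp p" using x y by (auto simp: Zp_def)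
  obtain q' k' where x': "zrep p (fst x) = (q', k')" by force
  obtain r' l' where y': "zrep p (snd y) = (r', l')" by force
  have q: "q * int p ^ k' = q' * int p ^ k"
    by (rule cross_eq) (use x zrep_eq[OF xy(1) x'] in simp)
  have r: "r * int p ^ l' = r' * int p ^ l"
    by (rule cross_eq) (use y zrep_eq[OF xy(2) y'] in simp)
  let ?n = "k + l + (k' + l')"
  have "(real p ^ (k' + l') * \<theta> (k + l + (k' + l')) - \<theta> (k + l)) * of_int (q * r) \<in> \<int>"
    by (rule Ints_mult[OF theta_step]) simp
  then have 1: "real p ^ (k' + l') * \<theta> ?n * of_int (q * r) - \<theta> (k + l) * of_int (q * r) \<in> \<int>"
    by (simp add: left_diff_distrib)
  have "(real p ^ (k + l) * \<theta> (k' + l' + (k + l)) - \<theta> (k' + l')) * of_int (q' * r') \<in> \<int>"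
    by (rule Ints_mult[OF theta_step]) simp
  then have 2: "real p ^ (k + l) * \<theta> ?n * of_int (q' * r') - \<theta> (k' + l') * of_int (q' * r') \<in> \<int>"
    by (simp add: left_diff_distrib add.commute)
  have "(q * int p ^ k') * (r * int p ^ l') = (q' * int p ^ k) * (r' * int p ^ l)" by (simp only: q r)
  then have "real_of_int (q * int p ^ k' * (r * int p ^ l')) = real_of_int (q' * int p ^ k * (r' * int p ^ l))"
    by (simp only:)
  then have "real p ^ (k' + l') * of_int (q * r) = real p ^ (k + l) * of_int (q' * r')"
    by (simp add: power_add algebra_simps)
  then have "real p ^ (k' + l') * \<theta> ?n * of_int (q * r) = real p ^ (k + l) * \<theta> ?n * of_int (q' * r')"
    by (metis (no_types, lifting) mult.assoc mult.commute)
  then have "\<theta> (k' + l') * of_int (q' * r') - \<theta> (k + l) * of_int (q * r)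
    = (real p ^ (k' + l') * \<theta> ?n * of_int (q * r) - \<theta> (k + l) * of_int (q * r))
      - (real p ^ (k + l) * \<theta> ?n * of_int (q' * r') - \<theta> (k' + l') * of_int (q' * r'))"
    by linarith
  with Ints_diff[OF 1 2] have "\<theta> (k' + l') * of_int (q' * r') - \<theta> (k + l) * of_int (q * r) \<in> \<int>"
    by (simp only:)
  then have "e2 (\<theta> (k' + l') * of_int (q' * r')) = e2 (\<theta> (k + l) * of_int (q * r))" by (rule e2_cong)
  then show ?thesis unfolding sigma_def x' y' by (simp add: e2_def algebra_simps)
qed

section \<open>The twisted group of pairs of p-adic fractions\<close>

lemma Gam_iff: "\<gamma> \<in> Gam p \<longleftrightarrow> fst \<gamma> \<in> Zp p \<and> snd \<gamma> \<in> Zp p"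
  by (cases \<gamma>) (simp add: Gam_def)

lemma common_denominator:
  assumes "x \<in> Zp p" "y \<in> Zp p"
  obtains q r n where "x = of_int q / real p ^ n" "y = of_int r / real p ^ n"
proof -
  obtain n where "{x, y} \<subseteq> H n" using H_common[of "{x, y}"] assms by auto
  with that show thesis by (auto simp: H_def)
qed

sublocale twisted_length "Gam p" "sigma p \<theta>" "LpSigma p"
proof
  show "0 \<in> Gam p" by (simp add: Gam_iff Zp_zero)
  show "x - y \<in> Gam p" if "x \<in> Gam p" "y \<in> Gam p" for x y
    using that by (simp add: Gam_iff Zp_diff)
  show "sigma p \<theta> (x + y) z = sigma p \<theta> x z * sigma p \<theta> y z"
    if xyz: "x \<in> Gam p" "y \<in> Gam p" "z \<in> Gam p" for x y z
  proof -
    have Z: "fst x \<in> Zp p" "fst y \<in> Zp p" "snd z \<in> Zp p" using xyz by (auto simp: Gam_iff)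
    obtain q r n where x: "fst x = of_int q / real p ^ n" and y: "fst y = of_int r / real p ^ n"
      using common_denominator[OF Z(1,2)] .
    obtain s l where z: "snd z = of_int s / real p ^ l" using Z(3) by (auto simp: Zp_def)
    have xy: "fst (x + y) = of_int (q + r) / real p ^ n" by (simp add: x y add_divide_distrib)
    show ?thesis
      unfolding sigma_eq[OF xy z] sigma_eq[OF x z] sigma_eq[OF y z] e2_add[symmetric]
      by (simp add: algebra_simps)
  qed
  show "sigma p \<theta> z (x + y) = sigma p \<theta> z x * sigma p \<theta> z y"
    if xyz: "x \<in> Gam p" "y \<in> Gam p" "z \<in> Gam p" for x y z
  proof -
    have Z: "snd x \<in> Zp p" "snd y \<in> Zp p" "fst z \<in> Zp p" using xyz by (auto simp: Gam_iff)
    obtain q r n where x: "snd x = of_int q / real p ^ n" and y: "snd y = of_int r / real p ^ n"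
      using common_denominator[OF Z(1,2)] .
    obtain s l where z: "fst z = of_int s / real p ^ l" using Z(3) by (auto simp: Zp_def)
    have xy: "snd (x + y) = of_int (q + r) / real p ^ n" by (simp add: x y add_divide_distrib)
    show ?thesis
      unfolding sigma_eq[OF z xy] sigma_eq[OF z x] sigma_eq[OF z y] e2_add[symmetric]
      by (simp add: algebra_simps)
  qed
  show "cmod (sigma p \<theta> x y) = 1" if xy: "x \<in> Gam p" "y \<in> Gam p" for x y
  proof -
    obtain q k where "fst x = of_int q / real p ^ k" using xy(1) unfolding Gam_iff Zp_def by blast
    moreover obtain r l where "snd y = of_int r / real p ^ l" using xy(2) unfolding Gam_iff Zp_def by blast
    ultimately show ?thesis by (simp add: sigma_eq norm_e2)
  qed
  show "LpSigma p 0 = 0" by (simp add: LpSigma_def Lp_zero)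
  show "0 < LpSigma p x" if x: "x \<in> Gam p" "x \<noteq> 0" for x
  proof -
    have Z: "fst x \<in> Zp p" "snd x \<in> Zp p" using x by (auto simp: Gam_iff)
    have "fst x \<noteq> 0 \<or> snd x \<noteq> 0" using x(2) by (auto simp: prod_eq_iff)
    then show ?thesis
      using Lp_pos[OF Z(1)] Lp_pos[OF Z(2)] Lp_nonneg[OF Z(1)] Lp_nonneg[OF Z(2)]
      by (auto simp: LpSigma_def)
  qed
  show "\<bar>LpSigma p x - LpSigma p y\<bar> \<le> LpSigma p (x - y)" if xy: "x \<in> Gam p" "y \<in> Gam p" for x y
    using xy Lp_diff[of "fst x" "fst y"] Lp_diff[of "snd x" "snd y"]
    by (simp add: Gam_iff LpSigma_def)
qed

text \<open>Couples a coordinate projection with the embedding of its axis, so that both coordinates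
  are treated at once. Translation along the axis changes the length only through the coordinate
  \<open>c\<close>.\<close>

definition axis :: "(real \<times> real \<Rightarrow> real) \<Rightarrow> (real \<Rightarrow> real \<times> real) \<Rightarrow> bool" where
  "axis c \<iota> \<longleftrightarrow> c = fst \<and> \<iota> = (\<lambda>t. (t, 0)) \<or> c = snd \<and> \<iota> = (\<lambda>t. (0, t))"

lemma axis_Zp: "axis c \<iota> \<Longrightarrow> \<gamma> \<in> Gam p \<Longrightarrow> c \<gamma> \<in> Zp p"
  and axis_Gam: "axis c \<iota> \<Longrightarrow> t \<in> Zp p \<Longrightarrow> \<iota> t \<in> Gam p"
  and axis_add: "axis c \<iota> \<Longrightarrow> c (x + y) = c x + c y"
  and axis_diff: "axis c \<iota> \<Longrightarrow> c (x - y) = c x - c y"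
  and axis_LpSigma: "axis c \<iota> \<Longrightarrow>
    LpSigma p (\<gamma> + \<iota> s) - LpSigma p (\<gamma> + \<iota> t) = Lp p (c \<gamma> + s) - Lp p (c \<gamma> + t)"
  by (auto simp: axis_def Gam_iff Zp_zero LpSigma_def)

lemma axis_classmap: "axis c \<iota> \<Longrightarrow> classmap c"
  by (rule classmap_additive) (rule axis_add)

lemma axis_classmap_H: "axis c \<iota> \<Longrightarrow> classmap (\<lambda>x. {z. z - c x \<in> H m})"
  by (rule classmap_coset) (auto simp: axis_add H_zero H_diff)

text \<open>Restates membership in the coset of \<open>- t\<close> as an equality of labels, the
  form in which \<open>class_component\<close> takes it.\<close>

lemma restr_coset_eq:
  "restr {x. c x + t \<in> H m} f = restr {x. {z. z - c x \<in> H m} = {z. z + t \<in> H m}} f"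
proof -
  have "{z. z - a \<in> H m} = {z. z + t \<in> H m} \<longleftrightarrow> a + t \<in> H m" for a
  proof
    assume "{z. z - a \<in> H m} = {z. z + t \<in> H m}"
    moreover have "a \<in> {z. z - a \<in> H m}" by (simp add: H_zero)
    ultimately show "a + t \<in> H m" by blast
  next
    assume at: "a + t \<in> H m"
    have "z - a \<in> H m \<longleftrightarrow> z + t \<in> H m" for z
      using H_add[OF _ at, of "z - a"] H_diff[OF _ at, of "z + t"] by auto
    then show "{z. z - a \<in> H m} = {z. z + t \<in> H m}" by simp
  qed
  then show ?thesis by simp
qed

text \<open>The elements with coordinate in a subgroup form a single class, so cutting down to them
  does not increase the norm.\<close>

lemma tbound_restr_H:
  assumes "axis c \<iota>" "f \<in> fs" "0 \<le> B" "tbound f B"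
  shows "tbound (restr {x. c x \<in> H m} f) B"
  using tbound_restr_class[OF axis_classmap_H[OF assms(1)] assms(2-4), of m "{z. z + 0 \<in> H m}"]
    restr_coset_eq[of c 0 m f] by simp

text \<open>Collects every coordinate at which the commutator evaluates its weight. The shift lemmas
  require such a finite set; the shift then depends on \<open>f\<close> and \<open>\<xi>\<close>,
  the resulting bound does not.\<close>

lemma finite_reach:
  assumes "axis c \<iota>" "f \<in> fs" "\<xi> \<in> fs"
  obtains E where "finite E" "E \<subseteq> Zp p"
    "\<And>\<gamma> x. \<lbrakk>\<gamma> \<in> Gam p; f x \<noteq> 0; \<xi> (\<gamma> - x) \<noteq> 0\<rbrakk> \<Longrightarrow> c \<gamma> \<in> E \<and> c (\<gamma> - x) \<in> E"
proof -
  let ?X = "supp f" and ?Y = "supp \<xi>"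
  let ?E = "c ` ((\<lambda>(x, y). x + y) ` (?X \<times> ?Y) \<union> ?Y)"
  show thesis
  proof (rule that[of ?E])
    show "finite ?E" using fs_finite assms by auto
    show "?E \<subseteq> Zp p"
      using axis_Zp[OF assms(1)] tconv_supp(2)[OF assms(2,3)] fs_sub[OF assms(3)] by blast
    fix \<gamma> x assume *: "f x \<noteq> 0" "\<xi> (\<gamma> - x) \<noteq> 0"
    then have "\<gamma> \<in> (\<lambda>(x, y). x + y) ` (?X \<times> ?Y)"
      by (intro image_eqI[of _ _ "(x, \<gamma> - x)"]) auto
    with * show "c \<gamma> \<in> ?E \<and> c (\<gamma> - x) \<in> ?E" by blast
  qed
qed

definition commbound :: "(real \<times> real \<Rightarrow> complex) \<Rightarrow> real \<Rightarrow> bool" where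
  "commbound f C \<longleftrightarrow> (\<forall>\<xi>\<in>fs. l2norm (Gam p) (comm (LpSigma p) f \<xi>) \<le> C * l2norm (Gam p) \<xi>)"

lemma commboundD:
  "commbound f C \<Longrightarrow> \<xi> \<in> fs \<Longrightarrow> l2norm (Gam p) (comm (LpSigma p) f \<xi>) \<le> C * l2norm (Gam p) \<xi>"
  by (simp add: commbound_def)

text \<open>The lengths seen from \<open>t\<close> and from \<open>- t\<close> differ by the
  additive weight \<open>2 * c\<close>, whose commutator is convolution by \<open>2 * c * f\<close>.
  That 2 cancels the one in \<open>comm_translate_diff\<close>.\<close>

lemma coordinate_bound:
  assumes ax: "axis c \<iota>" and f: "f \<in> fs" and C: "commbound f C"
  shows "tbound (\<lambda>x. of_real (c x) * f x) C"
  unfolding tbound_def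
proof
  fix \<xi> assume \<xi>: "\<xi> \<in> fs"
  obtain E where E: "finite E" "E \<subseteq> Zp p"
    "\<And>\<gamma> x. \<lbrakk>\<gamma> \<in> Gam p; f x \<noteq> 0; \<xi> (\<gamma> - x) \<noteq> 0\<rbrakk> \<Longrightarrow> c \<gamma> \<in> E \<and> c (\<gamma> - x) \<in> E"
    using finite_reach[OF ax f \<xi>] by blast
  obtain t where t: "t \<in> Zp p" "\<And>a. a \<in> E \<Longrightarrow> Lp p (a + t) - Lp p (a - t) = 2 * a"
    using Lp_real_shift[OF E(1,2)] by blast
  let ?w = "\<lambda>x. LpSigma p (x + \<iota> t) - LpSigma p (x + \<iota> (- t))"
  have w: "?w \<gamma> = 2 * c \<gamma>" if "c \<gamma> \<in> E" for \<gamma>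
    using t(2)[OF that] by (simp add: axis_LpSigma[OF ax])
  have "comm ?w f \<xi> = comm (\<lambda>x. 2 * c x) f \<xi>"
    by (rule comm_cong) (use w E(3) in simp)
  also have "\<dots> = (\<lambda>\<gamma>. 2 * tconv (\<lambda>x. of_real (c x) * f x) \<xi> \<gamma>)"
  proof
    fix \<gamma> show "comm (\<lambda>x. 2 * c x) f \<xi> \<gamma> = 2 * tconv (\<lambda>x. of_real (c x) * f x) \<xi> \<gamma>"
    proof (cases "\<gamma> \<in> Gam p")
      case True
      have "tconv (\<lambda>x. of_real (c x) * f x) \<xi> \<gamma>
        = (\<Sum>x\<in>supp f. sigma p \<theta> x (\<gamma> - x) * (of_real (c x) * f x) * \<xi> (\<gamma> - x))"
        by (rule tconv_eq[OF fs_finite[OF f] _ True]) auto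
      then show ?thesis
        unfolding comm_eq[OF True] by (simp add: axis_diff[OF ax] sum_distrib_left algebra_simps)
    qed (simp add: comm_outside)
  qed
  finally have e: "comm ?w f \<xi> = (\<lambda>\<gamma>. 2 * tconv (\<lambda>x. of_real (c x) * f x) \<xi> \<gamma>)" .
  have "l2norm (Gam p) (comm ?w f \<xi>) \<le> 2 * C * l2norm (Gam p) \<xi>"
    by (rule comm_translate_diff[OF f commboundD[OF C] axis_Gam[OF ax t(1)] axis_Gam[OF ax Zp_uminus[OF t(1)]] \<xi>])
  then show "l2norm (Gam p) (tconv (\<lambda>x. of_real (c x) * f x) \<xi>) \<le> C * l2norm (Gam p) \<xi>"
    unfolding e l2norm_scale by simp
qed

text \<open>For \<open>\<xi>\<close> in one coset of \<open>H n\<close>, choose the origin so that the weight is the constant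
  \<open>p\<^sup>n\<^sup>+\<^sup>1\<close> on that coset and at most \<open>p\<^sup>n\<close> on its image under the component of \<open>f\<close> on \<open>- t + H n\<close>.\<close>
lemma coset_component_bound:
  assumes ax: "axis c \<iota>" and f: "f \<in> fs" and C: "commbound f C" and C0: "0 \<le> C"
    and t: "t \<in> Zp p" "N t = real p ^ Suc n"
  shows "tbound (restr {x. c x + t \<in> H n} f) (2 * C / (real p ^ Suc n - real p ^ n))"
proof -
  let ?f = "restr {x. c x + t \<in> H n} f" and ?\<kappa> = "\<lambda>x. {z. z - c x \<in> H n}"
  let ?g = "real p ^ Suc n - real p ^ n"
  have g: "0 < ?g" using p_gt by simp
  have f': "?f \<in> fs" by (rule fs_restr[OF f])
  have single: "l2norm (Gam p) (tconv ?f \<xi>) \<le> (2 * C / ?g) * l2norm (Gam p) \<xi>"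
    if \<xi>: "\<xi> \<in> fs" and cl: "\<And>x. \<xi> x \<noteq> 0 \<Longrightarrow> ?\<kappa> x = i" for \<xi> i
  proof (cases "\<exists>y. \<xi> y \<noteq> 0")
    case False
    then have "\<xi> = (\<lambda>_. 0)" by auto
    then show ?thesis by simp
  next
    case True
    then obtain y0 where y0: "\<xi> y0 \<noteq> 0" by blast
    have y0Z: "c y0 \<in> Zp p" by (rule axis_Zp[OF ax fs_G[OF \<xi> y0]])
    have co: "c y - c y0 \<in> H n" if "\<xi> y \<noteq> 0" for y
    proof -
      have "c y \<in> ?\<kappa> y" by (simp add: H_zero)
      also have "?\<kappa> y = ?\<kappa> y0" using cl[OF that] cl[OF y0] by simp
      finally show ?thesis by simp
    qed
    obtain E where E: "finite E" "E \<subseteq> Zp p"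
      "\<And>\<gamma> x. \<lbrakk>\<gamma> \<in> Gam p; f x \<noteq> 0; \<xi> (\<gamma> - x) \<noteq> 0\<rbrakk> \<Longrightarrow> c \<gamma> \<in> E \<and> c (\<gamma> - x) \<in> E"
      using finite_reach[OF ax f \<xi>] by blast
    \<comment> \<open>With this origin, \<open>c y + s\<close> lies in \<open>t + H n\<close> on the
      support of \<open>\<xi>\<close> and has norm exactly \<open>p ^ Suc n\<close>. At a
      \<open>\<gamma>\<close> reached by the component, \<open>c \<gamma> + s\<close> lies in
      \<open>H n\<close>, so its norm is at most \<open>p ^ n\<close>.\<close>
    obtain s s' j K where s: "s \<in> Zp p" "s' \<in> Zp p" "s = (t - c y0) + real p ^ j"
      "\<forall>a\<in>E. Lp p (a + s) - Lp p (a + s') = N (a + s) + K"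
      using Lp_padic_shift[OF E(1,2) Zp_diff[OF t(1) y0Z]] .
    let ?w = "\<lambda>x. LpSigma p (x + \<iota> s) - LpSigma p (x + \<iota> s')"
    have cw: "comm ?w f \<xi> = comm (\<lambda>x. N (c x + s)) f \<xi>"
      by (rule comm_cong) (use s(4) E(3) in \<open>simp add: axis_LpSigma[OF ax]\<close>)
    have wcol: "N (c y + s) = real p ^ Suc n" if y: "\<xi> y \<noteq> 0" for y
    proof -
      let ?b = "(c y - c y0) + real p ^ j"
      have b: "?b \<in> H n" by (rule H_add[OF co[OF y] pow_H])
      then have "N ?b \<le> real p ^ n" using padic_norm_le_iff[OF H_Zp[OF b]] by blast
      also have "\<dots> < N t" using t(2) g by simp
      finally have "N (?b + t) = N t" by (rule padic_norm_add_eq[OF H_Zp[OF b] t(1)])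
      then show ?thesis using t(2) by (simp add: s(3) algebra_simps)
    qed
    \<comment> \<open>Where the component can reach, the commutator with all of \<open>f\<close> is
      the convolution by the component times a factor of modulus at least \<open>?g\<close>: other
      cosets of \<open>f\<close> lead elsewhere. Outside that region the convolution by the
      component vanishes.\<close>
    have pw: "?g * cmod (tconv ?f \<xi> \<gamma>) \<le> cmod (comm ?w f \<xi> \<gamma>)" for \<gamma>
    proof (cases "\<gamma> \<in> Gam p \<and> c \<gamma> - c y0 + t \<in> H n")
      case True
      then have \<gamma>: "\<gamma> \<in> Gam p" and row: "c \<gamma> - c y0 + t \<in> H n" by auto
      have summand: "of_real (N (c \<gamma> + s) - N (c (\<gamma> - x) + s)) * (sigma p \<theta> x (\<gamma> - x) * f x * \<xi> (\<gamma> - x))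
        = of_real (N (c \<gamma> + s) - real p ^ Suc n) * (sigma p \<theta> x (\<gamma> - x) * ?f x * \<xi> (\<gamma> - x))" for x
      proof (cases "\<xi> (\<gamma> - x) = 0")
        case False
        have "(c \<gamma> - c y0 + t) - (c (\<gamma> - x) - c y0) \<in> H n" by (rule H_diff[OF row co[OF False]])
        then have "c x + t \<in> H n" by (simp add: axis_diff[OF ax] add.commute)
        then show ?thesis using wcol[OF False] by (simp add: restr_def)
      qed simp
      have "comm ?w f \<xi> \<gamma> = of_real (N (c \<gamma> + s) - real p ^ Suc n) * tconv ?f \<xi> \<gamma>"
        unfolding cw comm_eq[OF \<gamma>] summand
        by (subst tconv_eq[OF fs_finite[OF f] _ \<gamma>]) (auto simp: restr_def sum_distrib_left)
      moreover have "?g \<le> \<bar>N (c \<gamma> + s) - real p ^ Suc n\<bar>"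
      proof -
        have b: "(c \<gamma> - c y0 + t) + real p ^ j \<in> H n" by (rule H_add[OF row pow_H])
        then have "N ((c \<gamma> - c y0 + t) + real p ^ j) \<le> real p ^ n"
          using padic_norm_le_iff[OF H_Zp[OF b]] by blast
        then have "N (c \<gamma> + s) \<le> real p ^ n" by (simp add: s(3) algebra_simps)
        then show ?thesis by linarith
      qed
      ultimately show ?thesis
        by (simp only: norm_mult norm_of_real) (rule mult_right_mono[OF _ norm_ge_zero])
    next
      case False
      have "tconv ?f \<xi> \<gamma> = 0"
      proof (rule ccontr)
        assume nz: "tconv ?f \<xi> \<gamma> \<noteq> 0"
        obtain x where x: "?f x \<noteq> 0" "\<xi> (\<gamma> - x) \<noteq> 0" "\<gamma> \<in> Gam p" using tconv_nz[OF nz] by blast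
        have "c x + t \<in> H n" using x(1) by (auto simp: restr_def split: if_splits)
        from H_add[OF this co[OF x(2)]] have "c \<gamma> - c y0 + t \<in> H n"
          by (simp add: axis_diff[OF ax] algebra_simps)
        with False x(3) show False by simp
      qed
      then show ?thesis by simp
    qed
    have "cmod (tconv ?f \<xi> \<gamma>) \<le> (1 / ?g) * cmod (comm ?w f \<xi> \<gamma>)" for \<gamma>
      using pw[of \<gamma>] g by (simp add: pos_le_divide_eq mult.commute)
    then have "l2norm (Gam p) (tconv ?f \<xi>) \<le> (1 / ?g) * l2norm (Gam p) (comm ?w f \<xi>)"
      using g by (intro l2_mono(2) fs_l2[OF comm_fs[OF f \<xi>]]) auto
    also have "\<dots> \<le> (1 / ?g) * (2 * C * l2norm (Gam p) \<xi>)"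
      using g by (intro mult_left_mono comm_translate_diff[OF f commboundD[OF C] axis_Gam[OF ax s(1)] axis_Gam[OF ax s(2)] \<xi>]) auto
    finally show ?thesis by (simp add: mult.assoc)
  qed
  have D: "0 \<le> 2 * C / ?g" using g C0 by simp
  have idem: "restr {x. c x + t \<in> H n} ?f = ?f" by (auto simp: restr_def)
  \<comment> \<open>\<open>class_component\<close> is applied to the component, which the
    restriction leaves unchanged; this extends the bound from test vectors in one coset to all of
    \<open>fs\<close>.\<close>
  have "tbound (restr {x. ?\<kappa> x = {z. z + t \<in> H n}} ?f) (2 * C / ?g)"
    unfolding tbound_def
    by (intro ballI class_component[OF axis_classmap_H[OF ax] f' _ D] single)
  then show ?thesis unfolding restr_coset_eq[symmetric] idem .
qed

text \<open>The digit \<open>j\<close> is the residue modulo \<open>p\<close> of the numerator of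
  \<open>a\<close> over \<open>p ^ Suc n\<close>.\<close>

lemma H_Suc_cosets:
  assumes "a \<in> H (Suc n)"
  shows "\<exists>!j. j < p \<and> a - real j / real p ^ Suc n \<in> H n"
proof -
  obtain q :: int where q: "a = of_int q / real p ^ Suc n" using assms by (auto simp: H_def)
  have mem: "a - real j / real p ^ Suc n \<in> H n \<longleftrightarrow> int p dvd q - int j" for j
  proof -
    have e: "a - real j / real p ^ Suc n = of_int (q - int j) / real p ^ Suc n"
      by (simp add: q diff_divide_distrib)
    have "of_int (q - int j) / real p ^ Suc n \<in> H n \<longleftrightarrow> (\<exists>r. q - int j = int p * r)"
    proof -
      have "of_int (q - int j) / real p ^ Suc n = of_int r / real p ^ n \<longleftrightarrow> q - int j = int p * r" for r :: int
      proof -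
        have r: "of_int r / real p ^ n = of_int (int p * r) / real p ^ Suc n" using p_gt by simp
        have "real p ^ Suc n \<noteq> 0" using p_gt(5)[of "Suc n"] by linarith
        then show ?thesis unfolding r by (simp only: divide_cancel_right of_int_eq_iff) simp
      qed
      then show ?thesis unfolding H_def by blast
    qed
    then show ?thesis unfolding e dvd_def .
  qed
  show ?thesis unfolding mem
  proof (rule ex1I[of _ "nat (q mod int p)"])
    have "0 \<le> q mod int p" "q mod int p < int p" using p_gt by auto
    then show "nat (q mod int p) < p \<and> int p dvd q - int (nat (q mod int p))"
      by (simp add: nat_less_iff mod_eq_dvd_iff[symmetric])
  next
    fix j assume "j < p \<and> int p dvd q - int j"
    then have "q mod int p = int j" using mod_eq_dvd_iff[of q "int p" "int j"] by simp
    then show "j = nat (q mod int p)" by simp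
  qed
qed

text \<open>The shell consists of the cosets with nonzero digit. Each contributes
  \<open>2 * C / ((p - 1) * p ^ n)\<close>, so the number \<open>p - 1\<close> of cosets cancels
  exactly; passing to \<open>2 ^ n\<close> keeps later constants free of \<open>p\<close>.\<close>

lemma shell_bound:
  assumes ax: "axis c \<iota>" and f: "f \<in> fs" and C: "commbound f C" "0 \<le> C"
  shows "tbound (restr {x. c x \<in> H (Suc n) \<and> c x \<notin> H n} f) (2 * C / 2 ^ n)"
proof -
  let ?t = "\<lambda>j. - (real j / real p ^ Suc n)"
  let ?g = "real p ^ Suc n - real p ^ n"
  have g: "0 < ?g" using p_gt by simp
  have Z: "real j / real p ^ Suc n \<in> Zp p" for j
    unfolding Zp_def by (auto intro!: exI[of _ "int j"] exI[of _ "Suc n"])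
  have b: "tbound (restr {x. c x + ?t j \<in> H n} f) (2 * C / ?g)" if "j \<in> {1..<p}" for j
    using that padic_norm_uminus[OF Z] padic_norm_digit[of j "Suc n"]
    by (intro coset_component_bound[OF ax f C]) (auto simp: Zp_uminus[OF Z] simp del: power_Suc)
  have e: "restr {x. c x \<in> H (Suc n) \<and> c x \<notin> H n} f
    = (\<lambda>x. \<Sum>j\<in>{1..<p}. restr {x. c x + ?t j \<in> H n} f x)"
  proof
    fix x
    show "restr {x. c x \<in> H (Suc n) \<and> c x \<notin> H n} f x = (\<Sum>j\<in>{1..<p}. restr {x. c x + ?t j \<in> H n} f x)"
    proof (cases "c x \<in> H (Suc n)")
      case True
      obtain i where i: "i < p" "c x - real i / real p ^ Suc n \<in> H n"
        "\<And>j. j < p \<Longrightarrow> c x - real j / real p ^ Suc n \<in> H n \<Longrightarrow> j = i"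
        using H_Suc_cosets[OF True] by metis
      have "(\<Sum>j\<in>{1..<p}. restr {x. c x + ?t j \<in> H n} f x) = (\<Sum>j\<in>{1..<p}. if j = i then f x else 0)"
      proof (rule sum.cong[OF refl])
        fix j assume j: "j \<in> {1..<p}"
        have "c x + ?t j \<in> H n \<longleftrightarrow> j = i"
        proof
          assume "c x + ?t j \<in> H n"
          with j show "j = i" by (intro i(3)) auto
        qed (use i(2) in simp)
        then show "restr {x. c x + ?t j \<in> H n} f x = (if j = i then f x else 0)" by (simp add: restr_def)
      qed
      moreover have "c x \<in> H n \<longleftrightarrow> i = 0"
      proof
        assume "c x \<in> H n"
        then have "0 = i" using p_gt by (intro i(3)) auto
        then show "i = 0" ..
      qed (use i(2) in simp)
      ultimately show ?thesis using True i(1) by (auto simp: restr_def)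
    next
      case False
      have "c x - real j / real p ^ Suc n \<notin> H n" for j
      proof
        assume "c x - real j / real p ^ Suc n \<in> H n"
        then have 1: "c x - real j / real p ^ Suc n \<in> H (Suc n)" by (rule H_mono) simp
        have "real j / real p ^ Suc n \<in> H (Suc n)" unfolding H_def by (auto intro!: exI[of _ "int j"])
        from H_add[OF 1 this] False show False by simp
      qed
      then show ?thesis using False by (simp add: restr_def)
    qed
  qed
  have "tbound (restr {x. c x \<in> H (Suc n) \<and> c x \<notin> H n} f) (\<Sum>j\<in>{1..<p}. 2 * C / ?g)"
    unfolding e by (rule tbound_sum) (use b fs_restr[OF f] in auto)
  moreover have "(\<Sum>j\<in>{1..<p}. 2 * C / ?g) \<le> 2 * C / 2 ^ n"
  proof -
    have "?g = (real p - 1) * real p ^ n" by (simp add: algebra_simps)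
    then have "(\<Sum>j\<in>{1..<p}. 2 * C / ?g) = 2 * C / real p ^ n"
      using p_gt by (simp add: of_nat_diff)
    also have "\<dots> \<le> 2 * C / 2 ^ n"
      using p_gt C(2) by (intro divide_left_mono power_mono) auto
    finally show ?thesis .
  qed
  ultimately show ?thesis by (rule tbound_mono)
qed

text \<open>A finitely supported \<open>f\<close> meets finitely many shells, and the geometric sum
  of their bounds stays below \<open>4 * C / 2 ^ m\<close> however many there are.\<close>

lemma padic_tail_bound:
  assumes ax: "axis c \<iota>" and f: "f \<in> fs" and C: "commbound f C" "0 \<le> C"
  shows "tbound (restr {x. c x \<notin> H m} f) (4 * C / 2 ^ m)"
proof -
  obtain M' where M': "c ` supp f \<subseteq> H M'"
    using H_common[of "c ` supp f"] fs_finite[OF f] fs_G[OF f] axis_Zp[OF ax] by blast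
  define d where "d = M'"
  have M: "c x \<in> H (m + d)" if "f x \<noteq> 0" for x
    using H_mono[of "c x" M' "m + M'"] M' that by (auto simp: d_def)
  have e: "restr {x. c x \<in> H (m + k) \<and> c x \<notin> H m} f
    = (\<lambda>x. \<Sum>n\<in>{m..<m + k}. restr {x. c x \<in> H (Suc n) \<and> c x \<notin> H n} f x)" for k
  proof (induction k)
    case 0
    then show ?case by (simp add: restr_def)
  next
    case (Suc k)
    have "restr {x. c x \<in> H (m + Suc k) \<and> c x \<notin> H m} f
      = (\<lambda>x. restr {x. c x \<in> H (m + k) \<and> c x \<notin> H m} f x
         + restr {x. c x \<in> H (Suc (m + k)) \<and> c x \<notin> H (m + k)} f x)"
    proof
      fix x
      have 1: "c x \<notin> H m \<or> c x \<in> H (m + k)" using H_mono[OF _ le_add1, of "c x" m k] by blast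
      have 2: "c x \<notin> H (m + k) \<or> c x \<in> H (Suc (m + k))"
        using H_mono[OF _ le_SucI[OF order_refl], of "c x" "m + k"] by blast
      show "restr {x. c x \<in> H (m + Suc k) \<and> c x \<notin> H m} f x
        = restr {x. c x \<in> H (m + k) \<and> c x \<notin> H m} f x
         + restr {x. c x \<in> H (Suc (m + k)) \<and> c x \<notin> H (m + k)} f x"
        using 1 2 by (cases "c x \<in> H (m + k)") (simp_all add: restr_def)
    qed
    then show ?case unfolding Suc by simp
  qed
  have eq: "restr {x. c x \<notin> H m} f = restr {x. c x \<in> H (m + d) \<and> c x \<notin> H m} f"
    using M by (auto simp: restr_def fun_eq_iff)
  have "tbound (restr {x. c x \<notin> H m} f) (\<Sum>n\<in>{m..<m + d}. 2 * C / 2 ^ n)"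
    unfolding eq e by (intro tbound_sum fs_restr f shell_bound[OF ax f C]) auto
  moreover have "(\<Sum>n\<in>{m..<m + k}. 2 * C / 2 ^ n) = 4 * C / 2 ^ m - 4 * C / 2 ^ (m + k)" for k
  proof (induction k)
    case (Suc k)
    have "4 * C / 2 ^ (m + Suc k) = 2 * C / 2 ^ (m + k)" by simp
    with Suc show ?case by simp
  qed simp
  then have "(\<Sum>n\<in>{m..<m + d}. 2 * C / 2 ^ n) \<le> 4 * C / 2 ^ m" using C(2) by simp
  ultimately show ?thesis by (rule tbound_mono)
qed

text \<open>Away from \<open>c x = 0\<close> the function is recovered from \<open>c * f\<close> by
  the multiplier \<open>1 / c\<close>. The small square norm of this multiplier on the far part of
  the lattice becomes a small operator norm by \<open>class_multiplier\<close>.\<close>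

lemma real_tail_bound:
  assumes ax: "axis c \<iota>" and f: "f \<in> fs" and C: "tbound (\<lambda>x. of_real (c x) * f x) C" "0 \<le> C"
    and H: "\<And>x. f x \<noteq> 0 \<Longrightarrow> c x \<in> H m"
    and R: "0 \<le> R" "\<And>J. \<lbrakk>finite J; J \<subseteq> H m; \<And>a. a \<in> J \<Longrightarrow> R < \<bar>a\<bar>\<rbrakk> \<Longrightarrow> L2_set (\<lambda>a. 1 / \<bar>a\<bar>) J \<le> e"
  shows "tbound (restr {x. R < \<bar>c x\<bar>} f) (e * C)"
  unfolding tbound_def
proof
  fix \<xi> assume \<xi>: "\<xi> \<in> fs"
  let ?J = "c ` {x. f x \<noteq> 0 \<and> R < \<bar>c x\<bar>}"
  have J: "finite ?J" "?J \<subseteq> H m" "\<And>a. a \<in> ?J \<Longrightarrow> R < \<bar>a\<bar>"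
    using fs_finite[OF f] H by (auto intro: finite_subset[of _ "supp f"])
  have eq: "restr {x. R < \<bar>c x\<bar>} f
    = (\<lambda>x. if c x \<in> ?J then complex_of_real (1 / c x) * (of_real (c x) * f x) else 0)"
  proof
    fix x
    show "restr {x. R < \<bar>c x\<bar>} f x
      = (if c x \<in> ?J then complex_of_real (1 / c x) * (of_real (c x) * f x) else 0)"
    proof (cases "R < \<bar>c x\<bar>")
      case True
      then have "c x \<noteq> 0" using R(1) by auto
      moreover have "f x \<noteq> 0 \<Longrightarrow> c x \<in> ?J" using True by blast
      ultimately show ?thesis using True by (cases "f x = 0") (simp_all add: restr_def)
    next
      case False
      then have "c x \<notin> ?J" using J(3) by blast
      then show ?thesis using False by (simp add: restr_def)
    qed
  qed
  have "l2norm (Gam p) (tconv (restr {x. R < \<bar>c x\<bar>} f) \<xi>)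
    \<le> L2_set (\<lambda>a. cmod (complex_of_real (1 / a))) ?J * (C * l2norm (Gam p) \<xi>)"
    unfolding eq
    by (rule class_multiplier[OF axis_classmap[OF ax] fs_mult[OF f] \<xi> C(2) J(1), where k="\<lambda>a. complex_of_real (1 / a)"])
      (rule tboundD[OF C(1)])
  also have "L2_set (\<lambda>a. cmod (complex_of_real (1 / a))) ?J = L2_set (\<lambda>a. 1 / \<bar>a\<bar>) ?J"
    by (simp add: norm_divide)
  also have "\<dots> * (C * l2norm (Gam p) \<xi>) \<le> e * (C * l2norm (Gam p) \<xi>)"
    by (intro mult_right_mono R(2) J) (use C in auto)
  finally show "l2norm (Gam p) (tconv (restr {x. R < \<bar>c x\<bar>} f) \<xi>) \<le> e * C * l2norm (Gam p) \<xi>"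
    by (simp add: mult.assoc)
qed

text \<open>Outside \<open>A1 \<times> A2\<close> the function splits into four pieces of norm at
  most \<open>e / 4\<close> each: a p-adic and a real tail for each coordinate.\<close>

lemma uniform_tails: uniform_tails
  unfolding uniform_tails_def
proof (intro allI impI)
  fix e :: real assume e: "0 < e"
  have a1: "axis fst (\<lambda>t. (t, 0))" and a2: "axis snd (\<lambda>t. (0, t))" by (auto simp: axis_def)
  \<comment> \<open>Brings the p-adic tail \<open>4 * C / 2 ^ m\<close>, with \<open>C = 1\<close>,
    down to \<open>e / 4\<close>.\<close>
  obtain m where "16 / e < 2 ^ m" using real_arch_pow[of 2 "16 / e"] by auto
  then have m: "4 * 1 / 2 ^ m \<le> e / 4" using e by (simp add: field_simps)
  have e4: "0 < e / 4" using e by simp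
  obtain R1 where R1: "0 \<le> R1"
    "\<And>J. \<lbrakk>finite J; J \<subseteq> H m; \<And>a. a \<in> J \<Longrightarrow> R1 < \<bar>a\<bar>\<rbrakk> \<Longrightarrow> L2_set (\<lambda>a. 1 / \<bar>a\<bar>) J \<le> e / 4"
    using H_inverse_square_tail[OF e4] by blast
  define A1 where "A1 = {a \<in> H m. \<bar>a\<bar> \<le> R1}"
  have A1: "finite A1" unfolding A1_def by (rule finite_H_interval)
  \<comment> \<open>The square root of the number of values in \<open>A1\<close>: the price, by
    \<open>class_multiplier\<close> with multiplier 1, for confining the first coordinate to
    \<open>A1\<close>. The cutoff \<open>R2\<close> is chosen afterwards with accuracy
    \<open>e / 4 / (Q + 1)\<close> to pay for it.\<close>
  define Q where "Q = L2_set (\<lambda>_. 1) A1"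
  have Q: "0 \<le> Q" by (simp add: Q_def L2_set_nonneg)
  have e': "0 < e / 4 / (Q + 1)" using e Q by simp
  obtain R2 where R2: "0 \<le> R2"
    "\<And>J. \<lbrakk>finite J; J \<subseteq> H m; \<And>a. a \<in> J \<Longrightarrow> R2 < \<bar>a\<bar>\<rbrakk> \<Longrightarrow> L2_set (\<lambda>a. 1 / \<bar>a\<bar>) J \<le> e / 4 / (Q + 1)"
    using H_inverse_square_tail[OF e'] by blast
  define A2 where "A2 = {a \<in> H m. \<bar>a\<bar> \<le> R2}"
  have A2: "finite A2" unfolding A2_def by (rule finite_H_interval)
  let ?S = "A1 \<times> A2"
  have "bnd (Gam p) (lop (restr (- ?S) f)) e" if f: "f \<in> fs" and lf: "lipr f \<le> 1" for f
  proof -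
    have C: "commbound f 1" unfolding commbound_def
    proof
      fix \<xi> assume \<xi>: "\<xi> \<in> fs"
      have "lipr f * l2norm (Gam p) \<xi> \<le> 1 * l2norm (Gam p) \<xi>" using lf by (intro mult_right_mono) auto
      with lipr_bound[OF f \<xi>]
      show "l2norm (Gam p) (comm (LpSigma p) f \<xi>) \<le> 1 * l2norm (Gam p) \<xi>" by linarith
    qed
    let ?c2 = "restr {x. snd x \<in> H m}" and ?c1 = "restr {x. fst x \<in> H m}"
    define f2 where "f2 = ?c1 (?c2 f)"
    define f3 where "f3 = restr {x. \<not> R1 < \<bar>fst x\<bar>} f2"
    have fsf: "?c2 f \<in> fs" "f2 \<in> fs" "f3 \<in> fs" unfolding f3_def f2_def by (intro fs_restr f)+
    have b1: "tbound (restr {x. fst x \<notin> H m} f) (e / 4)"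
      by (rule tbound_mono[OF padic_tail_bound[OF a1 f C] m]) simp
    have "tbound (restr {x. snd x \<notin> H m} f) (e / 4)"
      by (rule tbound_mono[OF padic_tail_bound[OF a2 f C] m]) simp
    then have b2: "tbound (?c1 (restr {x. snd x \<notin> H m} f)) (e / 4)"
      using e by (intro tbound_restr_H[OF a1] fs_restr f) auto
    \<comment> \<open>The coordinate bound survives both p-adic cuts with constant 1, since each cut
      is a restriction to a subgroup.\<close>
    have contr: "tbound (?c1 (?c2 (\<lambda>x. of_real (c x) * f x))) 1" if "axis c \<iota>" for c \<iota>
      by (intro tbound_restr_H[OF a1] tbound_restr_H[OF a2] fs_restr fs_mult f coordinate_bound[OF that f C]) auto
    have r2: "?c1 (?c2 (\<lambda>x. of_real (c x) * f x)) = (\<lambda>x. of_real (c x) * f2 x)" for c :: "real \<times> real \<Rightarrow> real"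
      by (auto simp: f2_def restr_def)
    have "tbound (restr {x. R1 < \<bar>fst x\<bar>} f2) (e / 4 * 1)"
      by (rule real_tail_bound[OF a1 fsf(2) contr[OF a1, unfolded r2] _ _ R1])
         (auto simp: f2_def restr_def split: if_splits)
    then have b3: "tbound (restr {x. R1 < \<bar>fst x\<bar>} f2) (e / 4)" by simp
    \<comment> \<open>\<open>f2\<close> already lives where the first coordinate is in
      \<open>H m\<close>, so bounding that coordinate by \<open>R1\<close> leaves exactly the
      classes in \<open>A1\<close>.\<close>
    have eq3: "(\<lambda>x. of_real (snd x) * f3 x)
      = (\<lambda>x. if fst x \<in> A1 then 1 * (complex_of_real (snd x) * f2 x) else 0)"
      by (auto simp: f3_def f2_def restr_def A1_def fun_eq_iff)
    have "tbound (\<lambda>x. of_real (snd x) * f3 x) Q" unfolding tbound_def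
    proof
      fix \<xi> assume \<xi>: "\<xi> \<in> fs"
      have "l2norm (Gam p) (tconv (\<lambda>x. if fst x \<in> A1 then 1 * (complex_of_real (snd x) * f2 x) else 0) \<xi>)
        \<le> L2_set (\<lambda>j. cmod 1) A1 * (1 * l2norm (Gam p) \<xi>)"
        by (rule class_multiplier[OF axis_classmap[OF a1] fs_mult[OF fsf(2)] \<xi> _ A1, where k="\<lambda>_. 1"])
          (use tboundD[OF contr[OF a2, unfolded r2]] in auto)
      then show "l2norm (Gam p) (tconv (\<lambda>x. of_real (snd x) * f3 x) \<xi>) \<le> Q * l2norm (Gam p) \<xi>"
        by (simp add: eq3 Q_def)
    qed
    then have "tbound (restr {x. R2 < \<bar>snd x\<bar>} f3) (e / 4 / (Q + 1) * Q)"
      by (rule real_tail_bound[OF a2 fsf(3) _ Q _ R2])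
         (auto simp: f3_def f2_def restr_def split: if_splits)
    moreover have "e / 4 / (Q + 1) * Q \<le> e / 4" using e Q by (simp add: field_simps)
    ultimately have b4: "tbound (restr {x. R2 < \<bar>snd x\<bar>} f3) (e / 4)" by (rule tbound_mono)
    have eq: "restr (- ?S) f = (\<lambda>x. ((restr {x. fst x \<notin> H m} f x + ?c1 (restr {x. snd x \<notin> H m} f) x)
      + restr {x. R1 < \<bar>fst x\<bar>} f2 x) + restr {x. R2 < \<bar>snd x\<bar>} f3 x)"
      by (rule ext) (auto simp: restr_def f2_def f3_def A1_def A2_def)
    have "tbound (restr (- ?S) f) (((e / 4 + e / 4) + e / 4) + e / 4)"
      unfolding eq by (intro tbound_add b1 b2 b3 b4 fs_add fs_restr f fsf)
    then have "tbound (restr (- ?S) f) e" by simp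
    then show ?thesis using e by (intro bnd_lop fs_restr f tboundD) auto
  qed
  moreover have "?S \<subseteq> Gam p" by (auto simp: A1_def A2_def Gam_def intro: H_Zp)
  ultimately show "\<exists>S. finite S \<and> S \<subseteq> Gam p \<and>
      (\<forall>f\<in>fs. lipr f \<le> 1 \<longrightarrow> bnd (Gam p) (lop (restr (- S) f)) e)"
    using A1 A2 by (intro exI[of _ ?S]) auto
qed

section \<open>Identification with the concrete algebra and seminorm\<close>

lemma fs_eq_CC: "fs = CC p"
  by (simp add: fs_def CC_def)

lemma lop_eq_lam: "lop = lam p \<theta>"
  by (simp add: lop_def lam_def tconv_def fun_eq_iff)

lemma alg_eq: "alg = Atheta p \<theta>"
  by (simp add: alg_def Atheta_def fs_eq_CC lop_eq_lam)

lemma sadom_eq: "sadom = domL p \<theta>"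
  by (simp add: sadom_def domL_def fs_eq_CC lop_eq_lam)

lemma Lip_eq: "Lip = LD p"
  by (simp add: Lip_def LD_def Dp_def fs_eq_CC fun_eq_iff)

end

theorem theorem3p14:
  fixes p :: nat and \<theta> :: "nat \<Rightarrow> real"
  assumes "prime p" and "\<theta> \<in> Omega p"
  shows "leibniz_qcms (Gam p) (Atheta p \<theta>) (domL p \<theta>) (LD p)"
proof -
  interpret solenoid p \<theta> using assms by unfold_locales
  show ?thesis
    using leibniz_qcms_of_uniform_tails[OF uniform_tails] by (simp add: alg_eq sadom_eq Lip_eq)
qed

end
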